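(* Let $m$ be a positive integer. For any odd positive integer $n\geq 3$, we have $$\mathfrak{d}_m^{\mathrm{sd}}(\mathfrak{so}_{2n})\leq\omega(m)\exp\left(-\frac{n}{16m}\right).$$
   Context: $\omega(m)$ is the number of distinct prime factors of $m$. For a complex semisimple Lie algebra $\mathfrak{g}$ with weight lattice $\Lambda$ (for a fixed Cartan subalgebra and positive system), let $\rho$ be the half-sum of positive roots and $w_0$ the longest Weyl group element. Let $\mathscr{D}:\Lambda\to\mathbb{Z}$ be the Weyl dimension polynomial $$\mathscr{D}(\lambda)=\prod_{\alpha>0}\frac{\langle\lambda+\rho,\alpha^\vee\rangle}{\langle\rho,\alpha^\vee\rangle},$$ which is integer-valued on $\Lambda$ and, for dominant $\lambda$, equals the degree of the irreducible representation of highest weight $\lambda$. Put $$\Lambda_m=\{\lambda\in\Lambda : m\nmid\mathscr{D}(\lambda)\},\qquad \Lambda_{\mathrm{sd}}=\{\lambda\in\Lambda : w_0\lambda=-\lambda\}.$$ (The dominant members of $\Lambda_{\mathrm{sd}}$ are the highest weights of the irreducible self-dual representations.) For a finite-rank free $\mathbb{Z}$-module $L$ and a subset $A\subseteq L$ with $A+\varpi L=A$ for some positive integer $\varpi$, put $$\mathfrak{d}(A\mid L)=\lim_{r\to\infty}\frac{\#\{a\in A : N(a)<r\}}{\#\{v\in L : N(v)<r\}},$$ where $N$ is any norm on $L\otimes_{\mathbb{Z}}\mathbb{R}$; the limit exists and is independent of $N$. Define $$\mathfrak{d}_m^{\mathrm{sd}}(\mathfrak{g})=\mathfrak{d}(\Lambda_m\cap\Lambda_{\mathrm{sd}}\mid\Lambda_{\mathrm{sd}}).$$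 *)

theory Defs
  imports "HOL-Analysis.Analysis" "HOL-Computational_Algebra.Primes" "Jordan_Normal_Form.Matrix"
begin

section \<open>Density of a subset of a lattice\<close>

text \<open>
  Lattices live in the complex vector space of functions \<open>'a \<Rightarrow> complex\<close>, with pointwise
  operations. They are only used when a \<open>\<int>\<close>-basis of \<open>L\<close> is linearly independent over the
  reals, so that \<open>L \<otimes> \<real>\<close> is the real span of \<open>L\<close>.
\<close>

definition real_span :: "('a \<Rightarrow> complex) set \<Rightarrow> ('a \<Rightarrow> complex) set" where
  "real_span L = {v. \<exists>S c. finite S \<and> S \<subseteq> L \<and> v = (\<lambda>x. \<Sum>s\<in>S. complex_of_real (c s) * s x)}"

definition is_norm_on :: "('a \<Rightarrow> complex) set \<Rightarrow> (('a \<Rightarrow> complex) \<Rightarrow> real) \<Rightarrow> bool" where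
  "is_norm_on V N \<longleftrightarrow>
     (\<forall>v\<in>V. N v \<ge> 0 \<and> (N v = 0 \<longleftrightarrow> v = (\<lambda>x. 0))) \<and>
     (\<forall>v\<in>V. \<forall>c::real. N (\<lambda>x. complex_of_real c * v x) = \<bar>c\<bar> * N v) \<and>
     (\<forall>u\<in>V. \<forall>v\<in>V. N (\<lambda>x. u x + v x) \<le> N u + N v)"

definition has_lattice_density ::
    "('a \<Rightarrow> complex) set \<Rightarrow> ('a \<Rightarrow> complex) set \<Rightarrow> real \<Rightarrow> bool" where
  "has_lattice_density A L d \<longleftrightarrow>
     (\<forall>N. is_norm_on (real_span L) N \<longrightarrow>
        ((\<lambda>r::real. real (card {a \<in> A. N a < r}) / real (card {v \<in> L. N v < r})) \<longlongrightarrow> d) at_top)"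

text \<open>
  The value is meaningful only if the limit exists and is the same for every norm, as it is
  for \<open>A \<subseteq> L\<close> with \<open>A + q L = A\<close> for some positive integer \<open>q\<close>.
\<close>

definition lattice_density :: "('a \<Rightarrow> complex) set \<Rightarrow> ('a \<Rightarrow> complex) set \<Rightarrow> real" where
  "lattice_density A L = (THE d. has_lattice_density A L d)"

section \<open>Roots and weights of a complex semisimple matrix Lie algebra\<close>

definition lie_bracket :: "complex mat \<Rightarrow> complex mat \<Rightarrow> complex mat" where
  "lie_bracket X Y = X * Y - Y * X"

type_synonym functional = "complex mat \<Rightarrow> complex"

text \<open>Functionals on \<open>h\<close> vanish outside \<open>h\<close>, so that equality of functionals is equality on \<open>h\<close>.\<close>

definition dual_space :: "complex mat set \<Rightarrow> functional set" where
  "dual_space h = {l.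
     (\<forall>X\<in>h. \<forall>Y\<in>h. l (X + Y) = l X + l Y) \<and>
     (\<forall>c. \<forall>X\<in>h. l (c \<cdot>\<^sub>m X) = c * l X) \<and>
     (\<forall>X. X \<notin> h \<longrightarrow> l X = 0)}"

text \<open>
  Below, \<open>g\<close> is a complex semisimple Lie algebra of square matrices, \<open>h\<close> a Cartan subalgebra
  of it and \<open>P\<close> a system of positive roots.
\<close>

definition root_space :: "complex mat set \<Rightarrow> complex mat set \<Rightarrow> functional \<Rightarrow> complex mat set" where
  "root_space g h a = {X \<in> g. \<forall>H\<in>h. lie_bracket H X = a H \<cdot>\<^sub>m X}"

definition roots :: "complex mat set \<Rightarrow> complex mat set \<Rightarrow> functional set" where
  "roots g h = {a \<in> dual_space h. a \<noteq> (\<lambda>X. 0) \<and>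
     (\<exists>X \<in> root_space g h a. X \<noteq> 0\<^sub>m (dim_row X) (dim_col X))}"

text \<open>
  The coroot of \<open>a\<close> is the element of \<open>[g\<^sub>a, g\<^sub>-\<^sub>a] \<subseteq> h\<close> on which \<open>a\<close> takes the value 2. As the
  root spaces are one-dimensional, every element of \<open>[g\<^sub>a, g\<^sub>-\<^sub>a]\<close> is a single bracket. The
  pairing of a functional \<open>l\<close> with the coroot is evaluation of \<open>l\<close> at it.
\<close>

definition coroot :: "complex mat set \<Rightarrow> complex mat set \<Rightarrow> functional \<Rightarrow> complex mat" where
  "coroot g h a = (THE H.
     (\<exists>X \<in> root_space g h a. \<exists>Y \<in> root_space g h (\<lambda>Z. - a Z). H = lie_bracket X Y) \<and> a H = 2)"

definition weight_lattice :: "complex mat set \<Rightarrow> complex mat set \<Rightarrow> functional set" where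
  "weight_lattice g h = {l \<in> dual_space h. \<forall>a \<in> roots g h. l (coroot g h a) \<in> \<int>}"

definition half_sum :: "functional set \<Rightarrow> functional" where
  "half_sum P = (\<lambda>X. (\<Sum>a\<in>P. a X) / 2)"

text \<open>Integer-valued on the weight lattice.\<close>

definition weyl_dim ::
    "complex mat set \<Rightarrow> complex mat set \<Rightarrow> functional set \<Rightarrow> functional \<Rightarrow> complex" where
  "weyl_dim g h P l =
     (\<Prod>a\<in>P. (l (coroot g h a) + half_sum P (coroot g h a)) / half_sum P (coroot g h a))"

definition weights_not_dvd ::
    "complex mat set \<Rightarrow> complex mat set \<Rightarrow> functional set \<Rightarrow> nat \<Rightarrow> functional set" where
  "weights_not_dvd g h P m =
     {l \<in> weight_lattice g h. \<nexists>k::int. weyl_dim g h P l = of_nat m * of_int k}"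

text \<open>Reflections of \<open>dual_space h\<close>, extended by the identity to the whole type.\<close>

definition reflection ::
    "complex mat set \<Rightarrow> complex mat set \<Rightarrow> functional \<Rightarrow> functional \<Rightarrow> functional" where
  "reflection g h a l =
     (if l \<in> dual_space h then (\<lambda>X. l X - l (coroot g h a) * a X) else l)"

definition reflection_word ::
    "complex mat set \<Rightarrow> complex mat set \<Rightarrow> functional list \<Rightarrow> functional \<Rightarrow> functional" where
  "reflection_word g h as = foldr (\<lambda>a w. reflection g h a \<circ> w) as id"

definition weyl_group ::
    "complex mat set \<Rightarrow> complex mat set \<Rightarrow> (functional \<Rightarrow> functional) set" where
  "weyl_group g h = {reflection_word g h as | as. set as \<subseteq> roots g h}"

definition simple_roots :: "functional set \<Rightarrow> functional set" where
  "simple_roots P = {a \<in> P. \<not> (\<exists>b\<in>P. \<exists>c\<in>P. a = (\<lambda>X. b X + c X))}"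

definition weyl_length ::
    "complex mat set \<Rightarrow> complex mat set \<Rightarrow> functional set \<Rightarrow> (functional \<Rightarrow> functional) \<Rightarrow> nat" where
  "weyl_length g h P w =
     (LEAST k. \<exists>as. set as \<subseteq> simple_roots P \<and> length as = k \<and> w = reflection_word g h as)"

definition longest_element ::
    "complex mat set \<Rightarrow> complex mat set \<Rightarrow> functional set \<Rightarrow> functional \<Rightarrow> functional" where
  "longest_element g h P =
     (THE w. w \<in> weyl_group g h \<and> (\<forall>v \<in> weyl_group g h. weyl_length g h P v \<le> weyl_length g h P w))"

definition self_dual_weights ::
    "complex mat set \<Rightarrow> complex mat set \<Rightarrow> functional set \<Rightarrow> functional set" where
  "self_dual_weights g h P =
     {l \<in> weight_lattice g h. longest_element g h P l = (\<lambda>X. - l X)}"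

definition self_dual_density ::
    "complex mat set \<Rightarrow> complex mat set \<Rightarrow> functional set \<Rightarrow> nat \<Rightarrow> real" where
  "self_dual_density g h P m =
     lattice_density (weights_not_dvd g h P m \<inter> self_dual_weights g h P) (self_dual_weights g h P)"

section \<open>The even orthogonal Lie algebras\<close>

text \<open>
  The complex Lie algebra \<open>so(2n)\<close> is realised on the split form \<open>x\<^sub>1 y\<^sub>1 + \<dots> + x\<^sub>n y\<^sub>n\<close>, so that its
  diagonal matrices form a Cartan subalgebra. The positive roots are the usual
  \<open>\<epsilon>\<^sub>i \<plusminus> \<epsilon>\<^sub>j\<close> with \<open>i < j\<close>.
\<close>

definition split_form :: "nat \<Rightarrow> complex mat" where
  "split_form n = four_block_mat (0\<^sub>m n n) (1\<^sub>m n) (1\<^sub>m n) (0\<^sub>m n n)"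

definition so_even :: "nat \<Rightarrow> complex mat set" where
  "so_even n = {X \<in> carrier_mat (2 * n) (2 * n).
     transpose_mat X * split_form n + split_form n * X = 0\<^sub>m (2 * n) (2 * n)}"

definition so_even_cartan :: "nat \<Rightarrow> complex mat set" where
  "so_even_cartan n = {X \<in> so_even n. diagonal_mat X}"

definition coord_functional :: "nat \<Rightarrow> nat \<Rightarrow> functional" where
  "coord_functional n i = (\<lambda>H. if H \<in> so_even_cartan n then H $$ (i, i) else 0)"

definition so_even_positive :: "nat \<Rightarrow> functional set" where
  "so_even_positive n =
     {(\<lambda>H. coord_functional n i H - coord_functional n j H) | i j. i < j \<and> j < n} \<union>
     {(\<lambda>H. coord_functional n i H + coord_functional n j H) | i j. i < j \<and> j < n}"

end

theory Submission
  imports Defs "HOL-Number_Theory.Cong" "HOL-Combinatorics.Permutations"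
    "HOL-Real_Asymp.Real_Asymp" "Jordan_Normal_Form.Determinant"
begin

text \<open>
  For odd \<open>n\<close> the longest element of the Weyl group of type \<open>D\<^sub>n\<close> negates all coordinates but the last.
  The self-dual weights are therefore the integer vectors with last coordinate 0. Put \<open>a = \<lambda> + \<rho>\<close>. The
  dimension polynomial becomes the product of all \<open>a\<^sub>i\<^sup>2 - a\<^sub>j\<^sup>2\<close> with \<open>i < j\<close>, divided by its value at \<open>\<rho>\<close>.
  This is a Vandermonde determinant in the squares, and a change of the polynomial basis turns the
  quotient into the determinant of the integers \<open>P\<^sub>k(a\<^sub>i)\<close>, where
  \<open>P\<^sub>k(x) = (x + k choose 2 k) + (x + k - 1 choose 2 k)\<close> for \<open>k > 0\<close> and \<open>P\<^sub>0 = 1\<close>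
  (\<open>square_vandermonde_det\<close>).

  Let \<open>p ^ e\<close> be the exact power of a prime \<open>p\<close> in \<open>m\<close>, and choose \<open>K\<close> with
  \<open>p ^ K \<le> 2 n - 2 < p ^ (K + 1)\<close>. Modulo \<open>p ^ e\<close>, the values of the \<open>P\<^sub>k\<close> with \<open>k < n\<close> depend only on the argument modulo
  \<open>M = p ^ (K + e)\<close>. So if two of the numbers \<open>a\<^sub>i\<close> agree modulo \<open>M\<close>, two rows of the determinant agree
  modulo \<open>p ^ e\<close> and the dimension is divisible by \<open>p ^ e\<close> (\<open>prime_power_dvd_square_vandermonde\<close>). Thus
  \<open>p ^ e\<close> can only fail to divide the dimension if the \<open>n\<close> residues are distinct, one of them being
  fixed as 0. By the birthday estimate (\<open>card_distinct_residues_le\<close>) the proportion of such vectors is at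
  most \<open>exp (- n (n - 1) / (2 M))\<close>, and \<open>M \<le> (2 n - 2) m\<close> bounds this by \<open>exp (- n / (4 m))\<close>. Summing
  over the primes that divide \<open>m\<close> gives the result.

  Two translations connect this with the definitions. A periodic set in a lattice has, for every norm, the
  density given by its proportion of residue classes (\<open>lattice_density_periodic\<close>). The roots, coroots
  and reflections of the matrix algebra are computed entry by entry, and the longest element is found by counting
  inversions (\<open>longest_element_so_even\<close>).
\<close>

section \<open>The dimension as a determinant of integers\<close>

lemma multiplicity_less_if_less_power:
  fixes p t K :: nat
  assumes "prime p" "0 < t" "t < p ^ Suc K"
  shows "multiplicity p t \<le> K"
proof (rule ccontr)
  assume "\<not> ?thesis"
  hence "p ^ Suc K dvd t" by (intro multiplicity_dvd') auto
  thus False using assms by (auto dest: dvd_imp_le)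
qed

text \<open>
  From \<open>s * (h choose s) = h * (h - 1 choose s - 1)\<close>: cancelling \<open>s\<close> costs at most \<open>p ^ K\<close>, as \<open>s < p ^ Suc K\<close>.
\<close>

lemma prime_power_dvd_choose:
  fixes p h s e K :: nat
  assumes p: "prime p" and s: "0 < s" "s < p ^ Suc K" and h: "p ^ (K + e) dvd h"
  shows "p ^ e dvd (h choose s)"
proof (cases "h choose s = 0")
  case False
  obtain s' where s': "s = Suc s'" using s by (cases s) auto
  have hpos: "h > 0" using False s by (cases h) auto
  then obtain h' where h': "h = Suc h'" by (cases h) auto
  have "s * (h choose s) = h * (h' choose s')"
    unfolding s' h' using Suc_times_binomial_eq[of h' s'] by (simp only: mult.commute)
  with h have dvd: "p ^ (K + e) dvd s * (h choose s)" by simp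
  have "K + e \<le> multiplicity p (s * (h choose s))"
    using dvd False s p by (intro multiplicity_geI) auto
  also have "\<dots> = multiplicity p s + multiplicity p (h choose s)"
    using False s p by (intro prime_elem_multiplicity_mult_distrib) auto
  also have "multiplicity p s \<le> K" using multiplicity_less_if_less_power[OF p] s by blast
  finally show ?thesis by (intro multiplicity_dvd') auto
qed (metis dvd_0_right)

text \<open>
  Vandermonde's identity expands \<open>(x + h) choose t\<close>; every term but the first carries a factor
  \<open>h choose k\<close> with \<open>0 < k \<le> t\<close>.
\<close>

lemma choose_cong_prime_power:
  fixes p x y t e K :: nat
  assumes p: "prime p" and t: "t < p ^ Suc K" and xy: "[x = y] (mod p ^ (K + e))"
  shows "[x choose t = y choose t] (mod p ^ e)"
proof -
  have *: "[(x + h) choose t = x choose t] (mod p ^ e)" if "p ^ (K + e) dvd h" for x h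
  proof -
    have "(x + h) choose t = (\<Sum>k\<le>t. (h choose k) * (x choose (t - k)))"
      by (subst vandermonde) (simp add: add.commute)
    also have "\<dots> = (x choose t) + (\<Sum>k\<in>{..t} - {0}. (h choose k) * (x choose (t - k)))"
      by (subst sum.remove[of _ 0]) auto
    also have "[\<dots> = (x choose t) + 0] (mod p ^ e)"
    proof (rule cong_add)
      have "p ^ e dvd (\<Sum>k\<in>{..t} - {0}. (h choose k) * (x choose (t - k)))"
        using prime_power_dvd_choose[OF p _ _ that] t by (intro dvd_sum dvd_mult2) auto
      thus "[\<dots> = 0] (mod p ^ e)" by (simp add: cong_0_iff)
    qed auto
    finally show ?thesis by simp
  qed
  show ?thesis
  proof (cases "x \<le> y")
    case True
    then obtain h where h: "y = x + h" using le_Suc_ex by blast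
    have "p ^ (K + e) dvd h" using cong_sym[OF xy] h by (simp add: cong_add_lcancel_0_nat cong_0_iff)
    from *[OF this, of x] show ?thesis unfolding h by (rule cong_sym)
  next
    case False
    then obtain h where h: "x = y + h" using le_Suc_ex by (metis nat_le_linear)
    have "p ^ (K + e) dvd h" using xy h by (simp add: cong_add_lcancel_0_nat cong_0_iff)
    from *[OF this, of y] show ?thesis unfolding h .
  qed
qed

text \<open>
  Up to a constant factor these are the polynomials \<open>\<Prod>l<k. x\<^sup>2 - l\<^sup>2\<close>, normalised to take the value 1 at
  \<open>x = k\<close>. They are even in \<open>x\<close> and written through binomial coefficients to make integrality and
  congruences visible.
\<close>

definition even_binomial :: "nat \<Rightarrow> nat \<Rightarrow> int" where
  "even_binomial k x = (if k = 0 then 1 else int ((x + k) choose (2 * k)) + int ((x + k - 1) choose (2 * k)))"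

lemma prod_falling_shift:
  fixes y :: "'a :: comm_ring_1"
  shows "(\<Prod>i<Suc (Suc N). y + 1 - of_nat i) = (y + 1) * (\<Prod>i<N. y - of_nat i) * (y - of_nat N)"
proof -
  have "(\<Prod>i<Suc N. y + 1 - of_nat (Suc i)) = (\<Prod>i<Suc N. y - of_nat i)"
    by (rule prod.cong) (auto simp: algebra_simps)
  thus ?thesis by (subst prod.lessThan_Suc_shift) (simp add: mult.assoc)
qed

text \<open>
  The factors of the falling factorial pair up as \<open>(x - l) (x + l) = x\<^sup>2 - l\<^sup>2\<close>.
\<close>

lemma prod_falling_eq_prod_squares:
  fixes x :: "'a :: comm_ring_1"
  shows "(\<Prod>i<2*k. x + of_nat k - of_nat i) * (x - of_nat k) * x = (\<Prod>l<Suc k. x\<^sup>2 - (of_nat l)\<^sup>2)"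
proof (induction k)
  case (Suc k)
  have e: "2 * Suc k = Suc (Suc (2 * k))" "x + of_nat (Suc k) = x + of_nat k + 1"
    "x + of_nat k - of_nat (2 * k) = x - of_nat k" by simp_all
  have H: "(\<Prod>i<2*Suc k. x + of_nat (Suc k) - of_nat i)
      = (x + of_nat k + 1) * (\<Prod>i<2*k. x + of_nat k - of_nat i) * (x - of_nat k)"
    unfolding e prod_falling_shift ..
  have "(\<Prod>i<2*Suc k. x + of_nat (Suc k) - of_nat i) * (x - of_nat (Suc k)) * x
    = ((\<Prod>i<2*k. x + of_nat k - of_nat i) * (x - of_nat k) * x) * (x\<^sup>2 - (of_nat (Suc k))\<^sup>2)"
    unfolding H by (simp add: algebra_simps power2_eq_square)
  also have "\<dots> = (\<Prod>l<Suc (Suc k). x\<^sup>2 - (of_nat l)\<^sup>2)" by (simp only: Suc prod.lessThan_Suc)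
  finally show ?case .
qed (simp add: power2_eq_square)

text \<open>
  The two falling factorials share all factors but one, and the two remaining factors add up to \<open>2 x\<close>.
\<close>

lemma even_binomial_fact:
  assumes "k > 0"
  shows "even_binomial k x * fact (2 * k) = 2 * (\<Prod>l<k. (int x)\<^sup>2 - (int l)\<^sup>2)"
proof -
  obtain j where j: "k = Suc j" using assms by (cases k) auto
  have *: "rat_of_nat (N choose t) * fact t = (\<Prod>i<t. rat_of_nat N - of_nat i)" for N t
    unfolding binomial_gbinomial gbinomial_mult_fact' by (simp add: lessThan_atLeast0)
  let ?A = "\<Prod>i<2*j. rat_of_nat x + of_nat j - of_nat i"
  have e: "2 * Suc j = Suc (Suc (2 * j))" "rat_of_nat (x + Suc j) = rat_of_nat x + of_nat j + 1"
    "rat_of_nat x + of_nat j - of_nat (2 * j) = of_nat x - of_nat j" by simp_all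
  have 1: "rat_of_nat ((x + k) choose (2 * k)) * fact (2 * k) = (of_nat x + of_nat j + 1) * ?A * (of_nat x - of_nat j)"
    unfolding * j e prod_falling_shift ..
  have 2: "rat_of_nat ((x + k - 1) choose (2 * k)) * fact (2 * k) = ?A * (of_nat x - of_nat j) * (of_nat x - of_nat j - 1)"
    unfolding * j by (simp add: algebra_simps)
  have "rat_of_int (even_binomial k x * fact (2 * k)) = 2 * (?A * (of_nat x - of_nat j) * of_nat x)"
    using 1 2 assms by (simp add: even_binomial_def algebra_simps)
  also have "\<dots> = rat_of_int (2 * (\<Prod>l<k. (int x)\<^sup>2 - (int l)\<^sup>2))"
    unfolding prod_falling_eq_prod_squares j by simp
  finally show ?thesis by (simp only: of_int_eq_iff)
qed

text \<open>
  The constant is read off at \<open>x = k\<close>, where the left factor is 1.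
\<close>

lemma even_binomial_eq:
  "even_binomial k x * (\<Prod>l<k. (int k)\<^sup>2 - (int l)\<^sup>2) = (\<Prod>l<k. (int x)\<^sup>2 - (int l)\<^sup>2)"
proof (cases "k = 0")
  case False
  hence "even_binomial k k = 1" by (simp add: even_binomial_def mult_2 binomial_eq_0)
  with even_binomial_fact[of k k] False
  have c: "fact (2 * k) = 2 * (\<Prod>l<k. (int k)\<^sup>2 - (int l)\<^sup>2)" by simp
  show ?thesis using even_binomial_fact[of k x] False unfolding c by simp
qed (simp add: even_binomial_def)

lemma det_dvd_if_row_dvd:
  fixes A :: "'a :: comm_ring_1 mat"
  assumes A: "A \<in> carrier_mat n n" and i: "i < n" and dvd: "\<And>j. j < n \<Longrightarrow> q dvd A $$ (i, j)"
  shows "q dvd det A"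
  unfolding laplace_expansion_row[OF A i] using dvd by (intro dvd_sum dvd_mult2) auto

lemma det_dvd_if_rows_cong:
  fixes A :: "int mat"
  assumes A: "A \<in> carrier_mat n n" and ij: "i < n" "j < n" "i \<noteq> j"
    and cong: "\<And>k. k < n \<Longrightarrow> q dvd A $$ (i, k) - A $$ (j, k)"
  shows "q dvd det A"
proof -
  have "q dvd det (addrow (-1) i j A)"
    by (rule det_dvd_if_row_dvd[of _ n i]) (use A ij cong in auto)
  thus ?thesis using det_addrow[OF ij(2,3) A] by simp
qed

text \<open>
  Passing from one monic basis of polynomials to another is a unitriangular change of columns.
\<close>

lemma det_monic_basis:
  fixes x :: "nat \<Rightarrow> 'a :: idom"
  assumes deg: "\<And>k. k < n \<Longrightarrow> degree (f k) = k" and monic: "\<And>k. k < n \<Longrightarrow> lead_coeff (f k) = 1"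
  shows "det (mat n n (\<lambda>(i, k). poly (f k) (x i))) = det (mat n n (\<lambda>(i, k). x i ^ k))"
proof -
  let ?X = "mat n n (\<lambda>(i, k). x i ^ k)" and ?T = "mat n n (\<lambda>(j, k). coeff (f k) j)"
  have eq: "mat n n (\<lambda>(i, k). poly (f k) (x i)) = ?X * ?T"
  proof (rule eq_matI)
    fix i k assume "i < dim_row (?X * ?T)" "k < dim_col (?X * ?T)"
    hence ik: "i < n" "k < n" by auto
    have "poly (f k) (x i) = (\<Sum>j\<le>k. coeff (f k) j * x i ^ j)"
      by (simp add: poly_altdef deg ik)
    also have "\<dots> = (\<Sum>j<n. coeff (f k) j * x i ^ j)"
      by (rule sum.mono_neutral_left) (use ik deg[OF ik(2)] in \<open>auto intro!: coeff_eq_0\<close>)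
    finally show "mat n n (\<lambda>(i, k). poly (f k) (x i)) $$ (i, k) = (?X * ?T) $$ (i, k)"
      using ik by (simp add: scalar_prod_def lessThan_atLeast0 mult.commute)
  qed auto
  have "upper_triangular ?T"
    unfolding upper_triangular_def using deg by (auto intro!: coeff_eq_0)
  hence "det ?T = (\<Prod>i = 0..<n. coeff (f i) i)"
    by (subst det_upper_triangular[of _ n]) (auto simp: prod_list_diag_prod)
  also have "\<dots> = 1" using monic by (intro prod.neutral) (simp add: deg)
  finally show ?thesis unfolding eq by (subst det_mult[of _ n]) auto
qed

text \<open>
  The nodes \<open>y\<close> may be chosen freely, because all such bases are monic. With \<open>y = x\<close> the matrix is
  triangular, and the diagonal gives the Vandermonde product.
\<close>

lemma det_newton_basis:
  fixes x y :: "nat \<Rightarrow> 'a :: idom"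
  shows "det (mat n n (\<lambda>(i, k). \<Prod>l<k. x i - y l)) = (\<Prod>k<n. \<Prod>l<k. x k - x l)"
proof -
  have newton: "det (mat n n (\<lambda>(i, k). \<Prod>l<k. x i - z l)) = det (mat n n (\<lambda>(i, k). x i ^ k))" for z :: "nat \<Rightarrow> 'a"
  proof -
    let ?f = "\<lambda>k. \<Prod>l<k. [:- z l, 1:]"
    have "det (mat n n (\<lambda>(i, k). poly (?f k) (x i))) = det (mat n n (\<lambda>(i, k). x i ^ k))"
    proof (rule det_monic_basis)
      show "degree (?f k) = k" for k by (subst degree_prod_eq_sum_degree) auto
      show "lead_coeff (?f k) = 1" for k by (subst lead_coeff_prod) simp
    qed
    thus ?thesis by (simp add: poly_prod)
  qed
  have "det (mat n n (\<lambda>(i, k). \<Prod>l<k. x i - y l)) = det (mat n n (\<lambda>(i, k). \<Prod>l<k. x i - x l))"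
    by (rule trans[OF newton newton[symmetric]])
  also have "\<dots> = (\<Prod>k=0..<n. \<Prod>l<k. x k - x l)"
    by (subst det_lower_triangular[of n]) (auto simp: prod_list_diag_prod)
  finally show ?thesis by (simp add: lessThan_atLeast0)
qed

definition square_vandermonde :: "nat \<Rightarrow> (nat \<Rightarrow> int) \<Rightarrow> int" where
  "square_vandermonde n a = (\<Prod>k<n. \<Prod>l<k. (a k)\<^sup>2 - (a l)\<^sup>2)"

text \<open>
  Integrality of the quotient of Vandermonde products, with the quotient given as an integer
  determinant.
\<close>

lemma square_vandermonde_det:
  "square_vandermonde n (\<lambda>i. int (x i)) =
     det (mat n n (\<lambda>(i, k). even_binomial k (x i))) * square_vandermonde n int"
proof -
  let ?P = "mat n n (\<lambda>(i, k). even_binomial k (x i))"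
  let ?C = "mat n n (\<lambda>(j, k). if j = k then \<Prod>l<k. (int k)\<^sup>2 - (int l)\<^sup>2 else 0)"
  have "square_vandermonde n (\<lambda>i. int (x i)) = det (mat n n (\<lambda>(i, k). \<Prod>l<k. (int (x i))\<^sup>2 - (int l)\<^sup>2))"
    unfolding square_vandermonde_def using det_newton_basis[where x = "\<lambda>i. (int (x i))\<^sup>2" and y = "\<lambda>l. (int l)\<^sup>2" and n = n] by simp
  also have "mat n n (\<lambda>(i, k). \<Prod>l<k. (int (x i))\<^sup>2 - (int l)\<^sup>2) = ?P * ?C"
    by (rule eq_matI) (auto simp: scalar_prod_def if_distrib sum.delta' even_binomial_eq cong: if_cong)
  also have "det (?P * ?C) = det ?P * det ?C" by (rule det_mult[of _ n]) auto
  also have "det ?C = square_vandermonde n int"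
    unfolding square_vandermonde_def
    by (subst det_upper_triangular[of _ n]) (auto simp: prod_list_diag_prod lessThan_atLeast0)
  finally show ?thesis .
qed

lemma square_vandermonde_cong:
  assumes "\<And>i. i < n \<Longrightarrow> [a i = b i] (mod q)"
  shows "[square_vandermonde n a = square_vandermonde n b] (mod q)"
  unfolding square_vandermonde_def
  by (intro cong_prod cong_diff cong_pow) (use assms in auto)

lemma square_vandermonde_int_pos: "square_vandermonde n int > 0"
  unfolding square_vandermonde_def by (intro prod_pos ballI) (auto intro!: power_strict_mono)

text \<open>
  The determinant formula is available for natural numbers; a general integer vector is replaced by
  its residues modulo the divisor, which does not affect divisibility.
\<close>

lemma dvd_square_vandermonde:
  "square_vandermonde n int dvd square_vandermonde n a"
proof -
  let ?C = "square_vandermonde n int"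
  let ?b = "\<lambda>i. nat (a i mod ?C)"
  have C: "?C > 0" by (rule square_vandermonde_int_pos)
  have "[square_vandermonde n a = square_vandermonde n (\<lambda>i. int (?b i))] (mod ?C)"
    by (rule square_vandermonde_cong) (use C in \<open>auto simp: cong_def\<close>)
  thus ?thesis unfolding square_vandermonde_det[of n ?b] 
    by (simp add: cong_dvd_iff)
qed

text \<open>
  If two arguments agree modulo \<open>p ^ (K + e)\<close>, two rows of the determinant agree modulo \<open>p ^ e\<close>:
  the denominators in binomial coefficients of order below \<open>p ^ Suc K\<close> cost at most a factor
  \<open>p ^ K\<close>.
\<close>

lemma prime_power_dvd_square_vandermonde:
  fixes p e K n :: nat
  assumes p: "prime p" and K: "2 * n - 2 < p ^ Suc K"
    and ij: "i < n" "j < n" "i \<noteq> j" and cong: "[a i = a j] (mod int (p ^ (K + e)))"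
  shows "int (p ^ e) * square_vandermonde n int dvd square_vandermonde n a"
proof -
  let ?C = "square_vandermonde n int"
  let ?M = "int (p ^ e) * ?C * int (p ^ (K + e))"
  \<comment> \<open>Natural representatives, chosen modulo a multiple of both moduli that matter: the one of the
    congruence between the two arguments and the one of the divisibility to be shown.\<close>
  define b where "b = (\<lambda>i. nat (a i mod ?M))"
  let ?P = "mat n n (\<lambda>(i, k). even_binomial k (b i))"
  have p0: "p > 0" using p prime_gt_0_nat by blast
  have C: "?C > 0" by (rule square_vandermonde_int_pos)
  hence M: "?M > 0" using p0 by simp
  have b: "[a i = int (b i)] (mod ?M)" for i using M by (simp add: cong_def b_def)
  have "[int (b i) = int (b j)] (mod int (p ^ (K + e)))"
    using cong_dvd_modulus[OF b dvd_triv_right] cong by (meson cong_sym cong_trans)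
  hence bij: "[b i = b j] (mod p ^ (K + e))" by (simp only: cong_int_iff)
  have "int (p ^ e) dvd det ?P"
  proof (rule det_dvd_if_rows_cong[OF mat_carrier ij])
    fix k assume k: "k < n"
    have "[even_binomial k (b i) = even_binomial k (b j)] (mod int (p ^ e))"
    proof (cases "k = 0")
      case False
      have t: "2 * k < p ^ Suc K" using K k by simp
      have 1: "[b i + k = b j + k] (mod p ^ (K + e))"
        by (rule cong_add[OF bij cong_refl])
      have "b i + k - 1 = b i + (k - 1)" "b j + k - 1 = b j + (k - 1)" using False by simp_all
      hence 2: "[b i + k - 1 = b j + k - 1] (mod p ^ (K + e))"
        using cong_add[OF bij cong_refl[of "k - 1"]] by metis
      have "[int ((b i + k) choose (2 * k)) + int ((b i + k - 1) choose (2 * k))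
          = int ((b j + k) choose (2 * k)) + int ((b j + k - 1) choose (2 * k))] (mod int (p ^ e))"
        using choose_cong_prime_power[OF p t 1] choose_cong_prime_power[OF p t 2]
        unfolding cong_int_iff[symmetric] by (rule cong_add)
      thus ?thesis unfolding even_binomial_def using False by simp
    qed (simp add: even_binomial_def)
    thus "int (p ^ e) dvd ?P $$ (i, k) - ?P $$ (j, k)"
      using ij k by (simp add: cong_iff_dvd_diff)
  qed
  hence d: "int (p ^ e) * ?C dvd square_vandermonde n (\<lambda>i. int (b i))"
    unfolding square_vandermonde_det[of n b] by (rule mult_dvd_mono) auto
  have c: "[square_vandermonde n a = square_vandermonde n (\<lambda>i. int (b i))] (mod int (p ^ e) * ?C)"
    by (rule square_vandermonde_cong) (rule cong_dvd_modulus[OF b dvd_triv_left])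
  show ?thesis by (rule iffD2[OF cong_dvd_iff[OF c] d])
qed

section \<open>Counting vectors with distinct residues\<close>

text \<open>
  Vectors with \<open>d\<close> entries are functions that vanish from \<open>d\<close> on, so that pointwise sums and integer
  multiples stay in the set.
\<close>

definition lattice_points :: "nat \<Rightarrow> (nat \<Rightarrow> int) set" where
  "lattice_points d = {c. \<forall>i\<ge>d. c i = 0}"

definition residue_box :: "nat \<Rightarrow> int \<Rightarrow> (nat \<Rightarrow> int) set" where
  "residue_box d q = {c \<in> lattice_points d. \<forall>i<d. 0 \<le> c i \<and> c i < q}"

lemma residue_box_Suc:
  "residue_box (Suc d) q = (\<lambda>(c, x). c(d := x)) ` (residue_box d q \<times> {0..<q})"
proof (intro equalityI subsetI)
  fix c assume c: "c \<in> residue_box (Suc d) q"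
  have "c = (\<lambda>(c, x). c(d := x)) (c(d := 0), c d)" by auto
  moreover have "(c(d := 0), c d) \<in> residue_box d q \<times> {0..<q}"
    using c by (auto simp: residue_box_def lattice_points_def)
  ultimately show "c \<in> (\<lambda>(c, x). c(d := x)) ` (residue_box d q \<times> {0..<q})" by blast
next
  fix c assume "c \<in> (\<lambda>(c, x). c(d := x)) ` (residue_box d q \<times> {0..<q})"
  thus "c \<in> residue_box (Suc d) q"
    by (auto simp: residue_box_def lattice_points_def less_Suc_eq)
qed

lemma inj_on_append_coordinate:
  "inj_on (\<lambda>(c, x). c(d := x)) (lattice_points d \<times> (UNIV :: int set))"
proof (rule inj_onI, clarify)
  fix c c' :: "nat \<Rightarrow> int" and x x'
  assume c: "c \<in> lattice_points d" "c' \<in> lattice_points d" and eq: "c(d := x) = c'(d := x')"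
  have "c i = c' i" for i
    using c fun_cong[OF eq, of i] by (cases "i = d") (auto simp: lattice_points_def)
  thus "c = c' \<and> x = x'" using fun_cong[OF eq, of d] by auto
qed

lemma residue_box_finite_card: "finite (residue_box d q) \<and> card (residue_box d q) = nat q ^ d"
proof (induction d)
  case 0
  have "residue_box 0 q = {\<lambda>_. 0}" by (auto simp: residue_box_def lattice_points_def)
  thus ?case by simp
next
  case (Suc d)
  have "inj_on (\<lambda>(c, x). c(d := x)) (residue_box d q \<times> {0..<q})"
    by (rule inj_on_subset[OF inj_on_append_coordinate]) (auto simp: residue_box_def)
  with Suc show ?case unfolding residue_box_Suc
    by (auto simp: card_image card_cartesian_product)
qed

lemmas finite_residue_box = residue_box_finite_card[THEN conjunct1]
lemmas card_residue_box = residue_box_finite_card[THEN conjunct2]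

text \<open>
  Since \<open>M\<close> divides \<open>q\<close>, an interval of length \<open>q\<close> meets each residue class modulo \<open>M\<close> equally often.
\<close>

lemma card_residue_class:
  fixes M q a :: int
  assumes M: "M > 0" "M dvd q" "q > 0" and a: "0 \<le> a" "a < M"
  shows "card {x \<in> {0..<q}. (x + o') mod M = a} = nat (q div M)"
proof -
  let ?r = "(a - o') mod M"
  have r: "0 \<le> ?r" "?r < M" using M by auto
  have q: "q = M * (q div M)" using M by simp
  have iff: "(x + o') mod M = a \<longleftrightarrow> x mod M = ?r" for x
  proof -
    have "(x + o') mod M = a \<longleftrightarrow> (x + o') mod M = a mod M" using a by simp
    also have "\<dots> \<longleftrightarrow> M dvd (x + o') - a" by (rule mod_eq_dvd_iff)
    also have "(x + o') - a = x - (a - o')" by simp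
    also have "M dvd x - (a - o') \<longleftrightarrow> x mod M = ?r" by (rule mod_eq_dvd_iff[symmetric])
    finally show ?thesis .
  qed
  have "bij_betw (\<lambda>y. ?r + M * y) {0..<q div M} {x \<in> {0..<q}. (x + o') mod M = a}"
  proof (rule bij_betw_byWitness[where f' = "\<lambda>x. x div M"])
    show "\<forall>y\<in>{0..<q div M}. (?r + M * y) div M = y" using r M by simp
    show "\<forall>x\<in>{x \<in> {0..<q}. (x + o') mod M = a}. ?r + M * (x div M) = x"
      unfolding iff by (auto simp: mod_mult_div_eq) (metis mod_mult_div_eq)
    show "(\<lambda>y. ?r + M * y) ` {0..<q div M} \<subseteq> {x \<in> {0..<q}. (x + o') mod M = a}"
    proof (rule image_subsetI)
      fix y assume y: "y \<in> {0..<q div M}"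
      hence "M * (y + 1) \<le> M * (q div M)" using M by (intro mult_left_mono) auto
      hence "?r + M * y < q" using r q by (simp add: algebra_simps)
      thus "?r + M * y \<in> {x \<in> {0..<q}. (x + o') mod M = a}" using y r M unfolding iff by simp
    qed
    show "(\<lambda>x. x div M) ` {x \<in> {0..<q}. (x + o') mod M = a} \<subseteq> {0..<q div M}"
    proof (rule image_subsetI)
      fix x assume x: "x \<in> {x \<in> {0..<q}. (x + o') mod M = a}"
      hence "x < M * (q div M)" using q by simp
      moreover have "M * (x div M) \<le> x" using M pos_mod_sign[of M x] by (simp add: minus_mod_eq_mult_div[symmetric])
      ultimately have "M * (x div M) < M * (q div M)" by simp
      hence "x div M < q div M" by (rule mult_left_less_imp_less) (use M in simp)
      thus "x div M \<in> {0..<q div M}" using x M by (simp add: pos_imp_zdiv_nonneg_iff)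
    qed
  qed
  from bij_betw_same_card[OF this] show ?thesis by simp
qed

definition distinct_residues :: "nat \<Rightarrow> int \<Rightarrow> int \<Rightarrow> (nat \<Rightarrow> int) \<Rightarrow> (nat \<Rightarrow> int) set" where
  "distinct_residues d q M s = {c \<in> residue_box d q.
     inj_on (\<lambda>i. (c i + s i) mod M) {..<d} \<and> (\<forall>i<d. (c i + s i) mod M \<noteq> 0)}"

text \<open>
  Given the first \<open>d\<close> entries, the next one has to avoid \<open>Suc d\<close> residue classes: those already
  taken, and 0.
\<close>

lemma card_distinct_residues_Suc:
  assumes M: "M > 0" "M dvd q" "q > 0"
  shows "real (card (distinct_residues (Suc d) q M s))
    \<le> real (card (distinct_residues d q M s)) * (of_int q * (1 - real (Suc d) / of_int M))"
proof -
  let ?D = "distinct_residues d q M s"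
  let ?R = "\<lambda>c. insert 0 ((\<lambda>i. (c i + s i) mod M) ` {..<d})"
  let ?X = "\<lambda>c. {x \<in> {0..<q}. (x + s d) mod M \<notin> ?R c}"
  have fin: "finite ?D" unfolding distinct_residues_def using finite_residue_box by simp
  have sub: "distinct_residues (Suc d) q M s \<subseteq> (\<lambda>(c, x). c(d := x)) ` (SIGMA c:?D. ?X c)"
  proof
    fix c assume c: "c \<in> distinct_residues (Suc d) q M s"
    let ?c = "c(d := 0)"
    have box: "?c \<in> residue_box d q" using c
      by (auto simp: distinct_residues_def residue_box_def lattice_points_def)
    have cd: "c d \<in> {0..<q}" using c by (auto simp: distinct_residues_def residue_box_def)
    have inj: "inj_on (\<lambda>i. (c i + s i) mod M) {..<Suc d}" and nz: "\<And>i. i < Suc d \<Longrightarrow> (c i + s i) mod M \<noteq> 0"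
      using c by (auto simp: distinct_residues_def)
    have "inj_on (\<lambda>i. (?c i + s i) mod M) {..<d} \<longleftrightarrow> inj_on (\<lambda>i. (c i + s i) mod M) {..<d}"
      by (rule inj_on_cong) auto
    hence "?c \<in> ?D" using box inj nz unfolding distinct_residues_def
      by (auto intro: inj_on_subset)
    moreover have "c d \<in> ?X ?c"
    proof -
      have "(c d + s d) mod M \<noteq> (c i + s i) mod M" if "i < d" for i
        using inj_onD[OF inj, of d i] that by auto
      thus ?thesis using cd nz[of d] by (auto simp: image_iff)
    qed
    moreover have "c = (\<lambda>(c, x). c(d := x)) (?c, c d)" by auto
    ultimately show "c \<in> (\<lambda>(c, x). c(d := x)) ` (SIGMA c:?D. ?X c)" by (intro image_eqI) auto
  qed
  have cardX: "real (card (?X c)) = of_int q * (1 - real (Suc d) / of_int M)" if c: "c \<in> ?D" for c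
  proof -
    have R: "?R c \<subseteq> {0..<M}" using M by auto
    have finR: "finite (?R c)" by simp
    have "card (?R c) = Suc d"
      using c by (subst card_insert_disjoint) (auto simp: distinct_residues_def card_image)
    moreover have "{x \<in> {0..<q}. (x + s d) mod M \<in> ?R c} = (\<Union>a\<in>?R c. {x \<in> {0..<q}. (x + s d) mod M = a})"
      by auto
    hence "card {x \<in> {0..<q}. (x + s d) mod M \<in> ?R c} = (\<Sum>a\<in>?R c. card {x \<in> {0..<q}. (x + s d) mod M = a})"
      by (simp only:) (rule card_UN_disjoint[OF finR], auto intro: finite_subset[of _ "{0..<q}"])
    moreover have "\<dots> = (\<Sum>a\<in>?R c. nat (q div M))"
      by (rule sum.cong[OF refl], rule card_residue_class[OF M]) (use R in auto)
    ultimately have eq: "card {x \<in> {0..<q}. (x + s d) mod M \<in> ?R c} = Suc d * nat (q div M)" by simp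
    have quot: "real (nat (q div M)) = of_int q / of_int M"
      using M by (simp add: real_of_int_div pos_imp_zdiv_nonneg_iff less_imp_le)
    have 1: "real (card {x \<in> {0..<q}. (x + s d) mod M \<in> ?R c}) = real (Suc d) * (of_int q / of_int M)"
      unfolding eq of_nat_mult quot ..
    have "card {0..<q} = card (?X c \<union> {x \<in> {0..<q}. (x + s d) mod M \<in> ?R c})"
      by (rule arg_cong[where f = card]) auto
    also have "\<dots> = card (?X c) + card {x \<in> {0..<q}. (x + s d) mod M \<in> ?R c}"
      by (rule card_Un_disjoint) (auto intro: finite_subset[of _ "{0..<q}"])
    finally have "nat q = card (?X c) + card {x \<in> {0..<q}. (x + s d) mod M \<in> ?R c}" by simp
    hence "real (nat q) = real (card (?X c)) + real (card {x \<in> {0..<q}. (x + s d) mod M \<in> ?R c})"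
      by (simp only: of_nat_add)
    hence "of_int q = real (card (?X c)) + real (Suc d) * (of_int q / of_int M)"
      unfolding 1 using M by simp
    thus ?thesis by (simp add: algebra_simps)
  qed
  have finX: "finite (?X c)" for c by (rule finite_subset[of _ "{0..<q}"]) auto
  have finS: "finite (SIGMA c:?D. ?X c)" by (rule finite_SigmaI[OF fin finX])
  have "card (distinct_residues (Suc d) q M s) \<le> card (SIGMA c:?D. ?X c)"
    by (rule order_trans[OF card_mono[OF finite_imageI[OF finS] sub] card_image_le[OF finS]])
  also have "card (SIGMA c:?D. ?X c) = (\<Sum>c\<in>?D. card (?X c))"
    using fin finX by (intro card_SigmaI) auto
  finally have "real (card (distinct_residues (Suc d) q M s)) \<le> real (\<Sum>c\<in>?D. card (?X c))"
    by (simp only: of_nat_le_iff)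
  also have "\<dots> = (\<Sum>c\<in>?D. of_int q * (1 - real (Suc d) / of_int M))"
    unfolding of_nat_sum by (rule sum.cong[OF refl cardX])
  finally show ?thesis by simp
qed

text \<open>
  The birthday estimate \<open>1 - x \<le> exp (- x)\<close>, multiplied up.
\<close>

lemma card_distinct_residues_le:
  assumes M: "M > 0" "M dvd q" "q > 0"
  shows "real (card (distinct_residues d q M s)) \<le> of_int q ^ d * exp (- (real d * (real d + 1) / (2 * of_int M)))"
proof (induction d)
  case 0
  have "card (distinct_residues 0 q M s) \<le> card (residue_box 0 q)"
    unfolding distinct_residues_def by (rule card_mono[OF finite_residue_box]) auto
  thus ?case by (simp add: card_residue_box)
next
  case (Suc d)
  have "real (card (distinct_residues (Suc d) q M s))
      \<le> real (card (distinct_residues d q M s)) * (of_int q * (1 - real (Suc d) / of_int M))"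
    by (rule card_distinct_residues_Suc[OF M])
  also have "\<dots> \<le> real (card (distinct_residues d q M s)) * (of_int q * exp (- (real (Suc d) / of_int M)))"
    using exp_ge_add_one_self[of "- (real (Suc d) / of_int M)"] M by (intro mult_left_mono) auto
  also have "\<dots> \<le> (of_int q ^ d * exp (- (real d * (real d + 1) / (2 * of_int M)))) * (of_int q * exp (- (real (Suc d) / of_int M)))"
    by (rule mult_right_mono[OF Suc]) (use M in auto)
  also have "\<dots> = of_int q ^ Suc d * exp (- (real d * (real d + 1) / (2 * of_int M)) + - (real (Suc d) / of_int M))"
    by (simp only: exp_add power_Suc mult_ac)
  also have "- (real d * (real d + 1) / (2 * of_int M)) + - (real (Suc d) / of_int M)
      = - (real (Suc d) * (real (Suc d) + 1) / (2 * of_int M))"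
    using M by (simp add: field_simps)
  finally show ?case .
qed

lemma prime_power_bracket:
  fixes p N :: nat
  assumes "p \<ge> 2" "N \<ge> 1"
  obtains K where "p ^ K \<le> N" "N < p ^ Suc K"
proof -
  have fin: "finite {k. p ^ k \<le> N}"
  proof (rule finite_subset)
    show "{k. p ^ k \<le> N} \<subseteq> {..N}"
    proof
      fix k assume "k \<in> {k. p ^ k \<le> N}"
      moreover have "k < p ^ k" using assms by (intro power_gt_expt) auto
      ultimately show "k \<in> {..N}" by simp
    qed
  qed simp
  let ?K = "Max {k. p ^ k \<le> N}"
  have ne: "{k. p ^ k \<le> N} \<noteq> {}" using assms by (auto intro!: exI[of _ 0])
  show ?thesis
  proof (rule that[of ?K])
    show "p ^ ?K \<le> N" using Max_in[OF fin ne] by simp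
    show "N < p ^ Suc ?K" using Max_ge[OF fin, of "Suc ?K"] by (auto simp: not_le[symmetric])
  qed
qed

text \<open>
  Multiplicities are compared prime by prime.
\<close>

lemma exists_prime_power_not_dvd:
  fixes m :: nat and x :: int
  assumes "m > 0" "\<not> int m dvd x"
  obtains p where "p \<in> prime_factors m" "\<not> int (p ^ multiplicity p m) dvd x"
proof -
  have "\<exists>p\<in>prime_factors m. \<not> int (p ^ multiplicity p m) dvd x"
  proof (rule ccontr)
    assume "\<not> ?thesis"
    hence dvd: "int (p ^ multiplicity p m) dvd x" if "p \<in> prime_factors m" for p using that by blast
    have x: "x \<noteq> 0" using assms(2) by auto
    have "m dvd nat \<bar>x\<bar>"
    proof (rule multiplicity_le_imp_dvd)
      fix p :: nat assume p: "prime p"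
      show "multiplicity p m \<le> multiplicity p (nat \<bar>x\<bar>)"
      proof (cases "p \<in> prime_factors m")
        case True
        have "p ^ multiplicity p m dvd nat \<bar>x\<bar>" using dvd[OF True] by (simp add: dvd_nat_abs_iff)
        thus ?thesis using x p by (intro multiplicity_geI) auto
      next
        case False
        hence "\<not> p dvd m" using p assms(1) by (auto simp: in_prime_factors_iff)
        thus ?thesis by (simp add: not_dvd_imp_multiplicity_0)
      qed
    qed (use assms(1) in simp)
    thus False using assms(2) by (simp add: dvd_nat_abs_iff)
  qed
  thus ?thesis using that by blast
qed

section \<open>Densities of periodic sets in lattices\<close>

lemma tendsto_affine_ratio:
  fixes a b c :: real
  shows "((\<lambda>x. (c * x + a) / (x + b)) \<longlongrightarrow> c) at_top"
  by real_asymp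

locale lattice_norm =
  fixes d :: nat and \<nu> :: "(nat \<Rightarrow> int) \<Rightarrow> real"
  assumes triangle: "\<nu> (\<lambda>i. a i + b i) \<le> \<nu> a + \<nu> b"
    and homogeneous: "\<nu> (\<lambda>i. k * a i) = \<bar>of_int k\<bar> * \<nu> a"
    and local: "(\<And>i. i < d \<Longrightarrow> a i = b i) \<Longrightarrow> \<nu> a = \<nu> b"
    and finite_ball: "finite {c \<in> lattice_points d. \<nu> c < r}"
begin

definition ball_count :: "real \<Rightarrow> nat" where
  "ball_count r = card {c \<in> lattice_points d. \<nu> c < r}"

definition box_radius :: real where
  "box_radius = (\<Sum>i<d. \<nu> (\<lambda>j. if j = i then 1 else 0))"

lemma norm_zero: "\<nu> (\<lambda>i. 0) = 0"
  using homogeneous[of 0 "\<lambda>_. 0"] by simp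

lemma norm_minus: "\<nu> (\<lambda>i. - a i) = \<nu> a"
  using homogeneous[of "-1" a] by simp

lemma norm_nonneg: "\<nu> a \<ge> 0"
  using triangle[of a "\<lambda>i. - a i"] by (simp add: norm_minus norm_zero)

lemma box_radius_nonneg: "box_radius \<ge> 0"
  unfolding box_radius_def by (intro sum_nonneg norm_nonneg)

lemma norm_residue_box:
  assumes "a \<in> residue_box d q" shows "\<nu> a \<le> of_int q * box_radius"
proof -
  let ?e = "\<lambda>i j. if j = i then 1 else 0 :: int"
  have "\<nu> (\<lambda>i. if i < k then a i else 0) \<le> (\<Sum>i<k. \<bar>of_int (a i)\<bar> * \<nu> (?e i))" for k
  proof (induction k)
    case (Suc k)
    have "(\<lambda>i. if i < Suc k then a i else 0) = (\<lambda>i. (if i < k then a i else 0) + a k * ?e k i)"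
      by (auto simp: less_Suc_eq)
    thus ?case using triangle[of "\<lambda>i. if i < k then a i else 0" "\<lambda>i. a k * ?e k i"] Suc
      by (simp add: homogeneous)
  qed (simp add: norm_zero)
  from this[of d] have "\<nu> a \<le> (\<Sum>i<d. \<bar>of_int (a i)\<bar> * \<nu> (?e i))"
    using local[of "\<lambda>i. if i < d then a i else 0" a] by simp
  also have "\<dots> \<le> (\<Sum>i<d. of_int q * \<nu> (?e i))"
    by (intro sum_mono mult_right_mono norm_nonneg) (use assms in \<open>auto simp: residue_box_def\<close>)
  finally show ?thesis by (simp add: box_radius_def sum_distrib_left)
qed

lemma ball_count_mono: "r \<le> s \<Longrightarrow> ball_count r \<le> ball_count s"
  unfolding ball_count_def by (intro card_mono finite_ball) auto

lemma ball_count_pos: "r > 0 \<Longrightarrow> ball_count r \<ge> 1"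
proof -
  assume "r > 0"
  hence "(\<lambda>_. 0) \<in> {c \<in> lattice_points d. \<nu> c < r}" by (simp add: norm_zero lattice_points_def)
  thus ?thesis unfolding ball_count_def using finite_ball[of r]
    by (metis One_nat_def Suc_leI card_gt_0_iff empty_iff)
qed

definition class_ball :: "int \<Rightarrow> (nat \<Rightarrow> int) \<Rightarrow> real \<Rightarrow> (nat \<Rightarrow> int) set" where
  "class_ball q a r = {c \<in> lattice_points d. \<nu> c < r \<and> (\<lambda>i. c i mod q) = a}"

lemma finite_class_ball: "finite (class_ball q a r)"
  by (rule finite_subset[OF _ finite_ball[of r]]) (auto simp: class_ball_def)

lemma card_class_ball_bounds:
  assumes q: "q > 0" and a: "a \<in> residue_box d q"
  shows "ball_count (r / of_int q - box_radius) \<le> card (class_ball q a r)"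
    and "card (class_ball q a r) \<le> ball_count (r / of_int q + box_radius)"
proof -
  let ?f = "\<lambda>e i. a i + q * e i"
  have inj: "inj_on ?f S" for S
    by (rule inj_onI) (use q in \<open>auto simp: fun_eq_iff\<close>)
  have az: "a i = 0" if "i \<ge> d" for i using a that by (auto simp: residue_box_def lattice_points_def)
  have ab: "0 \<le> a i \<and> a i < q" for i
    using a az[of i] q by (cases "i < d") (auto simp: residue_box_def)
  have fin: "finite {c \<in> lattice_points d. \<nu> c < s}" for s by (rule finite_ball)
  have "?f ` {e \<in> lattice_points d. \<nu> e < r / of_int q - box_radius} \<subseteq> class_ball q a r"
  proof (rule image_subsetI)
    fix e assume e: "e \<in> {e \<in> lattice_points d. \<nu> e < r / of_int q - box_radius}"
    have "\<nu> (?f e) \<le> of_int q * box_radius + of_int q * \<nu> e"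
      using triangle[of a "\<lambda>i. q * e i"] norm_residue_box[OF a] q by (simp add: homogeneous)
    also have "\<dots> < r" using e q by (simp add: field_simps)
    finally show "?f e \<in> class_ball q a r"
      using e ab by (auto simp: class_ball_def lattice_points_def az)
  qed
  from card_mono[OF finite_class_ball this] 
  show "ball_count (r / of_int q - box_radius) \<le> card (class_ball q a r)"
    by (simp add: card_image[OF inj] ball_count_def)
  have "class_ball q a r \<subseteq> ?f ` {e \<in> lattice_points d. \<nu> e < r / of_int q + box_radius}"
  proof
    fix c assume c: "c \<in> class_ball q a r"
    let ?e = "\<lambda>i. c i div q"
    have am: "c i mod q = a i" for i using c by (auto simp: class_ball_def)
    have ce: "c i = a i + q * ?e i" for i unfolding am[symmetric] by simp
    have "q * ?e i = c i + - a i" for i using ce[of i] by linarith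
    hence "of_int q * \<nu> ?e = \<nu> (\<lambda>i. c i + - a i)"
      using homogeneous[of q ?e] q by simp
    also have "\<dots> \<le> \<nu> c + \<nu> a" using triangle[of c "\<lambda>i. - a i"] by (simp add: norm_minus)
    also have "\<dots> < r + of_int q * box_radius"
      using c norm_residue_box[OF a] by (auto simp: class_ball_def)
    finally have "\<nu> ?e < r / of_int q + box_radius" using q by (simp add: field_simps)
    moreover have "?e \<in> lattice_points d" using c by (auto simp: class_ball_def lattice_points_def)
    ultimately show "c \<in> ?f ` {e \<in> lattice_points d. \<nu> e < r / of_int q + box_radius}"
      using ce by (intro image_eqI[of _ _ ?e]) auto
  qed
  from card_mono[OF finite_imageI[OF fin] this] 
  show "card (class_ball q a r) \<le> ball_count (r / of_int q + box_radius)"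
    by (simp add: card_image[OF inj] ball_count_def)
qed

lemma card_classes:
  assumes "F \<subseteq> residue_box d q"
  shows "card {c \<in> lattice_points d. \<nu> c < r \<and> (\<lambda>i. c i mod q) \<in> F} = (\<Sum>a\<in>F. card (class_ball q a r))"
proof -
  have "{c \<in> lattice_points d. \<nu> c < r \<and> (\<lambda>i. c i mod q) \<in> F} = (\<Union>a\<in>F. class_ball q a r)"
    by (auto simp: class_ball_def)
  also have "card \<dots> = (\<Sum>a\<in>F. card (class_ball q a r))"
    by (rule card_UN_disjoint)
       (use assms finite_subset[OF _ finite_residue_box] finite_class_ball in \<open>auto simp: class_ball_def\<close>)
  finally show ?thesis .
qed

text \<open>
  The ball of radius \<open>k s\<close> is the disjoint union of its \<open>k ^ d\<close> residue classes modulo \<open>k\<close>. Each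
  class is a translate of \<open>k\<close> times the lattice by a vector of norm at most \<open>k * box_radius\<close>, so after
  rescaling it contains as many points as a ball whose radius differs from \<open>s\<close> by at most
  \<open>box_radius\<close>.
\<close>

lemma ball_count_scale:
  fixes k :: nat assumes "k > 0"
  shows "k ^ d * ball_count (s - box_radius) \<le> ball_count (of_nat k * s)"
    and "ball_count (of_nat k * s) \<le> k ^ d * ball_count (s + box_radius)"
proof -
  let ?q = "int k"
  have s: "of_nat k * s / of_int ?q = s" using assms by simp
  have "(\<lambda>i. c i mod ?q) \<in> residue_box d ?q" if "c \<in> lattice_points d" for c
    using that assms by (auto simp: residue_box_def lattice_points_def)
  hence "{c \<in> lattice_points d. \<nu> c < of_nat k * s}
      = {c \<in> lattice_points d. \<nu> c < of_nat k * s \<and> (\<lambda>i. c i mod ?q) \<in> residue_box d ?q}" by auto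
  hence eq: "ball_count (of_nat k * s) = (\<Sum>a\<in>residue_box d ?q. card (class_ball ?q a (of_nat k * s)))"
    unfolding ball_count_def by (simp add: card_classes)
  have "card (residue_box d ?q) * ball_count (s - box_radius)
      \<le> (\<Sum>a\<in>residue_box d ?q. card (class_ball ?q a (of_nat k * s)))"
    using sum_bounded_below[of "residue_box d ?q" "ball_count (s - box_radius)"]
      card_class_ball_bounds(1)[of ?q _ "of_nat k * s"] assms s by simp
  thus "k ^ d * ball_count (s - box_radius) \<le> ball_count (of_nat k * s)"
    unfolding eq by (simp add: card_residue_box)
  have "(\<Sum>a\<in>residue_box d ?q. card (class_ball ?q a (of_nat k * s)))
      \<le> card (residue_box d ?q) * ball_count (s + box_radius)"
    using sum_bounded_above[of "residue_box d ?q" _ "ball_count (s + box_radius)"]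
      card_class_ball_bounds(2)[of ?q _ "of_nat k * s"] assms s by simp
  thus "ball_count (of_nat k * s) \<le> k ^ d * ball_count (s + box_radius)"
    unfolding eq by (simp add: card_residue_box)
qed

text \<open>
  Choose integers \<open>k s \<le> l t\<close> with \<open>l / k\<close> close to \<open>s / t\<close> and compare the balls of these two radii
  through the scaling estimate.
\<close>

lemma ball_count_compare:
  assumes s: "s > 0" and t: "t > 0"
  shows "real (ball_count (s - box_radius)) / s ^ d \<le> real (ball_count (t + box_radius)) / t ^ d"
proof -
  let ?B = "real (ball_count (s - box_radius))" and ?C = "real (ball_count (t + box_radius))"
  have step: "?B \<le> (s / t + 1 / real (Suc n)) ^ d * ?C" for n
  proof -
    let ?k = "Suc n"
    \<comment> \<open>the least \<open>l\<close> with \<open>k s \<le> l t\<close>\<close>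
    define l where "l = nat \<lceil>real ?k * s / t\<rceil>"
    have p: "real ?k * s / t > 0" using s t by simp
    have l0: "l > 0" using p by (simp add: l_def)
    have l1: "real ?k * s / t \<le> real l" and l2: "real l \<le> real ?k * s / t + 1"
      using p unfolding l_def by linarith+
    have "real ?k ^ d * ?B \<le> real (ball_count (real ?k * s))"
      using ball_count_scale(1)[of ?k s] by (simp only: of_nat_power[symmetric] of_nat_mult[symmetric] of_nat_le_iff)
    also have "\<dots> \<le> real (ball_count (real l * t))"
      using l1 t by (simp only: of_nat_le_iff) (intro ball_count_mono, simp add: field_simps)
    also have "\<dots> \<le> real l ^ d * ?C"
      using ball_count_scale(2)[OF l0, of t] by (simp only: of_nat_power[symmetric] of_nat_mult[symmetric] of_nat_le_iff)
    also have "\<dots> \<le> (real ?k * s / t + 1) ^ d * ?C"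
      by (intro mult_right_mono power_mono l2) auto
    also have "real ?k * s / t + 1 = real ?k * (s / t + 1 / real ?k)" by (simp add: field_simps)
    also have "\<dots> ^ d * ?C = real ?k ^ d * ((s / t + 1 / real ?k) ^ d * ?C)"
      by (simp add: power_mult_distrib)
    finally show ?thesis by (subst (asm) mult_le_cancel_left_pos) auto
  qed
  have "(\<lambda>n. (s / t + 1 / real (Suc n)) ^ d * ?C) \<longlonglongrightarrow> (s / t + 0) ^ d * ?C"
    by (intro tendsto_intros LIMSEQ_Suc lim_1_over_n)
  hence "?B \<le> (s / t) ^ d * ?C"
    using step by (intro LIMSEQ_le_const[of _ "(s / t) ^ d * ?C"]) auto
  thus ?thesis using s t by (simp add: field_simps power_divide)
qed

text \<open>
  A Fekete argument in place of volumes: the normalised lower counts never exceed the normalised upper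
  counts, so a single constant \<open>\<gamma>\<close> (the infimum of the latter) separates them. It is the
  volume of the unit ball in units of the covolume of the lattice.
\<close>

lemma ball_count_growth:
  obtains \<gamma> where "\<gamma> > 0"
    "\<And>y. y > box_radius \<Longrightarrow> \<gamma> * (y - box_radius) ^ d \<le> real (ball_count y)"
    "\<And>y. y > 0 \<Longrightarrow> real (ball_count y) \<le> \<gamma> * (y + box_radius) ^ d"
proof -
  let ?f = "\<lambda>t. real (ball_count (t + box_radius)) / t ^ d"
  define \<gamma> where "\<gamma> = Inf (?f ` {0<..})"
  have lower: "\<gamma> \<le> ?f t" if "t > 0" for t
    unfolding \<gamma>_def by (rule cInf_lower) (use that in \<open>auto intro!: bdd_belowI[of _ 0]\<close>)
  have upper: "real (ball_count (s - box_radius)) / s ^ d \<le> \<gamma>" if "s > 0" for s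
    unfolding \<gamma>_def by (rule cInf_greatest) (use that ball_count_compare in auto)
  show ?thesis
  proof (rule that)
    have "0 < real (ball_count 1) / (1 + box_radius) ^ d"
      using ball_count_pos[of 1] box_radius_nonneg by simp
    also have "\<dots> \<le> \<gamma>" using upper[of "1 + box_radius"] box_radius_nonneg by simp
    finally show "\<gamma> > 0" .
    show "\<gamma> * (y - box_radius) ^ d \<le> real (ball_count y)" if "y > box_radius" for y
      using lower[of "y - box_radius"] that by (simp add: field_simps)
    show "real (ball_count y) \<le> \<gamma> * (y + box_radius) ^ d" if "y > 0" for y
      using upper[of "y + box_radius"] that box_radius_nonneg by (simp add: field_simps)
  qed
qed

text \<open>
  The count lies between those for the balls of radius \<open>r / q - box_radius\<close> and
  \<open>r / q + box_radius\<close>, and bounded changes of the radius do not affect the leading term of the growth.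
\<close>

lemma class_ball_ratio:
  assumes q: "q > 0" and a: "a \<in> residue_box d q"
  shows "((\<lambda>r. real (card (class_ball q a r)) / real (ball_count r)) \<longlongrightarrow> (1 / of_int q) ^ d) at_top"
proof -
  obtain \<gamma> where \<gamma>: "\<gamma> > 0"
    "\<And>y. y > box_radius \<Longrightarrow> \<gamma> * (y - box_radius) ^ d \<le> real (ball_count y)"
    "\<And>y. y > 0 \<Longrightarrow> real (ball_count y) \<le> \<gamma> * (y + box_radius) ^ d"
    using ball_count_growth by blast
  let ?Q = "real_of_int q" and ?R = box_radius
  have Q: "?Q > 0" using q by simp
  have R: "?R \<ge> 0" by (rule box_radius_nonneg)
  have ev: "\<forall>\<^sub>F r in at_top. r > ?Q * (2 * ?R + 1) \<and> r > ?R + 1"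
    by (intro eventually_conj eventually_gt_at_top)
  show ?thesis
  proof (rule tendsto_sandwich)
    show "\<forall>\<^sub>F r in at_top. ((r / ?Q - 2 * ?R) / (r + ?R)) ^ d \<le> real (card (class_ball q a r)) / real (ball_count r)"
      using ev
    proof eventually_elim
      case (elim r)
      have y: "r / ?Q - ?R > ?R" "r > 0" using elim Q R by (auto simp: field_simps)
      have "\<gamma> * (r / ?Q - 2 * ?R) ^ d \<le> real (card (class_ball q a r))"
        using \<gamma>(2)[OF y(1)] card_class_ball_bounds(1)[OF q a, of r] by (simp add: algebra_simps)
      moreover have "real (ball_count r) \<le> \<gamma> * (r + ?R) ^ d" using \<gamma>(3)[of r] y by simp
      moreover have "real (ball_count r) > 0" using ball_count_pos[of r] y by simp
      ultimately have "\<gamma> * (r / ?Q - 2 * ?R) ^ d / (\<gamma> * (r + ?R) ^ d) \<le> real (card (class_ball q a r)) / real (ball_count r)"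
        using \<gamma>(1) by (intro frac_le) auto
      thus ?case using \<gamma>(1) by (simp add: power_divide)
    qed
    show "\<forall>\<^sub>F r in at_top. real (card (class_ball q a r)) / real (ball_count r) \<le> ((r / ?Q + 2 * ?R) / (r - ?R)) ^ d"
      using ev
    proof eventually_elim
      case (elim r)
      have r0: "r > ?R" "r > 0" using elim R by auto
      hence y: "r / ?Q + ?R > 0" "r > ?R" "r > 0" using Q R by (auto intro: add_pos_nonneg)
      have "real (card (class_ball q a r)) \<le> \<gamma> * (r / ?Q + 2 * ?R) ^ d"
        using \<gamma>(3)[OF y(1)] card_class_ball_bounds(2)[OF q a, of r] by (simp add: algebra_simps)
      moreover have "\<gamma> * (r - ?R) ^ d \<le> real (ball_count r)" using \<gamma>(2)[of r] y by simp
      moreover have "\<gamma> * (r - ?R) ^ d > 0" using \<gamma>(1) y by simp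
      ultimately have "real (card (class_ball q a r)) / real (ball_count r) \<le> \<gamma> * (r / ?Q + 2 * ?R) ^ d / (\<gamma> * (r - ?R) ^ d)"
        by (intro frac_le) (auto intro: order_trans[OF of_nat_0_le_iff])
      thus ?case using \<gamma>(1) by (simp add: power_divide)
    qed
    have "((\<lambda>r. (r / ?Q - 2 * ?R) / (r + ?R)) \<longlongrightarrow> 1 / ?Q) at_top"
      using tendsto_affine_ratio[of "1 / ?Q" "- (2 * ?R)" ?R] by simp
    thus "((\<lambda>r. ((r / ?Q - 2 * ?R) / (r + ?R)) ^ d) \<longlongrightarrow> (1 / ?Q) ^ d) at_top" by (rule tendsto_power)
    have "((\<lambda>r. (r / ?Q + 2 * ?R) / (r - ?R)) \<longlongrightarrow> 1 / ?Q) at_top"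
      using tendsto_affine_ratio[of "1 / ?Q" "2 * ?R" "- ?R"] by simp
    thus "((\<lambda>r. ((r / ?Q + 2 * ?R) / (r - ?R)) ^ d) \<longlongrightarrow> (1 / ?Q) ^ d) at_top" by (rule tendsto_power)
  qed
qed

lemma periodic_ratio:
  assumes q: "q > 0" and F: "F \<subseteq> residue_box d q"
  shows "((\<lambda>r. real (card {c \<in> lattice_points d. \<nu> c < r \<and> (\<lambda>i. c i mod q) \<in> F})
            / real (card {c \<in> lattice_points d. \<nu> c < r})) \<longlongrightarrow> real (card F) / of_int q ^ d) at_top"
proof -
  have "((\<lambda>r. \<Sum>a\<in>F. real (card (class_ball q a r)) / real (ball_count r)) \<longlongrightarrow> (\<Sum>a\<in>F. (1 / of_int q) ^ d)) at_top"
    by (intro tendsto_sum class_ball_ratio[OF q]) (use F in auto)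
  thus ?thesis unfolding card_classes[OF F] ball_count_def[symmetric]
    by (simp add: sum_divide_distrib power_divide)
qed

end

definition lattice_embedding :: "(nat \<Rightarrow> 'a \<Rightarrow> complex) \<Rightarrow> nat \<Rightarrow> (nat \<Rightarrow> real) \<Rightarrow> 'a \<Rightarrow> complex" where
  "lattice_embedding b d x = (\<lambda>y. \<Sum>i<d. of_real (x i) * b i y)"

lemma compact_product_real:
  fixes S :: "nat \<Rightarrow> real set"
  assumes "\<And>i. compact (S i)"
  shows "compact (PiE UNIV S)"
  using assms compactin_PiE[of "\<lambda>_. euclidean" UNIV S] 
  by (simp add: euclidean_product_topology)

text \<open>
  Equivalence of norms in finite dimension: the norm is continuous for the product topology and
  positive on the boundary of the unit cube, which is a finite union of compact faces.
\<close>

lemma norm_lower_bound_on_coordinates: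
  fixes f :: "(nat \<Rightarrow> real) \<Rightarrow> real"
  assumes tri: "\<And>x y. f (\<lambda>i. x i + y i) \<le> f x + f y"
    and hom: "\<And>k x. f (\<lambda>i. k * x i) = \<bar>k\<bar> * f x"
    and local: "\<And>x y. (\<And>i. i < d \<Longrightarrow> x i = y i) \<Longrightarrow> f x = f y"
    and pos: "\<And>x i. i < d \<Longrightarrow> x i \<noteq> 0 \<Longrightarrow> f x > 0"
  obtains m where "m > 0" "\<And>x i. i < d \<Longrightarrow> m * \<bar>x i\<bar> \<le> f x"
proof -
  let ?e = "\<lambda>i j. if j = i then 1 else 0 :: real"
  have f0: "f (\<lambda>i. 0) = 0" using hom[of 0 "\<lambda>_. 0"] by simp
  have sum: "f x \<le> (\<Sum>i<d. \<bar>x i\<bar> * f (?e i))" for x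
  proof -
    have "f (\<lambda>i. if i < k then x i else 0) \<le> (\<Sum>i<k. \<bar>x i\<bar> * f (?e i))" for k
    proof (induction k)
      case (Suc k)
      have "(\<lambda>i. if i < Suc k then x i else 0) = (\<lambda>i. (if i < k then x i else 0) + x k * ?e k i)"
        by (auto simp: less_Suc_eq)
      thus ?case using tri[of "\<lambda>i. if i < k then x i else 0" "\<lambda>i. x k * ?e k i"] Suc
        by (simp add: hom)
    qed (simp add: f0)
    from this[of d] show ?thesis using local[of "\<lambda>i. if i < d then x i else 0" x] by simp
  qed
  have diff: "f x - f y \<le> (\<Sum>i<d. \<bar>x i - y i\<bar> * f (?e i))" for x y
    using tri[of "\<lambda>i. x i - y i" y] sum[of "\<lambda>i. x i - y i"] by simp
  have dist: "\<bar>f x - f y\<bar> \<le> (\<Sum>i<d. \<bar>x i - y i\<bar> * f (?e i))" for x y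
    using diff[of x y] diff[of y x] by (simp add: abs_minus_commute)
  have cont: "continuous_on UNIV f"
    unfolding continuous_on_def
  proof
    fix x :: "nat \<Rightarrow> real"
    have coord: "((\<lambda>y. y i) \<longlongrightarrow> x i) (at x)" for i
    proof -
      have "continuous_on UNIV (\<lambda>y :: nat \<Rightarrow> real. y i)" by (rule continuous_on_product_coordinates)
      thus ?thesis unfolding continuous_on_def by blast
    qed
    have "((\<lambda>y. \<Sum>i<d. \<bar>y i - x i\<bar> * f (?e i)) \<longlongrightarrow> (\<Sum>i<d. \<bar>x i - x i\<bar> * f (?e i))) (at x)"
      by (intro tendsto_intros coord)
    hence "((\<lambda>y. \<Sum>i<d. \<bar>y i - x i\<bar> * f (?e i)) \<longlongrightarrow> 0) (at x)" by simp
    hence "((\<lambda>y. f y - f x) \<longlongrightarrow> 0) (at x)"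
      by (rule Lim_null_comparison[rotated]) (use dist in auto)
    thus "(f \<longlongrightarrow> f x) (at x within UNIV)" by (simp add: LIM_zero_iff)
  qed
  \<comment> \<open>The boundary of the unit cube is covered by its faces, where some coordinate is 1 or -1.\<close>
  have face: "\<exists>m>0. \<forall>x. (\<forall>j. \<bar>x j\<bar> \<le> 1) \<and> \<bar>x i\<bar> = 1 \<longrightarrow> m \<le> f x" if i: "i < d" for i
  proof -
    let ?S = "PiE UNIV (\<lambda>j. if j = i then {-1, 1} else {-1..1 :: real})"
    have "compact ?S" by (rule compact_product_real) auto
    moreover have "(\<lambda>_. 1) \<in> ?S" by auto
    moreover have "continuous_on ?S f" using cont continuous_on_subset by blast
    ultimately obtain x where x: "x \<in> ?S" "\<And>y. y \<in> ?S \<Longrightarrow> f x \<le> f y"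
      using continuous_attains_inf[of ?S f] by blast
    have "x i \<in> {-1, 1}" using PiE_mem[OF x(1), of i] by simp
    hence "f x > 0" using pos[OF i, of x] by auto
    moreover have "f x \<le> f y" if "\<forall>j. \<bar>y j\<bar> \<le> 1" "\<bar>y i\<bar> = 1" for y
    proof (rule x(2), rule PiE_I)
      show "y j \<in> (if j = i then {-1, 1} else {-1..1})" for j
        using that(1)[rule_format, of j] that(2) by (auto simp: abs_le_iff)
    qed auto
    ultimately show ?thesis by blast
  qed
  define M where "M = (\<lambda>i. SOME m. m > 0 \<and> (\<forall>x. (\<forall>j. \<bar>x j\<bar> \<le> 1) \<and> \<bar>x i\<bar> = 1 \<longrightarrow> m \<le> f x))"
  have M: "M i > 0" "(\<forall>j. \<bar>x j\<bar> \<le> 1) \<Longrightarrow> \<bar>x i\<bar> = 1 \<Longrightarrow> M i \<le> f x" if "i < d" for i x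
    using someI_ex[OF face[OF that, unfolded Bex_def]] unfolding M_def by simp_all
  define m where "m = Min (insert 1 (M ` {..<d}))"
  have m0: "m > 0" unfolding m_def using M(1) by (subst Min_gr_iff) auto
  have mM: "m \<le> M i" if "i < d" for i unfolding m_def using that by (intro Min_le) auto
  show ?thesis
  proof (rule that[OF m0])
    fix x :: "nat \<Rightarrow> real" and i assume i: "i < d"
    define y where "y = (\<lambda>j. if j < d then x j else 0)"
    have fy: "f y = f x" by (rule local) (simp add: y_def)
    have "Max ((\<lambda>j. \<bar>x j\<bar>) ` {..<d}) \<in> (\<lambda>j. \<bar>x j\<bar>) ` {..<d}" using i by (intro Max_in) auto
    then obtain k where k: "k < d" "\<bar>x k\<bar> = Max ((\<lambda>j. \<bar>x j\<bar>) ` {..<d})" by auto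
    have kmax: "\<bar>x j\<bar> \<le> \<bar>x k\<bar>" if "j < d" for j unfolding k(2) using that by (intro Max_ge) auto
    show "m * \<bar>x i\<bar> \<le> f x"
    proof (cases "x k = 0")
      case True
      hence "x j = 0" if "j < d" for j using kmax[OF that] by simp
      hence "y = (\<lambda>_. 0)" by (auto simp: y_def)
      hence "f y = 0" using f0 by simp
      thus ?thesis using kmax[OF i] True fy by simp
    next
      case False
      let ?t = "\<bar>x k\<bar>"
      have t: "?t > 0" using False by simp
      let ?z = "\<lambda>j. (1 / ?t) * y j"
      have "M k \<le> f ?z"
        by (rule M(2)[of k]) (use kmax t k in \<open>auto simp: y_def abs_mult divide_le_eq\<close>)
      also have "f ?z = f x / ?t" unfolding hom fy using t by simp
      finally have "M k * ?t \<le> f x" using t by (simp add: field_simps)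
      moreover have "m * \<bar>x i\<bar> \<le> M k * ?t" by (intro mult_mono mM k kmax i) (use M(1) k less_imp_le in auto)
      ultimately show ?thesis by linarith
    qed
  qed
qed

lemma real_span_lattice_embedding:
  assumes L: "L = {lattice_embedding b d (\<lambda>i. of_int (c i)) | c. True}"
    and v: "\<And>i. i < d \<Longrightarrow> b i \<in> L" and inj: "inj_on b {..<d}"
  shows "real_span L = range (lattice_embedding b d)"
proof (intro equalityI subsetI)
  fix v assume "v \<in> real_span L"
  then obtain S c where S: "finite S" "S \<subseteq> L" "v = (\<lambda>x. \<Sum>s\<in>S. complex_of_real (c s) * s x)"
    by (auto simp: real_span_def)
  from S(2) have "\<forall>s\<in>S. \<exists>k. s = lattice_embedding b d (\<lambda>i. of_int (k i))" unfolding L by blast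
  then obtain k where k: "\<And>s. s \<in> S \<Longrightarrow> s = lattice_embedding b d (\<lambda>i. of_int (k s i))"
    by metis
  have "v = lattice_embedding b d (\<lambda>i. \<Sum>s\<in>S. c s * of_int (k s i))"
  proof
    fix x
    have "v x = (\<Sum>s\<in>S. complex_of_real (c s) * lattice_embedding b d (\<lambda>i. of_int (k s i)) x)"
      unfolding S(3) using k by (intro sum.cong) auto
    also have "\<dots> = (\<Sum>s\<in>S. \<Sum>i<d. of_real (c s * of_int (k s i)) * b i x)"
      by (simp add: lattice_embedding_def sum_distrib_left mult.assoc)
    also have "\<dots> = lattice_embedding b d (\<lambda>i. \<Sum>s\<in>S. c s * of_int (k s i)) x"
      unfolding lattice_embedding_def by (subst sum.swap) (simp add: sum_distrib_right)
    finally show "v x = lattice_embedding b d (\<lambda>i. \<Sum>s\<in>S. c s * of_int (k s i)) x" .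
  qed
  thus "v \<in> range (lattice_embedding b d)" by blast
next
  fix v assume "v \<in> range (lattice_embedding b d)"
  then obtain x where x: "v = lattice_embedding b d x" by blast
  let ?inv = "the_inv_into {..<d} b"
  have "v = (\<lambda>y. \<Sum>s\<in>b ` {..<d}. complex_of_real (x (?inv s)) * s y)"
    unfolding x lattice_embedding_def
    by (intro ext, subst sum.reindex[OF inj]) (auto intro!: sum.cong simp: the_inv_into_f_f[OF inj])
  moreover have "finite (b ` {..<d})" "b ` {..<d} \<subseteq> L" using v by auto
  ultimately show "v \<in> real_span L" unfolding real_span_def
    by (intro CollectI exI[of _ "b ` {..<d}"] exI[of _ "\<lambda>s. x (?inv s)"] conjI)
qed

text \<open>
  The points \<open>h i\<close> form a dual basis: evaluation at them recovers coordinates, which gives linear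
  independence over the reals as well as one concrete norm. The latter is needed because the
  density is a definite description: without any norm every number would qualify as a density.
\<close>

theorem lattice_density_periodic:
  fixes b :: "nat \<Rightarrow> 'a \<Rightarrow> complex" and h :: "nat \<Rightarrow> 'a"
  assumes dual: "\<And>i j. i < d \<Longrightarrow> j < d \<Longrightarrow> b j (h i) = (if i = j then 1 else 0)"
    and q: "q > 0" and F: "F \<subseteq> residue_box d q"
    and L: "L = {lattice_embedding b d (\<lambda>i. of_int (c i)) | c. c \<in> lattice_points d}"
    and A: "A = {lattice_embedding b d (\<lambda>i. of_int (c i)) | c. c \<in> lattice_points d \<and> (\<lambda>i. c i mod q) \<in> F}"
  shows "lattice_density A L = real (card F) / of_int q ^ d"
proof -
  let ?E = "lattice_embedding b d"
  let ?I = "\<lambda>c. ?E (\<lambda>i. of_int (c i))"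
  have local: "?E x = ?E y" if "\<And>i. i < d \<Longrightarrow> x i = y i" for x y
    unfolding lattice_embedding_def using that by (intro ext sum.cong) auto
  have coord: "?E x (h i) = of_real (x i)" if "i < d" for x i
    unfolding lattice_embedding_def using that
    by (subst sum.remove[of _ i]) (auto simp: dual intro!: sum.neutral)
  have add: "?E (\<lambda>i. x i + y i) = (\<lambda>z. ?E x z + ?E y z)" for x y
    by (simp add: lattice_embedding_def fun_eq_iff sum.distrib distrib_right)
  have scale: "?E (\<lambda>i. k * x i) = (\<lambda>z. of_real k * ?E x z)" for k x
    by (simp add: lattice_embedding_def fun_eq_iff sum_distrib_left mult.assoc)
  have L': "L = {?I c | c. True}"
  proof (unfold L, safe)
    fix c :: "nat \<Rightarrow> int"
    have "?I c = ?I (\<lambda>i. if i < d then c i else 0)" by (rule local) simp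
    moreover have "(\<lambda>i. if i < d then c i else 0) \<in> lattice_points d" by (simp add: lattice_points_def)
    ultimately show "\<exists>c'. ?I c = ?I c' \<and> c' \<in> lattice_points d"
      by (intro exI[of _ "\<lambda>i. if i < d then c i else 0"] conjI)
  qed auto
  have span: "real_span L = range ?E"
  proof (rule real_span_lattice_embedding[OF L'])
    show "b i \<in> L" if "i < d" for i
    proof -
      have "b i = ?I (\<lambda>j. if j = i then 1 else 0)"
        unfolding lattice_embedding_def using that
        by (intro ext, subst sum.remove[of _ i]) (auto intro!: sum.neutral)
      thus ?thesis unfolding L' by (intro CollectI exI[of _ "\<lambda>j. if j = i then 1 else 0"]) simp
    qed
    show "inj_on b {..<d}"
    proof (rule inj_onI)
      fix i j assume "i \<in> {..<d}" "j \<in> {..<d}" "b i = b j"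
      thus "i = j" using dual[of i i] dual[of i j] by (auto split: if_splits)
    qed
  qed
  have injI: "inj_on ?I (lattice_points d)"
  proof (rule inj_onI, rule ext)
    fix c c' i assume c: "c \<in> lattice_points d" "c' \<in> lattice_points d" and eq: "?I c = ?I c'"
    show "c i = c' i"
    proof (cases "i < d")
      case True
      thus ?thesis using fun_cong[OF eq, of "h i"] by (simp add: coord)
    qed (use c in \<open>auto simp: lattice_points_def\<close>)
  qed
  have density: "has_lattice_density A L (real (card F) / of_int q ^ d)"
    unfolding has_lattice_density_def
  proof (intro allI impI)
    fix N assume "is_norm_on (real_span L) N"
    note N' = this[unfolded span is_norm_on_def, THEN conjunct1]
      this[unfolded span is_norm_on_def, THEN conjunct2, THEN conjunct1]
      this[unfolded span is_norm_on_def, THEN conjunct2, THEN conjunct2]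
    have N: "N (?E x) \<ge> 0" "N (?E x) = 0 \<longleftrightarrow> ?E x = (\<lambda>_. 0)"
      "N (\<lambda>z. complex_of_real k * ?E x z) = \<bar>k\<bar> * N (?E x)"
      "N (\<lambda>z. ?E x z + ?E y z) \<le> N (?E x) + N (?E y)" for x y k
      using N'(1)[THEN bspec, of "?E x"] N'(2)[THEN bspec, of "?E x"] N'(3)[THEN bspec, of "?E x", THEN bspec, of "?E y"]
      by simp_all
    obtain m where m: "m > 0" "\<And>x i. i < d \<Longrightarrow> m * \<bar>x i\<bar> \<le> N (?E x)"
    proof (rule norm_lower_bound_on_coordinates[of "\<lambda>x. N (?E x)" d])
      show "N (?E (\<lambda>i. x i + y i)) \<le> N (?E x) + N (?E y)" for x y unfolding add by (rule N)
      show "N (?E (\<lambda>i. k * x i)) = \<bar>k\<bar> * N (?E x)" for k x unfolding scale by (rule N)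
      show "N (?E x) = N (?E y)" if "\<And>i. i < d \<Longrightarrow> x i = y i" for x y using local[OF that] by simp
      show "N (?E x) > 0" if "i < d" "x i \<noteq> 0" for x i
      proof -
        have "?E x \<noteq> (\<lambda>_. 0)" using coord[OF that(1), of x] that(2) by auto
        thus ?thesis using N(1,2)[of x] by (simp add: less_le)
      qed
    qed blast
    interpret lattice_norm d "\<lambda>c. N (?I c)"
    proof
      show "N (?I (\<lambda>i. a i + b i)) \<le> N (?I a) + N (?I b)" for a b
        using N(4)[of "\<lambda>i. of_int (a i)" "\<lambda>i. of_int (b i)"] by (simp add: add)
      show "N (?I (\<lambda>i. k * a i)) = \<bar>of_int k\<bar> * N (?I a)" for k a
        using N(3)[of "of_int k" "\<lambda>i. of_int (a i)"] by (simp add: scale)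
      show "N (?I a) = N (?I b)" if "\<And>i. i < d \<Longrightarrow> a i = b i" for a b
        using local[of "\<lambda>i. of_int (a i)" "\<lambda>i. of_int (b i)"] that by simp
      show "finite {c \<in> lattice_points d. N (?I c) < r}" for r
      proof (rule finite_subset)
        let ?K = "\<lceil>r / m\<rceil>"
        \<comment> \<open>The coordinates are bounded by \<open>?K\<close>, so a shift moves the ball into a residue box.\<close>
        let ?f = "\<lambda>c i. if i < d then c i - ?K else 0"
        show "finite (?f ` residue_box d (2 * ?K + 1))"
          by (intro finite_imageI finite_residue_box)
        show "{c \<in> lattice_points d. N (?I c) < r} \<subseteq> ?f ` residue_box d (2 * ?K + 1)"
        proof
          fix c assume c: "c \<in> {c \<in> lattice_points d. N (?I c) < r}"
          have bound: "\<bar>c i\<bar> \<le> ?K" if "i < d" for i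
          proof -
            have "m * \<bar>of_int (c i)\<bar> < r" using m(2)[OF that, of "\<lambda>i. of_int (c i)"] c by simp
            hence "\<bar>of_int (c i)\<bar> < r / m" using m(1) by (simp add: field_simps)
            thus ?thesis by linarith
          qed
          let ?c = "\<lambda>i. if i < d then c i + ?K else 0"
          have "c = ?f ?c" using c by (auto simp: lattice_points_def)
          moreover have "?c \<in> residue_box d (2 * ?K + 1)"
            using bound by (fastforce simp: residue_box_def lattice_points_def abs_le_iff)
          ultimately show "c \<in> ?f ` residue_box d (2 * ?K + 1)"
            by (rule image_eqI[where f = ?f and x = ?c])
        qed
      qed
    qed
    have "{a \<in> A. N a < r} = ?I ` {c \<in> lattice_points d. N (?I c) < r \<and> (\<lambda>i. c i mod q) \<in> F}" for r
      unfolding A by auto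
    moreover have "{v \<in> L. N v < r} = ?I ` {c \<in> lattice_points d. N (?I c) < r}" for r
      unfolding L by auto
    moreover have "card (?I ` S) = card S" if "S \<subseteq> lattice_points d" for S
      by (rule card_image[OF inj_on_subset[OF injI that]])
    ultimately show "((\<lambda>r. real (card {a \<in> A. N a < r}) / real (card {v \<in> L. N v < r})) \<longlongrightarrow> real (card F) / of_int q ^ d) at_top"
      using periodic_ratio[OF q F] by (simp add: subset_eq)
  qed
  let ?N = "\<lambda>v. \<Sum>i<d. norm (v (h i))"
  have norm: "is_norm_on (real_span L) ?N"
    unfolding is_norm_on_def span
  proof (intro conjI ballI allI)
    fix v assume "v \<in> range ?E"
    then obtain x where x: "v = ?E x" by blast
    have "(?N v = 0) = (\<forall>i<d. x i = 0)"
      by (subst sum_nonneg_eq_0_iff) (auto simp: x coord)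
    also have "\<dots> = (v = (\<lambda>_. 0))"
    proof
      assume "\<forall>i<d. x i = 0"
      hence "v = ?E (\<lambda>_. 0)" unfolding x by (intro local) auto
      thus "v = (\<lambda>_. 0)" by (simp add: lattice_embedding_def)
    next
      assume "v = (\<lambda>_. 0)"
      thus "\<forall>i<d. x i = 0" using coord[of _ x] unfolding x by auto
    qed
    finally show "(?N v = 0) = (v = (\<lambda>_. 0))" .
  next
    fix u v :: "'a \<Rightarrow> complex"
    show "?N (\<lambda>x. u x + v x) \<le> ?N u + ?N v"
      unfolding sum.distrib[symmetric] by (intro sum_mono norm_triangle_ineq)
  qed (auto simp: norm_mult sum_distrib_left sum_nonneg)
  have "e = real (card F) / of_int q ^ d" if "has_lattice_density A L e" for e
  proof (rule tendsto_unique[OF trivial_limit_at_top_linorder])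
    let ?r = "\<lambda>r. real (card {a \<in> A. ?N a < r}) / real (card {v \<in> L. ?N v < r})"
    show "(?r \<longlongrightarrow> e) at_top"
      using that[unfolded has_lattice_density_def, THEN spec, of ?N] norm by (rule mp)
    show "(?r \<longlongrightarrow> real (card F) / of_int q ^ d) at_top"
      using density[unfolded has_lattice_density_def, THEN spec, of ?N] norm by (rule mp)
  qed
  thus ?thesis unfolding lattice_density_def using density by (intro the_equality)
qed

section \<open>Roots and coroots of so(2n)\<close>

text \<open>
  Rows and columns are numbered \<open>0, \<dots>, 2 n - 1\<close>. The split form pairs \<open>p\<close> with \<open>opposite n p\<close>, and the
  diagonal entries of a Cartan element at these two places are negatives of each other.
\<close>

definition opposite :: "nat \<Rightarrow> nat \<Rightarrow> nat" where
  "opposite n p = (if p < n then p + n else p - n)"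

text \<open>
  The diagonal entry at \<open>p\<close> of the Cartan element with coordinates \<open>t\<close>. Treating all \<open>2 n\<close> places alike
  brings the four shapes \<open>\<plusminus>\<epsilon>\<^sub>i \<plusminus> \<epsilon>\<^sub>j\<close> of a root into the single form \<open>E\<^sub>p - E\<^sub>q\<close>.
\<close>

definition signed_coord :: "nat \<Rightarrow> (nat \<Rightarrow> 'a :: comm_ring_1) \<Rightarrow> nat \<Rightarrow> 'a" where
  "signed_coord n t p = (if p < n then t p else - t (p - n))"

text \<open>
  Coordinates of the Cartan element with entry 1 at \<open>p\<close> and -1 at the opposite place.
\<close>

definition unit_coord :: "nat \<Rightarrow> nat \<Rightarrow> nat \<Rightarrow> 'a :: comm_ring_1" where
  "unit_coord n p i = (if i = p then 1 else 0) - (if i + n = p then 1 else 0)"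

definition cartan_mat :: "nat \<Rightarrow> (nat \<Rightarrow> complex) \<Rightarrow> complex mat" where
  "cartan_mat n t = mat (2 * n) (2 * n) (\<lambda>(p, q). if p = q then signed_coord n t p else 0)"

lemma opposite_less [simp]: "p < 2 * n \<Longrightarrow> opposite n p < 2 * n"
  by (auto simp: opposite_def)

lemma opposite_opposite [simp]: "p < 2 * n \<Longrightarrow> opposite n (opposite n p) = p"
  by (auto simp: opposite_def)

lemma opposite_neq: "p < 2 * n \<Longrightarrow> opposite n p \<noteq> p"
  by (auto simp: opposite_def)

lemma opposite_eq_iff: "p < 2 * n \<Longrightarrow> q < 2 * n \<Longrightarrow> opposite n p = q \<longleftrightarrow> p = opposite n q"
  by auto

lemma signed_coord_opposite [simp]: "p < 2 * n \<Longrightarrow> signed_coord n t (opposite n p) = - signed_coord n t p"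
  by (auto simp: opposite_def signed_coord_def)

lemma signed_coord_unit:
  assumes "p < 2 * n" "k < 2 * n"
  shows "signed_coord n (unit_coord n p) k = (if k = p then 1 else 0) - (if k = opposite n p then 1 else 0)"
  using assms by (auto simp: signed_coord_def unit_coord_def opposite_def)

lemma sum_unit_coord:
  assumes "p < 2 * n"
  shows "(\<Sum>i<n. c i * unit_coord n p i) = signed_coord n c p"
proof (cases "p < n")
  case True
  have "(\<Sum>i<n. c i * unit_coord n p i) = (\<Sum>i<n. if i = p then c i else 0)"
    by (rule sum.cong) (use True in \<open>auto simp: unit_coord_def\<close>)
  thus ?thesis using True by (simp add: signed_coord_def)
next
  case False
  have "(\<Sum>i<n. c i * unit_coord n p i) = (\<Sum>i<n. if i = p - n then - c i else 0)"
    by (rule sum.cong) (use False in \<open>auto simp: unit_coord_def\<close>)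
  thus ?thesis using False assms by (simp add: signed_coord_def)
qed

lemma cartan_mat_carrier [simp]: "cartan_mat n t \<in> carrier_mat (2 * n) (2 * n)"
  by (simp add: cartan_mat_def)

lemma cartan_mat_index [simp]:
  "p < 2 * n \<Longrightarrow> q < 2 * n \<Longrightarrow> cartan_mat n t $$ (p, q) = (if p = q then signed_coord n t p else 0)"
  by (simp add: cartan_mat_def)

lemma split_form_index:
  "p < 2 * n \<Longrightarrow> q < 2 * n \<Longrightarrow> split_form n $$ (p, q) = (if q = opposite n p then 1 else 0)"
  by (auto simp: split_form_def opposite_def)

lemma split_form_carrier: "split_form n \<in> carrier_mat (2 * n) (2 * n)"
  unfolding split_form_def mult_2 by (rule four_block_carrier_mat) auto

text \<open>
  Multiplication by the split form permutes rows, or columns, by the involution \<open>opposite\<close>, so the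
  defining equation compares the entry at \<open>(p, q)\<close> with the one at the opposite of \<open>(q, p)\<close>.
\<close>

lemma so_even_iff:
  "X \<in> so_even n \<longleftrightarrow> X \<in> carrier_mat (2 * n) (2 * n) \<and>
     (\<forall>p<2*n. \<forall>q<2*n. X $$ (opposite n q, opposite n p) = - X $$ (p, q))"
proof (cases "X \<in> carrier_mat (2 * n) (2 * n)")
  case True
  let ?S = "split_form n"
  note S = split_form_carrier[of n]
  have "(X\<^sup>T * ?S + ?S * X) $$ (p, q) = X $$ (opposite n q, p) + X $$ (opposite n p, q)"
    if "p < 2 * n" "q < 2 * n" for p q
  proof -
    have "(X\<^sup>T * ?S) $$ (p, q) = (\<Sum>k=0..<2*n. X $$ (k, p) * ?S $$ (k, q))"
      using True S that by (simp add: scalar_prod_def)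
    also have "\<dots> = (\<Sum>k=0..<2*n. if k = opposite n q then X $$ (k, p) else 0)"
      by (rule sum.cong) (use that in \<open>auto simp: split_form_index\<close>)
    also have "\<dots> = X $$ (opposite n q, p)" using that by simp
    finally have 1: "(X\<^sup>T * ?S) $$ (p, q) = X $$ (opposite n q, p)" .
    have "(?S * X) $$ (p, q) = (\<Sum>k=0..<2*n. ?S $$ (p, k) * X $$ (k, q))"
      using True S that by (simp add: scalar_prod_def)
    also have "\<dots> = (\<Sum>k=0..<2*n. if k = opposite n p then X $$ (k, q) else 0)"
      by (rule sum.cong) (use that in \<open>auto simp: split_form_index\<close>)
    also have "\<dots> = X $$ (opposite n p, q)" using that by simp
    finally have 2: "(?S * X) $$ (p, q) = X $$ (opposite n p, q)" .
    show ?thesis using True S that 1 2 by simp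
  qed
  moreover have "X\<^sup>T * ?S + ?S * X = 0\<^sub>m (2 * n) (2 * n) \<longleftrightarrow>
      (\<forall>p<2*n. \<forall>q<2*n. (X\<^sup>T * ?S + ?S * X) $$ (p, q) = 0)"
    using True S by (auto simp: mat_eq_iff)
  ultimately have "X \<in> so_even n \<longleftrightarrow> (\<forall>p<2*n. \<forall>q<2*n. X $$ (opposite n q, p) + X $$ (opposite n p, q) = 0)"
    using True by (simp add: so_even_def)
  also have "\<dots> \<longleftrightarrow> (\<forall>p<2*n. \<forall>q<2*n. X $$ (opposite n q, opposite n p) = - X $$ (p, q))"
    (is "?A \<longleftrightarrow> ?B")
  proof
    assume A: ?A
    show ?B
    proof (intro allI impI)
      fix p q assume pq: "p < 2 * n" "q < 2 * n"
      show "X $$ (opposite n q, opposite n p) = - X $$ (p, q)"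
        using A[rule_format, of "opposite n p" q] pq by (simp add: eq_neg_iff_add_eq_0)
    qed
  next
    assume B: ?B
    show ?A
    proof (intro allI impI)
      fix p q assume pq: "p < 2 * n" "q < 2 * n"
      show "X $$ (opposite n q, p) + X $$ (opposite n p, q) = 0"
        using B[rule_format, of "opposite n p" q] pq by simp
    qed
  qed
  finally show ?thesis using True by simp
qed (auto simp: so_even_def)

lemma so_even_carrier: "X \<in> so_even n \<Longrightarrow> X \<in> carrier_mat (2 * n) (2 * n)"
  by (simp add: so_even_def)

lemma so_even_cartan_eq: "so_even_cartan n = range (cartan_mat n)"
proof (intro equalityI subsetI)
  fix X assume "X \<in> so_even_cartan n"
  hence X: "X \<in> so_even n" "diagonal_mat X" by (auto simp: so_even_cartan_def)
  note c = so_even_carrier[OF X(1)]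
  have "X = cartan_mat n (\<lambda>i. X $$ (i, i))"
  proof (rule eq_matI)
    fix p q assume "p < dim_row (cartan_mat n (\<lambda>i. X $$ (i, i)))" "q < dim_col (cartan_mat n (\<lambda>i. X $$ (i, i)))"
    hence pq: "p < 2 * n" "q < 2 * n" by (auto simp: cartan_mat_def)
    show "X $$ (p, q) = cartan_mat n (\<lambda>i. X $$ (i, i)) $$ (p, q)"
    proof (cases "p = q")
      case True
      show ?thesis
      proof (cases "p < n")
        case False
        hence "opposite n p = p - n" by (simp add: opposite_def)
        moreover have "X $$ (opposite n p, opposite n p) = - X $$ (p, p)"
          using X(1) pq unfolding so_even_iff by blast
        ultimately show ?thesis using True pq False by (simp add: signed_coord_def)
      qed (use True pq in \<open>simp add: signed_coord_def\<close>)
    qed (use X(2) c pq in \<open>auto simp: diagonal_mat_def\<close>)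
  qed (use c in \<open>auto simp: cartan_mat_def\<close>)
  thus "X \<in> range (cartan_mat n)" by blast
next
  fix X assume "X \<in> range (cartan_mat n)"
  then obtain t where X: "X = cartan_mat n t" by blast
  show "X \<in> so_even_cartan n"
    unfolding so_even_cartan_def so_even_iff X diagonal_mat_def
    by (auto simp: opposite_eq_iff cartan_mat_def)
qed

lemma cartan_mat_in [simp]: "cartan_mat n t \<in> so_even_cartan n"
  by (simp add: so_even_cartan_eq)

lemma cartan_mat_add: "cartan_mat n s + cartan_mat n t = cartan_mat n (\<lambda>i. s i + t i)"
  by (rule eq_matI) (auto simp: cartan_mat_def signed_coord_def)

lemma cartan_mat_smult: "k \<cdot>\<^sub>m cartan_mat n t = cartan_mat n (\<lambda>i. k * t i)"
  by (rule eq_matI) (auto simp: cartan_mat_def signed_coord_def)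

definition weight :: "nat \<Rightarrow> (nat \<Rightarrow> complex) \<Rightarrow> functional" where
  "weight n c = (\<lambda>H. \<Sum>i<n. c i * coord_functional n i H)"

lemma coord_functional_cartan: "i < n \<Longrightarrow> coord_functional n i (cartan_mat n t) = t i"
  by (simp add: coord_functional_def signed_coord_def)

lemma weight_cartan: "weight n c (cartan_mat n t) = (\<Sum>i<n. c i * t i)"
  unfolding weight_def by (rule sum.cong) (auto simp: coord_functional_cartan)

lemma weight_outside: "H \<notin> so_even_cartan n \<Longrightarrow> weight n c H = 0"
  by (simp add: weight_def coord_functional_def)

lemma weight_unit:
  assumes "i < n" shows "weight n c (cartan_mat n (unit_coord n i)) = c i"
  using sum_unit_coord[of i n c] assms by (simp add: weight_cartan signed_coord_def)

lemma weight_cong: "(\<And>i. i < n \<Longrightarrow> c i = c' i) \<Longrightarrow> weight n c = weight n c'"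
  unfolding weight_def by (intro ext sum.cong) auto

lemma weight_eq_iff: "weight n c = weight n c' \<longleftrightarrow> (\<forall>i<n. c i = c' i)"
  using weight_unit[of _ n c] weight_unit[of _ n c'] weight_cong[of n c c'] by metis

lemma weight_in_dual: "weight n c \<in> dual_space (so_even_cartan n)"
  unfolding dual_space_def so_even_cartan_eq
  by (auto simp: cartan_mat_add cartan_mat_smult weight_cartan sum.distrib algebra_simps sum_distrib_left
      weight_outside so_even_cartan_eq)

lemma dual_space_expand:
  assumes "l \<in> dual_space (so_even_cartan n)"
  shows "l = weight n (\<lambda>i. l (cartan_mat n (unit_coord n i)))"
proof
  fix H
  have add: "l (cartan_mat n s + cartan_mat n t) = l (cartan_mat n s) + l (cartan_mat n t)" for s t
    using assms by (simp add: dual_space_def)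
  have smult: "l (k \<cdot>\<^sub>m cartan_mat n t) = k * l (cartan_mat n t)" for k t
    using assms by (simp add: dual_space_def)
  show "l H = weight n (\<lambda>i. l (cartan_mat n (unit_coord n i))) H"
  proof (cases "H \<in> so_even_cartan n")
    case True
    then obtain t where H: "H = cartan_mat n t" by (auto simp: so_even_cartan_eq)
    have "k \<le> n \<Longrightarrow> l (cartan_mat n (\<lambda>i. if i < k then t i else 0)) = (\<Sum>i<k. t i * l (cartan_mat n (unit_coord n i)))" for k
    proof (induction k)
      case 0
      show ?case using smult[of 0 "\<lambda>_. 0"] by (simp add: cartan_mat_smult)
    next
      case (Suc k)
      have "cartan_mat n (\<lambda>i. if i < Suc k then t i else 0)
          = cartan_mat n (\<lambda>i. if i < k then t i else 0) + t k \<cdot>\<^sub>m cartan_mat n (unit_coord n k)"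
        unfolding cartan_mat_add cartan_mat_smult
        by (rule arg_cong[where f = "cartan_mat n"]) (use Suc.prems in \<open>auto simp: unit_coord_def less_Suc_eq\<close>)
      thus ?case using Suc by (simp add: add smult cartan_mat_smult[symmetric] del: cartan_mat_smult)
         (metis add cartan_mat_smult smult)
    qed
    moreover have "cartan_mat n t = cartan_mat n (\<lambda>i. if i < n then t i else 0)"
      by (rule eq_matI) (auto simp: cartan_mat_def signed_coord_def)
    ultimately show ?thesis unfolding H weight_cartan by (metis (no_types, lifting) mult.commute order_refl sum.cong)
  next
    case False
    thus ?thesis using assms by (simp add: dual_space_def weight_outside)
  qed
qed

lemma dual_space_eq: "dual_space (so_even_cartan n) = range (weight n)"
  using dual_space_expand weight_in_dual by blast

definition so_root :: "nat \<Rightarrow> nat \<Rightarrow> nat \<Rightarrow> functional" where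
  "so_root n p q = (\<lambda>H. if H \<in> so_even_cartan n then H $$ (p, p) - H $$ (q, q) else 0)"

lemma root_cartan:
  "p < 2 * n \<Longrightarrow> q < 2 * n \<Longrightarrow> so_root n p q (cartan_mat n t) = signed_coord n t p - signed_coord n t q"
  by (simp add: so_root_def)

lemma root_weight:
  assumes "p < 2 * n" "q < 2 * n"
  shows "so_root n p q = weight n (\<lambda>i. unit_coord n p i - unit_coord n q i)"
proof
  fix H
  show "so_root n p q H = weight n (\<lambda>i. unit_coord n p i - unit_coord n q i) H"
  proof (cases "H \<in> so_even_cartan n")
    case True
    then obtain t where H: "H = cartan_mat n t" by (auto simp: so_even_cartan_eq)
    have "(\<Sum>i<n. (unit_coord n p i - unit_coord n q i) * t i) = (\<Sum>i<n. t i * unit_coord n p i) - (\<Sum>i<n. t i * unit_coord n q i)"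
      by (simp add: sum_subtractf algebra_simps)
    thus ?thesis unfolding H root_cartan[OF assms] weight_cartan by (simp add: sum_unit_coord assms)
  qed (simp add: so_root_def weight_outside)
qed

lemma root_uminus: "(\<lambda>H. - so_root n p q H) = so_root n q p"
  by (auto simp: so_root_def)

text \<open>
  The excluded cases are \<open>q = p\<close>, which gives the functional 0, and \<open>q = opposite n p\<close>, which gives
  \<open>\<plusminus>2\<epsilon>\<^sub>i\<close>: the corresponding matrix entry vanishes on \<open>so(2n)\<close>.
\<close>

definition root_index :: "nat \<Rightarrow> nat \<Rightarrow> nat \<Rightarrow> bool" where
  "root_index n p q \<longleftrightarrow> p < 2 * n \<and> q < 2 * n \<and> q \<noteq> p \<and> q \<noteq> opposite n p"

lemma root_index_sym: "root_index n p q \<Longrightarrow> root_index n q p"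
  by (auto simp: root_index_def opposite_eq_iff)

text \<open>
  A matrix entry on which the Cartan subalgebra acts by the root is one of two. It suffices to compare the functionals at the two
  unit vectors that belong to \<open>p\<close> and \<open>q\<close>.
\<close>

lemma root_index_unique:
  assumes pq: "root_index n p q" and kl: "k < 2 * n" "l < 2 * n"
    and eq: "\<And>t. signed_coord n t k - signed_coord n t l = signed_coord n t p - signed_coord n (t :: nat \<Rightarrow> complex) q"
  shows "k = p \<and> l = q \<or> k = opposite n q \<and> l = opposite n p"
proof -
  have p: "p < 2 * n" and q: "q < 2 * n" and d: "q \<noteq> p" "q \<noteq> opposite n p"
    using pq by (auto simp: root_index_def)
  have d': "p \<noteq> opposite n q" "opposite n p \<noteq> opposite n q" "opposite n p \<noteq> p" "opposite n q \<noteq> q"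
    using d p q opposite_neq opposite_opposite by metis+
  note u = signed_coord_unit[where 'a = complex]
  define p' q' where "p' = opposite n p" and "q' = opposite n q"
  have 1: "(if k = p then 1 else 0) - (if k = p' then 1 else 0) - ((if l = p then 1 else 0) - (if l = p' then 1 else 0)) = (1 :: complex)"
    using eq[of "unit_coord n p"] d d' unfolding u[OF p p] u[OF p q] u[OF p kl(1)] u[OF p kl(2)] p'_def by simp
  have 2: "(if k = q then 1 else 0) - (if k = q' then 1 else 0) - ((if l = q then 1 else 0) - (if l = q' then 1 else 0)) = - (1 :: complex)"
    using eq[of "unit_coord n q"] d d' unfolding u[OF q p] u[OF q q] u[OF q kl(1)] u[OF q kl(2)] q'_def by simp
  have dist: "p \<noteq> q" "p' \<noteq> q" "p \<noteq> q'" "p' \<noteq> q'" "p' \<noteq> p" "q' \<noteq> q"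
    using d d' unfolding p'_def q'_def by auto
  have "k = p \<or> l = p'" by (rule ccontr) (use 1 in \<open>simp split: if_splits\<close>)
  moreover have "k = q' \<or> l = q" by (rule ccontr) (use 2 in \<open>simp split: if_splits\<close>)
  ultimately show ?thesis using dist unfolding p'_def[symmetric] q'_def[symmetric] by blast
qed

lemma mat_mult_index:
  assumes "A \<in> carrier_mat m m" "B \<in> carrier_mat m m" "k < m" "l < m"
  shows "(A * B) $$ (k, l) = (\<Sum>j=0..<m. A $$ (k, j) * B $$ (j, l))"
  using assms by (simp add: scalar_prod_def)

lemma lie_bracket_cartan:
  assumes "X \<in> carrier_mat (2 * n) (2 * n)" "k < 2 * n" "l < 2 * n"
  shows "lie_bracket (cartan_mat n t) X $$ (k, l) = (signed_coord n t k - signed_coord n t l) * X $$ (k, l)"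
proof -
  let ?H = "cartan_mat n t"
  have H: "?H \<in> carrier_mat (2 * n) (2 * n)" by simp
  have "(?H * X) $$ (k, l) = (\<Sum>j=0..<2*n. ?H $$ (k, j) * X $$ (j, l))"
    by (rule mat_mult_index) (use assms H in auto)
  also have "\<dots> = (\<Sum>j=0..<2*n. if j = k then signed_coord n t k * X $$ (k, l) else 0)"
    by (rule sum.cong) (use assms in auto)
  finally have 1: "(?H * X) $$ (k, l) = signed_coord n t k * X $$ (k, l)" using assms by simp
  have "(X * ?H) $$ (k, l) = (\<Sum>j=0..<2*n. X $$ (k, j) * ?H $$ (j, l))"
    by (rule mat_mult_index) (use assms H in auto)
  also have "\<dots> = (\<Sum>j=0..<2*n. if j = l then X $$ (k, l) * signed_coord n t l else 0)"
    by (rule sum.cong) (use assms in auto)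
  finally have 2: "(X * ?H) $$ (k, l) = X $$ (k, l) * signed_coord n t l" using assms by simp
  show ?thesis unfolding lie_bracket_def using assms H 1 2 by (simp add: algebra_simps)
qed

lemma lie_bracket_carrier:
  "X \<in> carrier_mat m m \<Longrightarrow> Y \<in> carrier_mat m m \<Longrightarrow> lie_bracket X Y \<in> carrier_mat m m"
  unfolding lie_bracket_def by auto

lemma root_space_entry:
  assumes X: "X \<in> root_space (so_even n) (so_even_cartan n) a" and kl: "k < 2 * n" "l < 2 * n"
  shows "(signed_coord n t k - signed_coord n t l) * X $$ (k, l) = a (cartan_mat n t) * X $$ (k, l)"
proof -
  have c: "X \<in> carrier_mat (2 * n) (2 * n)" using X so_even_carrier by (auto simp: root_space_def)
  have "lie_bracket (cartan_mat n t) X = a (cartan_mat n t) \<cdot>\<^sub>m X" using X by (simp add: root_space_def)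
  hence "lie_bracket (cartan_mat n t) X $$ (k, l) = (a (cartan_mat n t) \<cdot>\<^sub>m X) $$ (k, l)" by simp
  thus ?thesis using c kl by (simp add: lie_bracket_cartan)
qed

text \<open>
  The standard generator \<open>E\<^sub>p\<^sub>q - E\<^sub>q\<^sub>'\<^sub>p\<^sub>'\<close> of a root space, where \<open>p'\<close> is opposite to \<open>p\<close>.
\<close>

definition root_vector :: "nat \<Rightarrow> nat \<Rightarrow> nat \<Rightarrow> complex mat" where
  "root_vector n p q = mat (2 * n) (2 * n)
     (\<lambda>(k, l). (if k = p \<and> l = q then 1 else 0) - (if k = opposite n q \<and> l = opposite n p then 1 else 0))"

lemma root_vector_in_root_space:
  assumes pq: "root_index n p q"
  shows "root_vector n p q \<in> root_space (so_even n) (so_even_cartan n) (so_root n p q)"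
proof -
  have p: "p < 2 * n" and q: "q < 2 * n" and d: "q \<noteq> p" "q \<noteq> opposite n p"
    using pq by (auto simp: root_index_def)
  let ?U = "root_vector n p q"
  have c: "?U \<in> carrier_mat (2 * n) (2 * n)" by (simp add: root_vector_def)
  have "?U $$ (opposite n b, opposite n a) = - ?U $$ (a, b)" if "a < 2 * n" "b < 2 * n" for a b
  proof -
    have "opposite n b = p \<longleftrightarrow> b = opposite n p" "opposite n a = q \<longleftrightarrow> a = opposite n q"
      "opposite n b = opposite n q \<longleftrightarrow> b = q" "opposite n a = opposite n p \<longleftrightarrow> a = p"
      using that p q opposite_opposite by metis+
    thus ?thesis using that by (simp add: root_vector_def conj_commute)
  qed
  hence "?U \<in> so_even n"
    unfolding so_even_iff using c by blast
  moreover have "lie_bracket H ?U = so_root n p q H \<cdot>\<^sub>m ?U" if Hh: "H \<in> so_even_cartan n" for H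
  proof -
    obtain t where H: "H = cartan_mat n t" using Hh by (auto simp: so_even_cartan_eq)
    show ?thesis unfolding H
    proof (rule eq_matI)
      fix k l assume "k < dim_row (so_root n p q (cartan_mat n t) \<cdot>\<^sub>m ?U)" "l < dim_col (so_root n p q (cartan_mat n t) \<cdot>\<^sub>m ?U)"
      hence kl: "k < 2 * n" "l < 2 * n" using c by auto
      show "lie_bracket (cartan_mat n t) ?U $$ (k, l) = (so_root n p q (cartan_mat n t) \<cdot>\<^sub>m ?U) $$ (k, l)"
        using c kl p q by (auto simp: lie_bracket_cartan root_cartan root_vector_def)
    qed (use lie_bracket_carrier[of "cartan_mat n t" "2 * n" ?U] c in auto)
  qed
  ultimately show ?thesis by (simp add: root_space_def)
qed

text \<open>
  All entries but the two that belong to the root vanish, and these two are negatives of each other. So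
  root spaces are one-dimensional.
\<close>

lemma root_space_entries:
  assumes pq: "root_index n p q" and X: "X \<in> root_space (so_even n) (so_even_cartan n) (so_root n p q)"
    and kl: "k < 2 * n" "l < 2 * n"
  shows "X $$ (k, l) = X $$ (p, q) *
     ((if k = p \<and> l = q then 1 else 0) - (if k = opposite n q \<and> l = opposite n p then 1 else 0))"
proof -
  have p: "p < 2 * n" and q: "q < 2 * n" and d: "q \<noteq> p" "q \<noteq> opposite n p"
    using pq by (auto simp: root_index_def)
  have d': "p \<noteq> opposite n q" using d p q by (metis opposite_opposite)
  have so: "X $$ (opposite n q, opposite n p) = - X $$ (p, q)"
    using X p q by (simp add: root_space_def so_even_iff)
  consider "k = p \<and> l = q" | "k = opposite n q \<and> l = opposite n p" "\<not> (k = p \<and> l = q)"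
    | "\<not> (k = p \<and> l = q)" "\<not> (k = opposite n q \<and> l = opposite n p)" by blast
  thus ?thesis
  proof cases
    case 3
    have "X $$ (k, l) = 0"
    proof (rule ccontr)
      assume nz: "X $$ (k, l) \<noteq> 0"
      have "k = p \<and> l = q \<or> k = opposite n q \<and> l = opposite n p"
      proof (rule root_index_unique[OF pq kl])
        fix t :: "nat \<Rightarrow> complex"
        show "signed_coord n t k - signed_coord n t l = signed_coord n t p - signed_coord n t q"
          using root_space_entry[OF X kl, of t] nz by (simp add: root_cartan p q)
      qed
      thus False using 3 by blast
    qed
    thus ?thesis by (simp only: if_not_P[OF 3(1)] if_not_P[OF 3(2)] diff_self mult_zero_right)
  qed (use so d' in simp_all)
qed

text \<open>
  As both root spaces are lines, all brackets are multiples of one Cartan element. This makes the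
  description of the coroot by a single value unique.
\<close>

lemma lie_bracket_root_spaces:
  assumes pq: "root_index n p q" and X: "X \<in> root_space (so_even n) (so_even_cartan n) (so_root n p q)"
    and Y: "Y \<in> root_space (so_even n) (so_even_cartan n) (so_root n q p)"
  shows "lie_bracket X Y = (X $$ (p, q) * Y $$ (q, p)) \<cdot>\<^sub>m cartan_mat n (\<lambda>i. unit_coord n p i - unit_coord n q i)"
    (is "_ = ?xy \<cdot>\<^sub>m ?C")
proof (rule eq_matI)
  have p: "p < 2 * n" and q: "q < 2 * n" and d: "q \<noteq> p" "q \<noteq> opposite n p"
    using pq by (auto simp: root_index_def)
  have d': "p \<noteq> opposite n q" "opposite n p \<noteq> opposite n q" "opposite n p \<noteq> p" "opposite n q \<noteq> q"
    using d p q opposite_neq opposite_opposite by metis+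
  have cX: "X \<in> carrier_mat (2 * n) (2 * n)" and cY: "Y \<in> carrier_mat (2 * n) (2 * n)"
    using X Y so_even_carrier by (auto simp: root_space_def)
  define p' q' where "p' = opposite n p" and "q' = opposite n q"
  have dist: "p \<noteq> q" "q \<noteq> p" "p' \<noteq> q" "q \<noteq> p'" "p \<noteq> q'" "q' \<noteq> p" "p' \<noteq> q'" "q' \<noteq> p'"
     "p' \<noteq> p" "p \<noteq> p'" "q' \<noteq> q" "q \<noteq> q'"
    using d d' unfolding p'_def q'_def by (simp_all add: eq_commute)
  have p': "p' < 2 * n" and q': "q' < 2 * n" using p q by (simp_all add: p'_def q'_def)
  fix k l assume "k < dim_row (?xy \<cdot>\<^sub>m ?C)" "l < dim_col (?xy \<cdot>\<^sub>m ?C)"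
  hence kl: "k < 2 * n" "l < 2 * n" by (auto simp: cartan_mat_def)
  note eX = root_space_entries[OF pq X, folded p'_def q'_def]
    and eY = root_space_entries[OF root_index_sym[OF pq] Y, folded p'_def q'_def]
  define x y where "x = X $$ (p, q)" and "y = Y $$ (q, p)"
  have "(X * Y) $$ (k, l) = (\<Sum>j=0..<2*n. X $$ (k, j) * Y $$ (j, l))"
    by (rule mat_mult_index) (use cX cY kl in auto)
  also have "\<dots> = (\<Sum>j=0..<2*n. (if j = q then (if k = p \<and> l = p then x * y else 0) else 0)
      + (if j = p' then (if k = q' \<and> l = q' then x * y else 0) else 0))"
  proof (rule sum.cong[OF refl])
    fix j assume "j \<in> {0..<2*n}"
    hence j: "j < 2 * n" by simp
    show "X $$ (k, j) * Y $$ (j, l) = (if j = q then (if k = p \<and> l = p then x * y else 0) else 0)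
      + (if j = p' then (if k = q' \<and> l = q' then x * y else 0) else 0)"
      unfolding eX[OF kl(1) j] eY[OF j kl(2)] x_def[symmetric] y_def[symmetric]
      by (cases "j = q"; cases "j = p'"; simp add: dist)
  qed
  also have "\<dots> = (if k = p \<and> l = p then x * y else 0) + (if k = q' \<and> l = q' then x * y else 0)"
    using q p' by (simp add: sum.distrib)
  finally have 1: "(X * Y) $$ (k, l) = (if k = p \<and> l = p then x * y else 0) + (if k = q' \<and> l = q' then x * y else 0)" .
  have "(Y * X) $$ (k, l) = (\<Sum>j=0..<2*n. Y $$ (k, j) * X $$ (j, l))"
    by (rule mat_mult_index) (use cX cY kl in auto)
  also have "\<dots> = (\<Sum>j=0..<2*n. (if j = p then (if k = q \<and> l = q then x * y else 0) else 0)
      + (if j = q' then (if k = p' \<and> l = p' then x * y else 0) else 0))"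
  proof (rule sum.cong[OF refl])
    fix j assume "j \<in> {0..<2*n}"
    hence j: "j < 2 * n" by simp
    show "Y $$ (k, j) * X $$ (j, l) = (if j = p then (if k = q \<and> l = q then x * y else 0) else 0)
      + (if j = q' then (if k = p' \<and> l = p' then x * y else 0) else 0)"
      unfolding eX[OF j kl(2)] eY[OF kl(1) j] x_def[symmetric] y_def[symmetric]
      by (cases "j = p"; cases "j = q'"; simp add: dist)
  qed
  also have "\<dots> = (if k = q \<and> l = q then x * y else 0) + (if k = p' \<and> l = p' then x * y else 0)"
    using p q' by (simp add: sum.distrib)
  finally have 2: "(Y * X) $$ (k, l) = (if k = q \<and> l = q then x * y else 0) + (if k = p' \<and> l = p' then x * y else 0)" .
  have C: "(?xy \<cdot>\<^sub>m ?C) $$ (k, l) = x * y * (if k = l then signed_coord n (\<lambda>i. unit_coord n p i - unit_coord n q i) k else 0)"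
    using kl by (subst index_smult_mat) (simp_all add: x_def y_def cartan_mat_def)
  have "signed_coord n (\<lambda>i. unit_coord n p i - unit_coord n q i) k
     = signed_coord n (unit_coord n p) k - signed_coord n (unit_coord n q :: nat \<Rightarrow> complex) k"
    by (simp add: signed_coord_def)
  also have "\<dots> = ((if k = p then 1 else 0) - (if k = p' then 1 else 0)) - ((if k = q then 1 else 0) - (if k = q' then 1 else 0))"
    by (simp only: signed_coord_unit p q kl p'_def q'_def)
  finally have V: "signed_coord n (\<lambda>i. unit_coord n p i - unit_coord n q i) k
     = ((if k = p then 1 else 0) - (if k = p' then 1 else 0)) - ((if k = q then 1 else 0) - (if k = q' then 1 else 0 :: complex))" .
  have 3: "(?xy \<cdot>\<^sub>m ?C) $$ (k, l) = x * y * (if k = l then ((if k = p then 1 else 0) - (if k = p' then 1 else 0))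
      - ((if k = q then 1 else 0) - (if k = q' then 1 else 0)) else 0)"
    unfolding C V ..
  have "lie_bracket X Y $$ (k, l) = (X * Y) $$ (k, l) - (Y * X) $$ (k, l)"
    unfolding lie_bracket_def using cX cY kl by simp
  also have "\<dots> = (?xy \<cdot>\<^sub>m ?C) $$ (k, l)"
    unfolding 1 2 3
  proof (cases "k = l")
    case True
    show "(if k = p \<and> l = p then x * y else 0) + (if k = q' \<and> l = q' then x * y else 0) -
      ((if k = q \<and> l = q then x * y else 0) + (if k = p' \<and> l = p' then x * y else 0)) =
      x * y * (if k = l then ((if k = p then 1 else 0) - (if k = p' then 1 else 0))
      - ((if k = q then 1 else 0) - (if k = q' then 1 else 0)) else 0)"
      unfolding True by (cases "l = p"; cases "l = q"; cases "l = p'"; cases "l = q'"; simp add: dist)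
  qed auto
  finally show "lie_bracket X Y $$ (k, l) = (?xy \<cdot>\<^sub>m ?C) $$ (k, l)" .
next
  have "X \<in> carrier_mat (2 * n) (2 * n)" and "Y \<in> carrier_mat (2 * n) (2 * n)"
    using X Y so_even_carrier by (auto simp: root_space_def)
  thus "dim_row (lie_bracket X Y) = dim_row (?xy \<cdot>\<^sub>m ?C)" "dim_col (lie_bracket X Y) = dim_col (?xy \<cdot>\<^sub>m ?C)"
    by (auto simp: lie_bracket_def cartan_mat_def)
qed

lemma root_coroot_value:
  assumes "root_index n p q"
  shows "so_root n p q (cartan_mat n (\<lambda>i. unit_coord n p i - unit_coord n q i)) = 2"
proof -
  have p: "p < 2 * n" and q: "q < 2 * n" and d: "q \<noteq> p" "q \<noteq> opposite n p"
    using assms by (auto simp: root_index_def)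
  have d': "p \<noteq> opposite n q" "opposite n p \<noteq> p" "opposite n q \<noteq> q"
    using d p q opposite_neq opposite_opposite by metis+
  have 3: "signed_coord n (\<lambda>i. unit_coord n p i - unit_coord n q i) k
     = signed_coord n (unit_coord n p) k - signed_coord n (unit_coord n q :: nat \<Rightarrow> complex) k" for k
    by (simp add: signed_coord_def)
  show ?thesis
    unfolding root_cartan[OF p q] 3 signed_coord_unit[OF p p] signed_coord_unit[OF p q]
      signed_coord_unit[OF q p] signed_coord_unit[OF q q]
    using d d' by simp
qed

lemma coroot_root:
  assumes pq: "root_index n p q"
  shows "coroot (so_even n) (so_even_cartan n) (so_root n p q) = cartan_mat n (\<lambda>i. unit_coord n p i - unit_coord n q i)"
    (is "_ = ?C")
  unfolding coroot_def root_uminus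
proof (rule the_equality)
  have p: "p < 2 * n" and q: "q < 2 * n" and d: "q \<noteq> p" "q \<noteq> opposite n p"
    using pq by (auto simp: root_index_def)
  have d': "p \<noteq> opposite n q" using d p q by (metis opposite_opposite)
  note qp = root_index_sym[OF pq]
  have "root_vector n p q $$ (p, q) * root_vector n q p $$ (q, p) = 1"
    using p q d d' by (auto simp: root_vector_def)
  hence "?C = lie_bracket (root_vector n p q) (root_vector n q p)"
    using lie_bracket_root_spaces[OF pq root_vector_in_root_space[OF pq] root_vector_in_root_space[OF qp]]
    by (auto simp: cartan_mat_smult)
  thus "(\<exists>X\<in>root_space (so_even n) (so_even_cartan n) (so_root n p q).
      \<exists>Y\<in>root_space (so_even n) (so_even_cartan n) (so_root n q p). ?C = lie_bracket X Y) \<and> so_root n p q ?C = 2"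
    using root_vector_in_root_space[OF pq] root_vector_in_root_space[OF qp] root_coroot_value[OF pq] by blast
next
  fix H assume "(\<exists>X\<in>root_space (so_even n) (so_even_cartan n) (so_root n p q).
      \<exists>Y\<in>root_space (so_even n) (so_even_cartan n) (so_root n q p). H = lie_bracket X Y) \<and> so_root n p q H = 2"
  then obtain X Y where XY: "X \<in> root_space (so_even n) (so_even_cartan n) (so_root n p q)"
    "Y \<in> root_space (so_even n) (so_even_cartan n) (so_root n q p)" "H = lie_bracket X Y" "so_root n p q H = 2" by blast
  let ?z = "X $$ (p, q) * Y $$ (q, p)"
  have H: "H = ?z \<cdot>\<^sub>m ?C" unfolding XY(3) by (rule lie_bracket_root_spaces[OF pq XY(1,2)])
  have "so_root n p q H = ?z * so_root n p q ?C"
  proof -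
    have "p < 2 * n" "q < 2 * n" using pq by (auto simp: root_index_def)
    thus ?thesis unfolding H cartan_mat_smult by (simp add: root_cartan signed_coord_def algebra_simps)
  qed
  hence "?z = 1" using XY(4) root_coroot_value[OF pq] by simp
  thus "H = ?C" unfolding H by (simp add: cartan_mat_smult)
qed

lemma weight_coroot:
  assumes "root_index n p q"
  shows "weight n c (coroot (so_even n) (so_even_cartan n) (so_root n p q)) = signed_coord n c p - signed_coord n c q"
proof -
  have "p < 2 * n" "q < 2 * n" using assms by (auto simp: root_index_def)
  thus ?thesis unfolding coroot_root[OF assms] weight_cartan
    by (simp add: algebra_simps sum_subtractf sum_unit_coord)
qed

lemma roots_so_even: "roots (so_even n) (so_even_cartan n) = {so_root n p q | p q. root_index n p q}"
proof (intro equalityI subsetI)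
  fix a assume "a \<in> roots (so_even n) (so_even_cartan n)"
  then obtain X where a: "a \<in> dual_space (so_even_cartan n)" "a \<noteq> (\<lambda>X. 0)"
    and X: "X \<in> root_space (so_even n) (so_even_cartan n) a" "X \<noteq> 0\<^sub>m (dim_row X) (dim_col X)"
    by (auto simp: roots_def)
  have so: "X \<in> so_even n" using X(1) by (simp add: root_space_def)
  note c = so_even_carrier[OF so]
  have "\<exists>k<2*n. \<exists>l<2*n. X $$ (k, l) \<noteq> 0"
    using X(2) c by (auto simp: mat_eq_iff)
  then obtain k l where kl: "k < 2 * n" "l < 2 * n" "X $$ (k, l) \<noteq> 0" by blast
  have val: "a (cartan_mat n t) = so_root n k l (cartan_mat n t)" for t
    using root_space_entry[OF X(1) kl(1,2), of t] kl by (simp add: root_cartan)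
  have eq: "a = so_root n k l"
  proof
    fix H show "a H = so_root n k l H"
    proof (cases "H \<in> so_even_cartan n")
      case True
      thus ?thesis using val by (auto simp: so_even_cartan_eq)
    next
      case False
      thus ?thesis using a(1) by (simp add: dual_space_def so_root_def)
    qed
  qed
  have "l \<noteq> k" using a(2) unfolding eq by (auto simp: so_root_def)
  moreover have "l \<noteq> opposite n k"
  proof
    assume l: "l = opposite n k"
    have "X $$ (opposite n l, opposite n k) = - X $$ (k, l)"
      using so kl unfolding so_even_iff by blast
    thus False using l kl by simp
  qed
  ultimately show "a \<in> {so_root n p q | p q. root_index n p q}" using eq kl by (auto simp: root_index_def)
next
  fix a assume "a \<in> {so_root n p q | p q. root_index n p q}"
  then obtain p q where a: "a = so_root n p q" and pq: "root_index n p q" by blast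
  have p: "p < 2 * n" and q: "q < 2 * n" and d: "q \<noteq> p" "q \<noteq> opposite n p"
    using pq by (auto simp: root_index_def)
  have "a \<in> dual_space (so_even_cartan n)" unfolding a root_weight[OF p q] by (rule weight_in_dual)
  moreover have "a \<noteq> (\<lambda>X. 0)" using root_coroot_value[OF pq] unfolding a by (metis zero_neq_numeral)
  moreover have "root_vector n p q \<noteq> 0\<^sub>m (dim_row (root_vector n p q)) (dim_col (root_vector n p q))"
  proof
    assume "root_vector n p q = 0\<^sub>m (dim_row (root_vector n p q)) (dim_col (root_vector n p q))"
    hence "root_vector n p q $$ (p, q) = 0\<^sub>m (dim_row (root_vector n p q)) (dim_col (root_vector n p q)) $$ (p, q)" by simp
    moreover have "p \<noteq> opposite n q" using d p q by (metis opposite_opposite)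
    ultimately show False using p q by (simp add: root_vector_def)
  qed
  ultimately show "a \<in> roots (so_even n) (so_even_cartan n)"
    using root_vector_in_root_space[OF pq] unfolding roots_def a by blast
qed

lemma reflection_weight:
  assumes "root_index n p q"
  shows "reflection (so_even n) (so_even_cartan n) (so_root n p q) (weight n c) =
    weight n (\<lambda>i. c i - (signed_coord n c p - signed_coord n c q) * (unit_coord n p i - unit_coord n q i))"
proof -
  have "p < 2 * n" "q < 2 * n" using assms by (auto simp: root_index_def)
  note r = root_weight[OF this]
  show ?thesis
    unfolding reflection_def using weight_in_dual[of n c]
    by (simp only: weight_coroot[OF assms] if_True)
       (simp add: r, simp add: weight_def algebra_simps sum_subtractf sum.distrib sum_distrib_left)
qed

section \<open>The Weyl group and its longest element\<close>

text \<open>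
  Positive roots are indexed by triples \<open>(i, j, b)\<close> with \<open>i < j < n\<close>; the flag \<open>b\<close> selects
  \<open>\<epsilon>\<^sub>i + \<epsilon>\<^sub>j\<close> rather than \<open>\<epsilon>\<^sub>i - \<epsilon>\<^sub>j\<close>.
\<close>

definition pos_index :: "nat \<Rightarrow> (nat \<times> nat \<times> bool) set" where
  "pos_index n = (SIGMA i:{..<n}. {i<..<n} \<times> UNIV)"

fun pos_root :: "nat \<Rightarrow> nat \<times> nat \<times> bool \<Rightarrow> functional" where
  "pos_root n (i, j, b) = so_root n i (if b then j + n else j)"

text \<open>
  The value of the weight with coordinates \<open>v\<close> at the coroot of the root with this index. The definition is
  generic in the ring because real coordinates are compared and integer ones multiplied.
\<close>

fun pairing :: "(nat \<Rightarrow> 'a :: comm_ring_1) \<Rightarrow> nat \<times> nat \<times> bool \<Rightarrow> 'a" where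
  "pairing v (i, j, b) = (if b then v i + v j else v i - v j)"

text \<open>
  The reflection in a root swaps two coordinates, and for \<open>\<epsilon>\<^sub>i + \<epsilon>\<^sub>j\<close> also negates them.
\<close>

fun reflect :: "nat \<times> nat \<times> bool \<Rightarrow> (nat \<Rightarrow> 'a :: comm_ring_1) \<Rightarrow> nat \<Rightarrow> 'a" where
  "reflect (i, j, b) v k = (if k = i then (if b then - v j else v j)
     else if k = j then (if b then - v i else v i) else v k)"

lemma pos_index_iff: "(i, j, b) \<in> pos_index n \<longleftrightarrow> i < j \<and> j < n"
  by (auto simp: pos_index_def)

lemma finite_pos_index: "finite (pos_index n)"
  by (auto simp: pos_index_def)

lemma pos_index_root_index:
  "(i, j, b) \<in> pos_index n \<Longrightarrow> root_index n i (if b then j + n else j)"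
  by (auto simp: pos_index_iff root_index_def opposite_def)

lemma so_even_positive_eq: "so_even_positive n = pos_root n ` pos_index n"
proof -
  have minus: "(\<lambda>H. coord_functional n i H - coord_functional n j H) = pos_root n (i, j, False)"
    if "i < j" "j < n" for i j
    by (auto simp: fun_eq_iff coord_functional_def so_root_def)
  have plus: "(\<lambda>H. coord_functional n i H + coord_functional n j H) = pos_root n (i, j, True)"
    if "i < j" "j < n" for i j
    using that by (auto simp: fun_eq_iff coord_functional_def so_root_def so_even_cartan_eq signed_coord_def)
  show ?thesis
  proof (intro equalityI subsetI)
    fix a assume "a \<in> so_even_positive n"
    then consider i j where "i < j" "j < n" "a = (\<lambda>H. coord_functional n i H - coord_functional n j H)"
      | i j where "i < j" "j < n" "a = (\<lambda>H. coord_functional n i H + coord_functional n j H)"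
      unfolding so_even_positive_def by blast
    thus "a \<in> pos_root n ` pos_index n"
    proof cases
      case 1 thus ?thesis by (intro image_eqI[of _ _ "(i, j, False)"]) (auto simp: minus pos_index_iff)
    next
      case 2 thus ?thesis by (intro image_eqI[of _ _ "(i, j, True)"]) (simp_all only: plus pos_index_iff)
    qed
  next
    fix a assume "a \<in> pos_root n ` pos_index n"
    then obtain i j b where a: "a = pos_root n (i, j, b)" "i < j" "j < n" by (auto simp: pos_index_iff)
    show "a \<in> so_even_positive n"
    proof (cases b)
      case True
      thus ?thesis unfolding so_even_positive_def
        by (intro UnI2 CollectI exI[of _ i] exI[of _ j]) (use a plus[of i j] in simp)
    next
      case False
      thus ?thesis unfolding so_even_positive_def
        by (intro UnI1 CollectI exI[of _ i] exI[of _ j]) (use a minus[of i j] in simp)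
    qed
  qed
qed

lemma pos_root_weight:
  assumes "t \<in> pos_index n"
  shows "pos_root n t = weight n (\<lambda>k. pairing (\<lambda>i. if k = i then 1 else 0) t)"
proof -
  obtain i j b where t: "t = (i, j, b)" by (cases t) auto
  have r: "root_index n i (if b then j + n else j)" and ij: "i < j" "j < n"
    using assms pos_index_root_index by (auto simp: t pos_index_iff)
  hence "i < 2 * n" "(if b then j + n else j) < 2 * n" by (auto simp: root_index_def)
  from root_weight[OF this] show ?thesis
    unfolding t pos_root.simps
    by (elim trans) (rule weight_cong, use ij in \<open>auto simp: unit_coord_def\<close>)
qed

lemma weight_coroot_pos:
  assumes "t \<in> pos_index n"
  shows "weight n c (coroot (so_even n) (so_even_cartan n) (pos_root n t)) = pairing c t"
proof -
  obtain i j b where t: "t = (i, j, b)" by (cases t) auto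
  have r: "root_index n i (if b then j + n else j)" and ij: "i < j" "j < n"
    using assms pos_index_root_index by (auto simp: t pos_index_iff)
  show ?thesis unfolding t pos_root.simps weight_coroot[OF r] using ij by (auto simp: signed_coord_def)
qed

lemma reflection_swap:
  assumes "root_index n p q" "p < n" "q < n"
  shows "reflection (so_even n) (so_even_cartan n) (so_root n p q) (weight n c) = weight n (reflect (p, q, False) c)"
  unfolding reflection_weight[OF assms(1)]
  by (rule weight_cong) (use assms in \<open>auto simp: root_index_def signed_coord_def unit_coord_def\<close>)

lemma reflection_negswap:
  assumes "root_index n p (q + n)" "p < n" "q < n"
  shows "reflection (so_even n) (so_even_cartan n) (so_root n p (q + n)) (weight n c) = weight n (reflect (p, q, True) c)"
  unfolding reflection_weight[OF assms(1)]
  by (rule weight_cong) (use assms in \<open>auto simp: root_index_def signed_coord_def unit_coord_def opposite_def\<close>)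

lemma reflection_pos_root:
  assumes "t \<in> pos_index n"
  shows "reflection (so_even n) (so_even_cartan n) (pos_root n t) (weight n c) = weight n (reflect t c)"
proof -
  obtain i j b where t: "t = (i, j, b)" by (cases t) auto
  have r: "root_index n i (if b then j + n else j)" and ij: "i < j" "j < n"
    using assms pos_index_root_index by (auto simp: t pos_index_iff)
  show ?thesis
    using reflection_swap[of n i j c] reflection_negswap[of n i j c] r ij unfolding t by (cases b) auto
qed

lemma reflection_root:
  assumes "a \<in> roots (so_even n) (so_even_cartan n)"
  obtains i j b where "i < n" "j < n" "i \<noteq> j"
    "\<And>c. reflection (so_even n) (so_even_cartan n) a (weight n c) = weight n (reflect (i, j, b) c)"
proof -
  obtain p q where a: "a = so_root n p q" and pq: "root_index n p q" using assms by (auto simp: roots_so_even)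
  have split: "k < n \<or> (\<exists>i. k = i + n \<and> i < n)" if "k < 2 * n" for k
    using that by (cases "k < n") (auto intro!: exI[of _ "k - n"])
  have "p < 2 * n" "q < 2 * n" using pq by (auto simp: root_index_def)
  from split[OF this(1)] split[OF this(2)]
  consider "p < n" "q < n" | i where "p < n" "q = i + n" "i < n" | i where "p = i + n" "q < n" "i < n"
    | i j where "p = i + n" "q = j + n" "i < n" "j < n"
    by blast
  thus ?thesis
  proof cases
    case 1
    have "p \<noteq> q" using pq by (auto simp: root_index_def)
    with 1 show ?thesis by (rule that[of p q False]) (unfold a, rule reflection_swap[OF pq 1])
  next
    case 2
    have "p \<noteq> i" using pq 2 by (auto simp: root_index_def opposite_def)
    with 2(1,3) show ?thesis
      by (rule that[of p i True]) (unfold a 2(2), rule reflection_negswap[OF pq[unfolded 2(2)] 2(1,3)])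
  next
    case 3
    have "i \<noteq> q" using pq 3 by (auto simp: root_index_def opposite_def)
    have "reflection (so_even n) (so_even_cartan n) a (weight n c) = weight n (reflect (i, q, True) c)" for c
      unfolding a reflection_weight[OF pq]
      by (rule weight_cong) (use 3 \<open>i \<noteq> q\<close> in \<open>auto simp: signed_coord_def unit_coord_def\<close>)
    with 3(3,2) \<open>i \<noteq> q\<close> show ?thesis by (rule that[of i q True])
  next
    case 4
    have "i \<noteq> j" using pq 4 by (auto simp: root_index_def opposite_def)
    have "reflection (so_even n) (so_even_cartan n) a (weight n c) = weight n (reflect (i, j, False) c)" for c
      unfolding a reflection_weight[OF pq]
      by (rule weight_cong) (use 4 \<open>i \<noteq> j\<close> in \<open>auto simp: signed_coord_def unit_coord_def\<close>)
    with 4(3,4) \<open>i \<noteq> j\<close> show ?thesis by (rule that[of i j False])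
  qed
qed

text \<open>
  Sums and products over the set of positive roots may be taken over indices instead.
\<close>

lemma inj_on_pos_root: "inj_on (pos_root n) (pos_index n)"
proof (rule inj_onI)
  fix t t' assume T: "t \<in> pos_index n" "t' \<in> pos_index n" and eq: "pos_root n t = pos_root n t'"
  obtain i j b i' j' b' where t: "t = (i, j, b)" "t' = (i', j', b')" by (cases t, cases t') auto
  have ij: "i < j" "j < n" "i' < j'" "j' < n" using T by (auto simp: t pos_index_iff)
  have "pairing (\<lambda>i. if k = i then 1 else 0 :: complex) t = pairing (\<lambda>i. if k = i then 1 else 0) t'" if "k < n" for k
    using eq that unfolding pos_root_weight[OF T(1)] pos_root_weight[OF T(2)] weight_eq_iff by blast
  hence co: "(if k = i then 1 else 0) + (if b then 1 else - 1) * (if k = j then 1 else 0 :: complex)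
      = (if k = i' then 1 else 0) + (if b' then 1 else - 1) * (if k = j' then 1 else 0)" if "k < n" for k
    using that unfolding t pairing.simps by (cases b; cases b'; simp)
  have i: "i = i'"
  proof (rule linorder_cases[of i i'])
    assume "i < i'" thus ?thesis using co[of i] ij by simp
  next
    assume "i' < i" thus ?thesis using co[of i'] ij by simp
  qed
  have j: "j = j'"
  proof (rule ccontr)
    assume "j \<noteq> j'" thus False using co[of j] ij unfolding i by (cases b) simp_all
  qed
  have "b = b'" using co[of j] ij unfolding i j by (cases b; cases b'; simp)
  thus "t = t'" by (simp add: t i j)
qed

definition simple_index :: "nat \<Rightarrow> (nat \<times> nat \<times> bool) set" where
  "simple_index n = {(i, Suc i, False) | i. Suc i < n} \<union> {(n - 2, n - 1, True)}"

lemma simple_index_subset: "n \<ge> 2 \<Longrightarrow> simple_index n \<subseteq> pos_index n"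
  by (auto simp: simple_index_def pos_index_iff)

definition rho :: "nat \<Rightarrow> nat \<Rightarrow> 'a :: comm_ring_1" where
  "rho n i = of_nat (n - 1 - i)"

lemma pos_root_sum_iff:
  assumes "s \<in> pos_index n" "t \<in> pos_index n" "u \<in> pos_index n"
  shows "pos_root n s = (\<lambda>H. pos_root n t H + pos_root n u H) \<longleftrightarrow>
    (\<forall>k<n. pairing (\<lambda>i. if k = i then 1 else 0 :: complex) s = pairing (\<lambda>i. if k = i then 1 else 0) t + pairing (\<lambda>i. if k = i then 1 else 0) u)"
proof -
  have "(\<lambda>H. weight n c H + weight n c' H) = weight n (\<lambda>i. c i + c' i)" for c c'
    by (auto simp: weight_def sum.distrib distrib_right)
  thus ?thesis unfolding assms[THEN pos_root_weight] by (simp add: weight_eq_iff)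
qed

lemma height_ge_1:
  assumes "t \<in> pos_index n" shows "pairing (rho n) t \<ge> (1 :: real)"
proof -
  obtain i j b where t: "t = (i, j, b)" by (cases t) auto
  have "i < j" "j < n" using assms by (auto simp: t pos_index_iff)
  thus ?thesis by (auto simp: t rho_def of_nat_diff)
qed

lemma pos_root_height:
  assumes "t \<in> pos_index n" shows "pos_root n t (cartan_mat n (rho n)) = pairing (rho n) t"
proof -
  obtain i j b where t: "t = (i, j, b)" by (cases t) auto
  have "i < j" "j < n" using assms by (auto simp: t pos_index_iff)
  thus ?thesis by (auto simp: t root_cartan signed_coord_def)
qed

lemma pairing_of_real: "pairing (\<lambda>i. of_real (v i)) t = (of_real (pairing v t) :: complex)"
  by (cases t) auto

lemma rho_of_real: "rho n = (\<lambda>i. of_real (rho n i) :: complex)"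
  by (auto simp: rho_def)

text \<open>
  Every other positive root visibly splits into two. Conversely the simple roots have height 1, where
  the height is the value at \<open>\<rho>\<close>, and a sum of two positive roots has height at least 2.
\<close>

lemma simple_roots_so_even:
  assumes "n \<ge> 2"
  shows "simple_roots (so_even_positive n) = pos_root n ` simple_index n"
proof (intro equalityI subsetI)
  fix a assume "a \<in> simple_roots (so_even_positive n)"
  then obtain s where a: "a = pos_root n s" "s \<in> pos_index n"
    and nsum: "\<And>t u. t \<in> pos_index n \<Longrightarrow> u \<in> pos_index n \<Longrightarrow> a \<noteq> (\<lambda>H. pos_root n t H + pos_root n u H)"
    unfolding simple_roots_def so_even_positive_eq by blast
  obtain i j b where s: "s = (i, j, b)" by (cases s) auto
  have ij: "i < j" "j < n" using a by (auto simp: s pos_index_iff)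
  have sumD: False if "t \<in> pos_index n" "u \<in> pos_index n"
    "\<And>k. pairing (\<lambda>i. if k = i then 1 else 0 :: complex) s = pairing (\<lambda>i. if k = i then 1 else 0) t + pairing (\<lambda>i. if k = i then 1 else 0) u" for t u
    using nsum[OF that(1,2)] pos_root_sum_iff[OF a(2) that(1,2)] that(3) unfolding a by blast
  have "s \<in> simple_index n"
  proof (rule ccontr)
    assume ns: "s \<notin> simple_index n"
    show False
    proof (cases b)
      case False
      hence "j \<noteq> Suc i" using ns ij by (auto simp: s simple_index_def)
      thus False using ij False
        by (intro sumD[of "(i, Suc i, False)" "(Suc i, j, False)"]) (auto simp: s pos_index_iff)
    next
      case b: True
      show False
      proof (cases "j = n - 1")
        case True
        hence "i < n - 2" using ns ij b by (auto simp: s simple_index_def)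
        thus False using ij b True
          by (intro sumD[of "(i, n - 2, False)" "(n - 2, n - 1, True)"]) (auto simp: s pos_index_iff)
      next
        case False
        hence "j < n - 1" using ij by simp
        thus False using ij b
          by (intro sumD[of "(i, n - 1, False)" "(j, n - 1, True)"]) (auto simp: s pos_index_iff)
      qed
    qed
  qed
  thus "a \<in> pos_root n ` simple_index n" unfolding a by blast
next
  fix a assume "a \<in> pos_root n ` simple_index n"
  then obtain s where a: "a = pos_root n s" "s \<in> simple_index n" by blast
  have s: "s \<in> pos_index n" using a simple_index_subset[OF assms] by blast
  have hs: "pairing (rho n) s = (1 :: real)"
    using a(2) assms by (auto simp: simple_index_def rho_def of_nat_diff)
  have False if t: "t \<in> pos_index n" "u \<in> pos_index n" "a = (\<lambda>H. pos_root n t H + pos_root n u H)" for t u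
  proof -
    have "(pairing (rho n) s :: complex) = pairing (rho n) t + pairing (rho n) u"
      using fun_cong[OF t(3), of "cartan_mat n (rho n)"] unfolding a
      by (simp only: pos_root_height[OF s] pos_root_height[OF t(1)] pos_root_height[OF t(2)])
    hence "(pairing (rho n) s :: real) = pairing (rho n) t + pairing (rho n) u"
      unfolding rho_of_real[of n] pairing_of_real by (simp only: of_real_add[symmetric] of_real_eq_iff)
    thus False using height_ge_1[OF t(1)] height_ge_1[OF t(2)] hs by simp
  qed
  thus "a \<in> simple_roots (so_even_positive n)"
    unfolding simple_roots_def so_even_positive_eq using a s
    by (intro CollectI conjI notI) (simp, elim bexE imageE, metis)
qed

text \<open>
  For \<open>v = w \<rho>\<close> this is the number of positive roots sent to negative ones by the inverse of \<open>w\<close>.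
\<close>

definition inversions :: "nat \<Rightarrow> (nat \<Rightarrow> real) \<Rightarrow> nat" where
  "inversions n v = card {t \<in> pos_index n. pairing v t < 0}"

lemma pairing_cong: "t \<in> pos_index n \<Longrightarrow> (\<And>i. i < n \<Longrightarrow> v i = v' i) \<Longrightarrow> pairing v t = pairing v' t"
  by (cases t) (auto simp: pos_index_iff)

lemma inversions_cong: "(\<And>i. i < n \<Longrightarrow> v i = v' i) \<Longrightarrow> inversions n v = inversions n v'"
  unfolding inversions_def by (metis (no_types, lifting) Collect_cong pairing_cong)

text \<open>
  A simple reflection permutes the positive roots other than its own root; \<open>\<phi>\<close> is this permutation on indices.
\<close>

lemma simple_permutes_positive:
  assumes n: "n \<ge> 2" and a: "\<alpha> \<in> simple_index n"
  obtains \<phi> where "\<And>t. t \<in> pos_index n - {\<alpha>} \<Longrightarrow> \<phi> t \<in> pos_index n - {\<alpha>} \<and> \<phi> (\<phi> t) = t"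
    "\<And>t (v :: nat \<Rightarrow> real). t \<in> pos_index n - {\<alpha>} \<Longrightarrow> pairing (reflect \<alpha> v) (\<phi> t) = pairing v t"
  using a unfolding simple_index_def
proof (elim UnE CollectE exE conjE)
  fix i assume \<alpha>: "\<alpha> = (i, Suc i, False)" and i: "Suc i < n"
  let ?\<tau> = "\<lambda>k. if k = i then Suc i else if k = Suc i then i else k"
  \<comment> \<open>The pair \<open>(i, i + 1)\<close> is kept: the root \<open>\<epsilon>\<^sub>i + \<epsilon>\<^sub>i\<^sub>+\<^sub>1\<close> is fixed, and swapping would put its indices in the wrong order.\<close>
  let ?\<phi> = "\<lambda>(x, y, b). if x = i \<and> y = Suc i then (x, y, b) else (?\<tau> x, ?\<tau> y, b)"
  show thesis
  proof (rule that[of ?\<phi>])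
    fix t assume t: "t \<in> pos_index n - {\<alpha>}"
    obtain x y b where txy: "t = (x, y, b)" by (cases t) auto
    have xy: "x < y" "y < n" using t by (auto simp: txy pos_index_iff)
    show "?\<phi> t \<in> pos_index n - {\<alpha>} \<and> ?\<phi> (?\<phi> t) = t"
      using t xy i by (auto simp: txy \<alpha> pos_index_iff split: if_splits)
    show "pairing (reflect \<alpha> v) (?\<phi> t) = pairing v t" for v :: "nat \<Rightarrow> real"
      using t xy by (auto simp: txy \<alpha>)
  qed
next
  assume "\<alpha> \<in> {(n - 2, n - 1, True)}"
  hence \<alpha>: "\<alpha> = (n - 2, n - 1, True)" by simp
  let ?\<tau> = "\<lambda>k. if k = n - 2 then n - 1 else if k = n - 1 then n - 2 else k"
  \<comment> \<open>The reflection exchanges \<open>\<epsilon>\<^sub>x \<plusminus> \<epsilon>\<^sub>y\<close> with \<open>\<epsilon>\<^sub>x \<minusplus> \<epsilon>\<^sub>z\<close>, where \<open>y\<close> and \<open>z\<close> are the last two indices.\<close>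
  let ?\<phi> = "\<lambda>(x, y, b). if y < n - 2 \<or> x = n - 2 then (x, y, b) else (x, ?\<tau> y, \<not> b)"
  show thesis
  proof (rule that[of ?\<phi>])
    fix t assume t: "t \<in> pos_index n - {\<alpha>}"
    obtain x y b where txy: "t = (x, y, b)" by (cases t) auto
    have xy: "x < y" "y < n" using t by (auto simp: txy pos_index_iff)
    show "?\<phi> t \<in> pos_index n - {\<alpha>} \<and> ?\<phi> (?\<phi> t) = t"
    proof (cases "y < n - 2 \<or> x = n - 2")
      case True
      thus ?thesis using t by (simp add: txy)
    next
      case False
      hence "y = n - 2 \<or> y = n - 1" "x < n - 2" "n - 2 \<noteq> n - 1" using xy n by auto
      thus ?thesis by (elim disjE) (auto simp: txy \<alpha> pos_index_iff)
    qed
    show "pairing (reflect \<alpha> v) (?\<phi> t) = pairing v t" for v :: "nat \<Rightarrow> real"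
    proof (cases "y < n - 2 \<or> x = n - 2")
      case True
      thus ?thesis using t xy by (auto simp: txy \<alpha>)
    next
      case False
      hence "y = n - 2 \<or> y = n - 1" "x < n - 2" "n - 2 \<noteq> n - 1" using xy n by auto
      thus ?thesis by (elim disjE) (auto simp: txy \<alpha>)
    qed
  qed
qed

lemma pairing_reflect_self:
  "\<alpha> \<in> pos_index n \<Longrightarrow> pairing (reflect \<alpha> v) \<alpha> = - pairing v \<alpha>"
  by (cases \<alpha>) (auto simp: pos_index_iff)

text \<open>
  Hence a simple reflection changes the number of inversions by exactly the contribution of its own root.
\<close>

lemma inversions_reflect:
  assumes n: "n \<ge> 2" and a: "\<alpha> \<in> simple_index n"
  shows "inversions n (reflect \<alpha> v) \<le> Suc (inversions n v)"
    and "pairing v \<alpha> < 0 \<Longrightarrow> inversions n v = Suc (inversions n (reflect \<alpha> v))"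
proof -
  have \<alpha>: "\<alpha> \<in> pos_index n" using a simple_index_subset[OF n] by blast
  obtain \<phi> where \<phi>: "\<And>t. t \<in> pos_index n - {\<alpha>} \<Longrightarrow> \<phi> t \<in> pos_index n - {\<alpha>} \<and> \<phi> (\<phi> t) = t"
    "\<And>t (v :: nat \<Rightarrow> real). t \<in> pos_index n - {\<alpha>} \<Longrightarrow> pairing (reflect \<alpha> v) (\<phi> t) = pairing v t"
    using simple_permutes_positive[OF n a] by metis
  let ?R = "\<lambda>v. {t \<in> pos_index n - {\<alpha>}. pairing v t < 0}"
  have fin: "finite (?R v)" for v using finite_pos_index by simp
  have inv: "inversions n v = (if pairing v \<alpha> < 0 then 1 else 0) + card (?R v)" for v
  proof -
    have "{t \<in> pos_index n. pairing v t < 0} = (if pairing v \<alpha> < 0 then insert \<alpha> (?R v) else ?R v)"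
      using \<alpha> by auto
    thus ?thesis using fin[of v] by (auto simp: inversions_def)
  qed
  have "bij_betw \<phi> (?R v) (?R (reflect \<alpha> v))"
  proof (rule bij_betw_byWitness[where f' = \<phi>])
    show "\<forall>t\<in>?R v. \<phi> (\<phi> t) = t" "\<forall>t\<in>?R (reflect \<alpha> v). \<phi> (\<phi> t) = t" using \<phi>(1) by auto
    show "\<phi> ` ?R v \<subseteq> ?R (reflect \<alpha> v)"
    proof (rule image_subsetI)
      fix t assume t: "t \<in> ?R v"
      thus "\<phi> t \<in> ?R (reflect \<alpha> v)" using \<phi>(1)[of t] \<phi>(2)[of t v] by simp
    qed
    show "\<phi> ` ?R (reflect \<alpha> v) \<subseteq> ?R v"
    proof (rule image_subsetI)
      fix t assume t: "t \<in> ?R (reflect \<alpha> v)"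
      thus "\<phi> t \<in> ?R v" using \<phi>(1)[of t] \<phi>(2)[of "\<phi> t" v] by simp
    qed
  qed
  hence eq: "card (?R v) = card (?R (reflect \<alpha> v))" by (rule bij_betw_same_card)
  show "inversions n (reflect \<alpha> v) \<le> Suc (inversions n v)"
    unfolding inv[of v] inv[of "reflect \<alpha> v"] eq by simp
  show "inversions n v = Suc (inversions n (reflect \<alpha> v))" if "pairing v \<alpha> < 0"
    unfolding inv[of v] inv[of "reflect \<alpha> v"] eq pairing_reflect_self[OF \<alpha>] using that by simp
qed

text \<open>
  Coordinates that are dominant for the simple roots decrease and satisfy
  \<open>v (n - 2) + v (n - 1) \<ge> 0\<close>, so they are dominant for all positive roots.
\<close>

lemma pairing_nonneg_if_simple:
  fixes v :: "nat \<Rightarrow> real"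
  assumes n: "n \<ge> 2" and s: "\<And>\<alpha>. \<alpha> \<in> simple_index n \<Longrightarrow> pairing v \<alpha> \<ge> 0" and t: "t \<in> pos_index n"
  shows "pairing v t \<ge> 0"
proof -
  have step: "v (Suc i) \<le> v i" if "Suc i < n" for i
    using s[of "(i, Suc i, False)"] that by (simp add: simple_index_def)
  have mono: "v j \<le> v i" if "i \<le> j" "j < n" for i j
    using that by (induction j rule: dec_induct) (auto intro: order_trans step)
  have last: "v (n - 2) + v (n - 1) \<ge> 0" using s[of "(n - 2, n - 1, True)"] by (simp add: simple_index_def)
  obtain i j b where tij: "t = (i, j, b)" by (cases t) auto
  have ij: "i < j" "j < n" using t by (auto simp: tij pos_index_iff)
  have "v (n - 2) \<le> v i" "v (n - 1) \<le> v j" "v j \<le> v i" using ij by (auto intro!: mono)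
  thus ?thesis using last by (simp add: tij)
qed

text \<open>
  Elements of the Weyl group of type \<open>D\<^sub>n\<close> act by signed permutations with an even number of signs.
  The product of the signs records this parity; it is what separates the group from type \<open>B\<^sub>n\<close>.
\<close>

definition sign_perm_action ::
    "nat \<Rightarrow> (functional \<Rightarrow> functional) \<Rightarrow> (nat \<Rightarrow> nat) \<Rightarrow> (nat \<Rightarrow> real) \<Rightarrow> bool" where
  "sign_perm_action n w \<pi> s \<longleftrightarrow> \<pi> permutes {..<n} \<and> (\<forall>i. s i = 1 \<or> s i = -1) \<and> (\<Prod>i<n. s i) = 1 \<and>
     (\<forall>c. w (weight n c) = weight n (\<lambda>i. of_real (s i) * c (\<pi> i))) \<and>
     (\<forall>l. l \<notin> dual_space (so_even_cartan n) \<longrightarrow> w l = l)"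

lemma sign_perm_action_reflection:
  assumes a: "a \<in> roots (so_even n) (so_even_cartan n)"
  shows "\<exists>\<pi> s. sign_perm_action n (reflection (so_even n) (so_even_cartan n) a) \<pi> s"
proof -
  obtain i j b where ij: "i < n" "j < n" "i \<noteq> j"
    and r: "\<And>c. reflection (so_even n) (so_even_cartan n) a (weight n c) = weight n (reflect (i, j, b) c)"
    using reflection_root[OF a] by metis
  let ?s = "\<lambda>k. if b \<and> (k = i \<or> k = j) then -1 else 1 :: real"
  have "(\<Prod>k<n. ?s k) = (\<Prod>k\<in>{i, j}. ?s k)"
    by (rule prod.mono_neutral_right) (use ij in auto)
  hence "(\<Prod>k<n. ?s k) = 1" using ij by auto
  moreover have "reflect (i, j, b) c = (\<lambda>k. of_real (?s k) * c (Transposition.transpose i j k))" for c :: "nat \<Rightarrow> complex"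
    using ij by (auto simp: fun_eq_iff Transposition.transpose_def)
  ultimately have "sign_perm_action n (reflection (so_even n) (so_even_cartan n) a) (Transposition.transpose i j) ?s"
    unfolding sign_perm_action_def using ij r
    by (auto intro!: permutes_swap_id simp: reflection_def)
  thus ?thesis by blast
qed

lemma sign_perm_action_comp:
  assumes w: "sign_perm_action n w \<pi> s" and w': "sign_perm_action n w' \<pi>' s'"
  shows "sign_perm_action n (w \<circ> w') (\<pi>' \<circ> \<pi>) (\<lambda>i. s i * s' (\<pi> i))"
proof -
  have p: "\<pi> permutes {..<n}" using w by (simp add: sign_perm_action_def)
  have "(\<Prod>i<n. s' (\<pi> i)) = (\<Prod>i<n. s' i)" using prod.permute[OF p, of s'] by (simp add: o_def)
  hence "(\<Prod>i<n. s i * s' (\<pi> i)) = 1" using w w' by (simp add: prod.distrib sign_perm_action_def)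
  moreover have "s i * s' (\<pi> i) = 1 \<or> s i * s' (\<pi> i) = -1" for i
    using w w' unfolding sign_perm_action_def by (metis minus_mult_minus mult.commute mult_1)
  moreover have "(w \<circ> w') (weight n c) = weight n (\<lambda>i. of_real (s i * s' (\<pi> i)) * c ((\<pi>' \<circ> \<pi>) i))" for c
    using w w' by (simp add: sign_perm_action_def mult.assoc)
  ultimately show ?thesis
    using w w' permutes_compose[of \<pi> "{..<n}" \<pi>'] by (simp add: sign_perm_action_def)
qed

lemma reflection_word_Cons:
  "reflection_word g h (a # as) = reflection g h a \<circ> reflection_word g h as"
  by (simp add: reflection_word_def)

lemma reflection_word_Nil: "reflection_word g h [] = id"
  by (simp add: reflection_word_def)

lemma weyl_group_sign_perm:
  assumes "w \<in> weyl_group (so_even n) (so_even_cartan n)"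
  obtains \<pi> s where "sign_perm_action n w \<pi> s"
proof -
  obtain as where w: "w = reflection_word (so_even n) (so_even_cartan n) as"
    "set as \<subseteq> roots (so_even n) (so_even_cartan n)" using assms by (auto simp: weyl_group_def)
  from w(2) have "\<exists>\<pi> s. sign_perm_action n (reflection_word (so_even n) (so_even_cartan n) as) \<pi> s"
  proof (induction as)
    case Nil
    have "sign_perm_action n id id (\<lambda>_. 1)" by (simp add: sign_perm_action_def permutes_id)
    thus ?case unfolding reflection_word_Nil by blast
  next
    case (Cons a as)
    then obtain \<pi> s where 1: "sign_perm_action n (reflection_word (so_even n) (so_even_cartan n) as) \<pi> s" by auto
    obtain \<pi>' s' where 2: "sign_perm_action n (reflection (so_even n) (so_even_cartan n) a) \<pi>' s'"
      using sign_perm_action_reflection[of a n] Cons.prems by auto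
    show ?case unfolding reflection_word_Cons using sign_perm_action_comp[OF 2 1] by blast
  qed
  thus ?thesis using that w(1) by blast
qed

lemma permutes_strict_mono_eq_id:
  assumes p: "\<pi> permutes {..<n}" and mono: "\<And>i j. i < j \<Longrightarrow> j < n \<Longrightarrow> \<pi> i < (\<pi> j :: nat)" and i: "i < n"
  shows "\<pi> i = i"
proof -
  have ge: "i \<le> \<pi> i" if "i < n" for i
    using that
  proof (induction i)
    case (Suc i)
    thus ?case using mono[of i "Suc i"] by simp
  qed simp
  have "(\<Sum>i<n. \<pi> i) = (\<Sum>i<n. i)" using sum.permute[OF p, of "\<lambda>i. i"] by (simp add: o_def)
  show ?thesis
  proof (rule ccontr)
    assume "\<pi> i \<noteq> i"
    hence "i < \<pi> i" using ge[OF i] by simp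
    hence "(\<Sum>i<n. i) < (\<Sum>i<n. \<pi> i)" using ge i by (intro sum_strict_mono_ex1) auto
    thus False using \<open>(\<Sum>i<n. \<pi> i) = (\<Sum>i<n. i)\<close> by simp
  qed
qed

text \<open>
  The absolute values of the coordinates of \<open>w \<rho>\<close> are \<open>n - 1, \<dots>, 0\<close> in some order, so
  only one order makes them decrease.
\<close>

lemma sign_perm_ordered_eq_id:
  assumes w: "sign_perm_action n w \<pi> s"
    and ord: "\<And>i j. i < j \<Longrightarrow> j < n \<Longrightarrow> \<bar>s j * rho n (\<pi> j)\<bar> \<le> \<bar>s i * rho n (\<pi> i)\<bar>"
    and i: "i < n"
  shows "\<pi> i = i"
proof (rule permutes_strict_mono_eq_id[OF _ _ i])
  show p: "\<pi> permutes {..<n}" using w by (simp add: sign_perm_action_def)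
  fix i j assume ij: "i < j" "j < n"
  have s: "\<bar>s k\<bar> = 1" for k using w unfolding sign_perm_action_def by (metis abs_1 abs_minus_cancel)
  have lt: "\<pi> i < n" "\<pi> j < n" using permutes_in_image[OF p] ij by (auto simp: lessThan_iff)
  have "\<bar>rho n (\<pi> j) :: real\<bar> \<le> \<bar>rho n (\<pi> i)\<bar>" using ord[OF ij] by (simp add: abs_mult s)
  hence "\<pi> i \<le> \<pi> j" using lt by (auto simp: rho_def)
  moreover have "\<pi> i \<noteq> \<pi> j" using permutes_inj[OF p] ij by (auto dest: injD)
  ultimately show "\<pi> i < \<pi> j" by simp
qed

lemma pos_root_in_roots:
  assumes "t \<in> pos_index n" shows "pos_root n t \<in> roots (so_even n) (so_even_cartan n)"
proof -
  obtain i j b where t: "t = (i, j, b)" by (cases t) auto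
  show ?thesis using pos_index_root_index[of i j b n] assms unfolding roots_so_even t pos_root.simps by blast
qed

lemma reflection_involution:
  assumes t: "t \<in> pos_index n"
  shows "reflection (so_even n) (so_even_cartan n) (pos_root n t) \<circ>
    (reflection (so_even n) (so_even_cartan n) (pos_root n t) \<circ> w) = w"
proof -
  let ?r = "reflection (so_even n) (so_even_cartan n) (pos_root n t)"
  have "?r (?r l) = l" for l
  proof (cases "l \<in> dual_space (so_even_cartan n)")
    case True
    then obtain c where l: "l = weight n c" by (auto simp: dual_space_eq)
    have "reflect t (reflect t c) = c"
      using t by (cases t) (auto simp: fun_eq_iff pos_index_iff)
    thus ?thesis unfolding l by (simp add: reflection_pos_root[OF t])
  qed (simp add: reflection_def)
  thus ?thesis by (simp add: fun_eq_iff)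
qed

text \<open>
  Inversions are read off from \<open>w \<rho>\<close>, so that they make sense for any map of functionals.
\<close>

definition inversions_of :: "nat \<Rightarrow> (functional \<Rightarrow> functional) \<Rightarrow> nat" where
  "inversions_of n w = inversions n (\<lambda>i. Re (w (weight n (rho n)) (cartan_mat n (unit_coord n i))))"

lemma inversions_of_weight:
  assumes "w (weight n (rho n)) = weight n c"
  shows "inversions_of n w = inversions n (\<lambda>i. Re (c i))"
  unfolding inversions_of_def assms by (rule inversions_cong) (simp add: weight_unit)

lemma inversions_of_sign_perm:
  assumes "sign_perm_action n w \<pi> s"
  shows "inversions_of n w = inversions n (\<lambda>i. s i * rho n (\<pi> i))"
proof -
  have "w (weight n (rho n)) = weight n (\<lambda>i. of_real (s i) * rho n (\<pi> i))"
    using assms by (simp add: sign_perm_action_def)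
  from inversions_of_weight[of w, OF this] show ?thesis by (simp add: rho_def)
qed

lemma Re_reflect: "Re (reflect t c k) = reflect t (\<lambda>i. Re (c i)) k"
  by (cases t) auto

lemma inversions_of_reflection:
  assumes n: "n \<ge> 2" and a: "\<alpha> \<in> simple_index n" and w: "w (weight n (rho n)) = weight n c"
  shows "inversions_of n (reflection (so_even n) (so_even_cartan n) (pos_root n \<alpha>) \<circ> w) \<le> Suc (inversions_of n w)"
    and "pairing (\<lambda>i. Re (c i)) \<alpha> < 0 \<Longrightarrow> inversions_of n w =
      Suc (inversions_of n (reflection (so_even n) (so_even_cartan n) (pos_root n \<alpha>) \<circ> w))"
proof -
  have \<alpha>: "\<alpha> \<in> pos_index n" using a simple_index_subset[OF n] by blast
  have "(reflection (so_even n) (so_even_cartan n) (pos_root n \<alpha>) \<circ> w) (weight n (rho n)) = weight n (reflect \<alpha> c)"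
    by (simp add: w reflection_pos_root[OF \<alpha>])
  note eq = inversions_of_weight[of "reflection (so_even n) (so_even_cartan n) (pos_root n \<alpha>) \<circ> w", OF this, unfolded Re_reflect] inversions_of_weight[of w, OF w]
  show "inversions_of n (reflection (so_even n) (so_even_cartan n) (pos_root n \<alpha>) \<circ> w) \<le> Suc (inversions_of n w)"
    unfolding eq by (rule inversions_reflect(1)[OF n a])
  show "inversions_of n w = Suc (inversions_of n (reflection (so_even n) (so_even_cartan n) (pos_root n \<alpha>) \<circ> w))"
    if "pairing (\<lambda>i. Re (c i)) \<alpha> < 0" unfolding eq by (rule inversions_reflect(2)[OF n a that])
qed

lemma weyl_group_weight:
  assumes "w \<in> weyl_group (so_even n) (so_even_cartan n)"
  obtains c' where "w (weight n c) = weight n c'"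
proof -
  obtain \<pi> s where "sign_perm_action n w \<pi> s" using weyl_group_sign_perm[OF assms] .
  thus ?thesis using that by (simp add: sign_perm_action_def)
qed

lemma weyl_group_Cons:
  assumes "w \<in> weyl_group (so_even n) (so_even_cartan n)" "a \<in> roots (so_even n) (so_even_cartan n)"
  shows "reflection (so_even n) (so_even_cartan n) a \<circ> w \<in> weyl_group (so_even n) (so_even_cartan n)"
proof -
  obtain as where as: "w = reflection_word (so_even n) (so_even_cartan n) as"
    "set as \<subseteq> roots (so_even n) (so_even_cartan n)" using assms(1) by (auto simp: weyl_group_def)
  have "reflection (so_even n) (so_even_cartan n) a \<circ> w = reflection_word (so_even n) (so_even_cartan n) (a # as)"
    unfolding as(1) by (simp add: reflection_word_Cons)
  moreover have "set (a # as) \<subseteq> roots (so_even n) (so_even_cartan n)" using as(2) assms(2) by simp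
  ultimately show ?thesis unfolding weyl_group_def by blast
qed

lemma simple_roots_subset: "n \<ge> 2 \<Longrightarrow> simple_roots (so_even_positive n) \<subseteq> roots (so_even n) (so_even_cartan n)"
  unfolding simple_roots_so_even using simple_index_subset pos_root_in_roots by blast

lemma inversions_rho: "inversions n (rho n) = 0"
proof -
  have "{t \<in> pos_index n. pairing (rho n) t < (0 :: real)} = {}"
    using height_ge_1[of _ n] by fastforce
  thus ?thesis unfolding inversions_def by (simp only: card.empty)
qed

text \<open>
  Each letter of a word in simple reflections creates at most one inversion.
\<close>

lemma inversions_of_word_le:
  assumes n: "n \<ge> 2" and as: "set as \<subseteq> simple_roots (so_even_positive n)"
  shows "inversions_of n (reflection_word (so_even n) (so_even_cartan n) as) \<le> length as"
  using as
proof (induction as)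
  case Nil
  have "inversions_of n id = inversions n (\<lambda>i. Re (rho n i))" by (rule inversions_of_weight) simp
  also have "\<dots> = inversions n (rho n)" by (rule inversions_cong) (simp add: rho_def)
  finally show ?case unfolding reflection_word_Nil inversions_rho by (simp only: list.size)
next
  case (Cons a as)
  let ?w = "reflection_word (so_even n) (so_even_cartan n) as"
  obtain \<alpha> where \<alpha>: "a = pos_root n \<alpha>" "\<alpha> \<in> simple_index n" using Cons.prems simple_roots_so_even[OF n] by auto
  have "?w \<in> weyl_group (so_even n) (so_even_cartan n)"
    unfolding weyl_group_def using Cons.prems simple_roots_subset[OF n] by auto
  then obtain c where c: "?w (weight n (rho n)) = weight n c" using weyl_group_weight by blast
  have step: "inversions_of n (reflection (so_even n) (so_even_cartan n) (pos_root n \<alpha>) \<circ> ?w) \<le> Suc (inversions_of n ?w)"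
    by (rule inversions_of_reflection(1)[where w = ?w, OF n \<alpha>(2) c])
  have "inversions_of n ?w \<le> length as" using Cons by simp
  with step show ?case unfolding reflection_word_Cons \<alpha>(1) list.size by linarith
qed

definition sign_change :: "nat \<Rightarrow> (nat \<Rightarrow> real) \<Rightarrow> functional \<Rightarrow> functional" where
  "sign_change n s l = (if l \<in> dual_space (so_even_cartan n)
     then weight n (\<lambda>i. of_real (s i) * l (cartan_mat n (unit_coord n i))) else l)"

lemma sign_change_weight: "sign_change n s (weight n c) = weight n (\<lambda>i. of_real (s i) * c i)"
  unfolding sign_change_def using weight_in_dual[of n c] by (auto intro!: weight_cong simp: weight_unit)

lemma sign_change_eqI:
  assumes "\<And>c. w (weight n c) = weight n (\<lambda>i. of_real (s i) * c i)"
    and "\<And>l. l \<notin> dual_space (so_even_cartan n) \<Longrightarrow> w l = l"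
  shows "w = sign_change n s"
proof
  fix l show "w l = sign_change n s l"
  proof (cases "l \<in> dual_space (so_even_cartan n)")
    case True
    then obtain c where l: "l = weight n c" by (auto simp: dual_space_eq)
    show ?thesis unfolding l sign_change_weight by (rule assms(1))
  qed (simp add: assms(2) sign_change_def)
qed

text \<open>
  Coordinate \<open>n - 1\<close> of \<open>\<rho>\<close> is 0 and says nothing about its sign; that sign is recovered
  from the condition that the product of all signs is 1.
\<close>

lemma sign_perm_fixed_eq_sign_change:
  assumes w: "sign_perm_action n w \<pi> s" and p: "\<And>i. i < n \<Longrightarrow> \<pi> i = i"
    and s: "\<And>i. i < n - 1 \<Longrightarrow> s i = \<sigma>" and \<sigma>: "\<sigma> ^ (n - 1) = 1" and n: "n > 0"
  shows "w = sign_change n (\<lambda>i. if i < n - 1 then \<sigma> else 1)"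
proof (rule sign_change_eqI)
  obtain k where k: "n = Suc k" using n by (cases n) auto
  have "(\<Prod>i<k. s i) = \<sigma> ^ k" using s k by simp
  moreover have "(\<Prod>i<n. s i) = 1" using w by (simp add: sign_perm_action_def)
  ultimately have last: "s (n - 1) = 1" using \<sigma> by (simp add: k)
  show "w (weight n c) = weight n (\<lambda>i. of_real (if i < n - 1 then \<sigma> else 1) * c i)" for c
  proof -
    have "w (weight n c) = weight n (\<lambda>i. of_real (s i) * c (\<pi> i))" using w by (simp add: sign_perm_action_def)
    also have "\<dots> = weight n (\<lambda>i. of_real (if i < n - 1 then \<sigma> else 1) * c i)"
    proof (rule weight_cong)
      fix i assume "i < n"
      hence "i < n - 1 \<or> i = n - 1" by auto
      thus "of_real (s i) * c (\<pi> i) = of_real (if i < n - 1 then \<sigma> else 1) * c i"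
        using p[OF \<open>i < n\<close>] s[of i] last by auto
    qed
    finally show ?thesis .
  qed
  show "w l = l" if "l \<notin> dual_space (so_even_cartan n)" for l
    using w that by (simp add: sign_perm_action_def)
qed

lemma pairing_both_signs:
  fixes v :: "nat \<Rightarrow> real"
  assumes "\<And>t. t \<in> pos_index n \<Longrightarrow> pairing v t \<ge> 0" "i < j" "j < n"
  shows "\<bar>v j\<bar> \<le> v i"
  using assms(1)[of "(i, j, False)"] assms(1)[of "(i, j, True)"] assms(2,3) by (simp add: pos_index_iff abs_le_iff)

text \<open>
  For \<open>\<sigma> = 1\<close> the hypothesis says that \<open>w \<rho>\<close> is dominant, which happens for elements without
  inversions. For \<open>\<sigma> = -1\<close> it says that \<open>w \<rho>\<close> is antidominant, which happens when all positive roots are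
  inverted. In both cases the absolute values of the coordinates of \<open>w \<rho>\<close> decrease.
\<close>

lemma weyl_element_eq_sign_change:
  assumes n: "n \<ge> 2" and w: "sign_perm_action n w \<pi> s" and \<sigma>: "\<sigma> = 1 \<or> \<sigma> = -1" "\<sigma> ^ (n - 1) = 1"
    and dom: "\<And>t. t \<in> pos_index n \<Longrightarrow> pairing (\<lambda>i. \<sigma> * (s i * rho n (\<pi> i))) t \<ge> 0"
  shows "w = sign_change n (\<lambda>i. if i < n - 1 then \<sigma> else 1)"
proof -
  let ?v = "\<lambda>i. s i * rho n (\<pi> i)"
  have ord: "\<bar>?v j\<bar> \<le> \<sigma> * ?v i" if "i < j" "j < n" for i j
    using pairing_both_signs[of n "\<lambda>i. \<sigma> * ?v i", OF dom that] \<sigma>(1) by auto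
  have fixed: "\<pi> i = i" if "i < n" for i
  proof (rule sign_perm_ordered_eq_id[OF w _ that])
    show "\<bar>?v j\<bar> \<le> \<bar>?v i\<bar>" if "i < j" "j < n" for i j
      using ord[OF that] \<sigma>(1) by auto
  qed
  have "s i = \<sigma>" if i: "i < n - 1" for i
  proof -
    have "0 \<le> \<sigma> * s i * rho n i" using ord[of i "n - 1"] i fixed[of i] by (simp add: mult.assoc)
    moreover have "rho n i > (0 :: real)" using i by (simp add: rho_def)
    ultimately have "0 \<le> \<sigma> * s i" by (simp add: zero_le_mult_iff)
    moreover have "s i = 1 \<or> s i = -1" using w by (simp add: sign_perm_action_def)
    ultimately show ?thesis using \<sigma>(1) by auto
  qed
  from sign_perm_fixed_eq_sign_change[OF w fixed this \<sigma>(2)] n show ?thesis by simp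
qed

lemma weyl_eq_id_if_no_inversions:
  assumes n: "n \<ge> 2" and w: "w \<in> weyl_group (so_even n) (so_even_cartan n)" and inv: "inversions_of n w = 0"
  shows "w = id"
proof -
  obtain \<pi> s where s: "sign_perm_action n w \<pi> s" using weyl_group_sign_perm[OF w] .
  have "{t \<in> pos_index n. pairing (\<lambda>i. s i * rho n (\<pi> i)) t < 0} = {}"
    using inv finite_pos_index[of n] unfolding inversions_of_sign_perm[OF s] inversions_def by simp
  hence "pairing (\<lambda>i. 1 * (s i * rho n (\<pi> i))) t \<ge> 0" if "t \<in> pos_index n" for t
    unfolding mult_1 using that by (intro leI notI) blast
  from weyl_element_eq_sign_change[OF n s _ _ this] have "w = sign_change n (\<lambda>i. 1)" by simp
  also have "\<dots> = id" by (rule sign_change_eqI[symmetric]) simp_all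
  finally show ?thesis .
qed

lemma weyl_eq_if_all_inversions:
  assumes n: "n \<ge> 2" "odd n" and w: "w \<in> weyl_group (so_even n) (so_even_cartan n)"
    and inv: "inversions_of n w = card (pos_index n)"
  shows "w = sign_change n (\<lambda>i. if i < n - 1 then -1 else 1)"
proof -
  obtain \<pi> s where s: "sign_perm_action n w \<pi> s" using weyl_group_sign_perm[OF w] .
  have "{t \<in> pos_index n. pairing (\<lambda>i. s i * rho n (\<pi> i)) t < 0} = pos_index n"
    using inv unfolding inversions_of_sign_perm[OF s] inversions_def
    by (intro card_subset_eq finite_pos_index) auto
  hence neg: "pairing (\<lambda>i. s i * rho n (\<pi> i)) t < 0" if "t \<in> pos_index n" for t
    using that by blast
  have minus: "pairing (\<lambda>i. -1 * v i) t = - pairing v t" for v :: "nat \<Rightarrow> real" and t by (cases t) auto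
  have "pairing (\<lambda>i. -1 * (s i * rho n (\<pi> i))) t \<ge> 0" if "t \<in> pos_index n" for t
    unfolding minus using neg[OF that] by linarith
  from weyl_element_eq_sign_change[OF n(1) s _ _ this] n show ?thesis by simp
qed

text \<open>
  Some simple reflection removes an inversion as long as there is one; when none is left the
  element is the identity.
\<close>

lemma reduced_word:
  assumes n: "n \<ge> 2" and w: "w \<in> weyl_group (so_even n) (so_even_cartan n)"
  shows "\<exists>as. set as \<subseteq> simple_roots (so_even_positive n) \<and> length as = inversions_of n w \<and>
    w = reflection_word (so_even n) (so_even_cartan n) as"
  using w
proof (induction "inversions_of n w" arbitrary: w)
  case 0
  hence "w = id" using weyl_eq_id_if_no_inversions[OF n] by simp
  thus ?case using 0 by (intro exI[of _ "[]"]) (simp add: reflection_word_Nil)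
next
  case (Suc k)
  obtain c where c: "w (weight n (rho n)) = weight n c" using weyl_group_weight[OF Suc.prems] by blast
  let ?v = "\<lambda>i. Re (c i)"
  have "\<exists>\<alpha>\<in>simple_index n. pairing ?v \<alpha> < 0"
  proof (rule ccontr)
    assume "\<not> ?thesis"
    hence "pairing ?v t \<ge> 0" if "t \<in> pos_index n" for t
      using pairing_nonneg_if_simple[OF n _ that, of ?v] by (auto simp: not_less)
    hence "{t \<in> pos_index n. pairing ?v t < 0} = {}" by (auto simp: not_less)
    hence "inversions_of n w = 0" unfolding inversions_of_weight[of w, OF c] inversions_def by (simp only: card.empty)
    thus False using Suc.hyps(2) by simp
  qed
  then obtain \<alpha> where \<alpha>: "\<alpha> \<in> simple_index n" "pairing ?v \<alpha> < 0" by blast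
  have p: "\<alpha> \<in> pos_index n" using \<alpha>(1) simple_index_subset[OF n] by blast
  let ?r = "reflection (so_even n) (so_even_cartan n) (pos_root n \<alpha>)"
  have "inversions_of n w = Suc (inversions_of n (?r \<circ> w))"
    by (rule inversions_of_reflection(2)[where w = w, OF n \<alpha>(1) c \<alpha>(2)])
  hence k: "k = inversions_of n (?r \<circ> w)" using Suc.hyps(2) by simp
  have "?r \<circ> w \<in> weyl_group (so_even n) (so_even_cartan n)"
    by (rule weyl_group_Cons[OF Suc.prems pos_root_in_roots[OF p]])
  from Suc.hyps(1)[OF k this] obtain as where as: "set as \<subseteq> simple_roots (so_even_positive n)"
    "length as = inversions_of n (?r \<circ> w)" "?r \<circ> w = reflection_word (so_even n) (so_even_cartan n) as" by blast
  have "w = ?r \<circ> (?r \<circ> w)" by (rule reflection_involution[OF p, symmetric])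
  also have "\<dots> = reflection_word (so_even n) (so_even_cartan n) (pos_root n \<alpha> # as)"
    unfolding as(3) reflection_word_Cons ..
  finally have "w = reflection_word (so_even n) (so_even_cartan n) (pos_root n \<alpha> # as)" .
  moreover have "set (pos_root n \<alpha> # as) \<subseteq> simple_roots (so_even_positive n)"
    using as(1) \<alpha>(1) simple_roots_so_even[OF n] by auto
  moreover have "length (pos_root n \<alpha> # as) = inversions_of n w" using as(2) k Suc.hyps(2) by simp
  ultimately show ?case by blast
qed

lemma weyl_length_eq_inversions:
  assumes n: "n \<ge> 2" and w: "w \<in> weyl_group (so_even n) (so_even_cartan n)"
  shows "weyl_length (so_even n) (so_even_cartan n) (so_even_positive n) w = inversions_of n w"
  unfolding weyl_length_def
proof (rule Least_equality)
  show "\<exists>as. set as \<subseteq> simple_roots (so_even_positive n) \<and> length as = inversions_of n w \<and>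
      w = reflection_word (so_even n) (so_even_cartan n) as"
    by (rule reduced_word[OF n w])
  fix k assume "\<exists>as. set as \<subseteq> simple_roots (so_even_positive n) \<and> length as = k \<and>
      w = reflection_word (so_even n) (so_even_cartan n) as"
  thus "inversions_of n w \<le> k" using inversions_of_word_le[OF n] by auto
qed

text \<open>
  The reflections in \<open>\<epsilon>\<^sub>i - \<epsilon>\<^sub>j\<close> and \<open>\<epsilon>\<^sub>i + \<epsilon>\<^sub>j\<close> together negate the coordinates \<open>i\<close> and \<open>j\<close>.
\<close>

lemma negate_pairs_in_weyl_group:
  assumes "2 * k \<le> n"
  shows "sign_change n (\<lambda>i. if i < 2 * k then -1 else 1) \<in> weyl_group (so_even n) (so_even_cartan n)"
  using assms
proof (induction k)
  case 0
  have "sign_change n (\<lambda>i. 1) = id" by (rule sign_change_eqI[symmetric]) simp_all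
  moreover have "id \<in> weyl_group (so_even n) (so_even_cartan n)"
    unfolding weyl_group_def by (intro CollectI exI[of _ "[]"]) (simp add: reflection_word_Nil)
  ultimately show ?case by (simp only: mult_0_right not_less0 if_False)
next
  case (Suc k)
  let ?w = "sign_change n (\<lambda>i. if i < 2 * k then -1 else 1)"
  let ?t = "\<lambda>b. (2 * k, Suc (2 * k), b)"
  let ?r = "\<lambda>b. reflection (so_even n) (so_even_cartan n) (pos_root n (?t b))"
  have t: "?t b \<in> pos_index n" for b using Suc.prems by (simp add: pos_index_iff)
  have "?r True \<circ> (?r False \<circ> ?w) \<in> weyl_group (so_even n) (so_even_cartan n)"
    by (intro weyl_group_Cons pos_root_in_roots t) (use Suc in simp)
  moreover have "?r True \<circ> (?r False \<circ> ?w) = sign_change n (\<lambda>i. if i < 2 * Suc k then -1 else 1)"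
  proof (rule sign_change_eqI)
    show "(?r True \<circ> (?r False \<circ> ?w)) (weight n c) = weight n (\<lambda>i. of_real (if i < 2 * Suc k then -1 else 1) * c i)" for c
      by (simp only: o_apply sign_change_weight reflection_pos_root[OF t]) (rule weight_cong, auto)
    show "(?r True \<circ> (?r False \<circ> ?w)) l = l" if "l \<notin> dual_space (so_even_cartan n)" for l
      using that by (simp add: sign_change_def reflection_def)
  qed
  ultimately show ?case by simp
qed

text \<open>
  The length is the number of inversions, which is largest when every positive root is inverted. As
  \<open>n - 1\<close> is even, negating the first \<open>n - 1\<close> coordinates lies in the Weyl group; it is the only
  element with all inversions.
\<close>

theorem longest_element_so_even:
  assumes n: "n \<ge> 2" "odd n"
  shows "longest_element (so_even n) (so_even_cartan n) (so_even_positive n) =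
    sign_change n (\<lambda>i. if i < n - 1 then -1 else 1)"
proof -
  let ?W = "weyl_group (so_even n) (so_even_cartan n)" and ?w0 = "sign_change n (\<lambda>i. if i < n - 1 then -1 else 1)"
  have len: "weyl_length (so_even n) (so_even_cartan n) (so_even_positive n) w = inversions_of n w" if "w \<in> ?W" for w
    by (rule weyl_length_eq_inversions[OF n(1) that])
  obtain k where k: "n = 2 * k + 1" using n(2) by (elim oddE)
  have w0: "?w0 \<in> ?W" using negate_pairs_in_weyl_group[of k n] k by simp
  have max: "inversions_of n w \<le> card (pos_index n)" for w
    unfolding inversions_of_def inversions_def by (intro card_mono finite_pos_index) auto
  have "inversions_of n ?w0 = card (pos_index n)"
  proof -
    have "inversions_of n ?w0 = inversions n (\<lambda>i. Re (of_real (if i < n - 1 then -1 else 1) * rho n i))"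
      by (rule inversions_of_weight) (rule sign_change_weight)
    also have "\<dots> = inversions n (\<lambda>i. - rho n i)"
      by (rule inversions_cong) (auto simp: rho_def)
    also have "\<dots> = card (pos_index n)"
    proof -
      have "pairing (\<lambda>i. - rho n i) t < (0 :: real)" if "t \<in> pos_index n" for t
        using height_ge_1[OF that] by (cases t) auto
      hence "{t \<in> pos_index n. pairing (\<lambda>i. - rho n i) t < (0 :: real)} = pos_index n" by blast
      thus ?thesis unfolding inversions_def by simp
    qed
    finally show ?thesis .
  qed
  hence top: "inversions_of n w \<le> inversions_of n ?w0" for w using max by simp
  show ?thesis unfolding longest_element_def
  proof (rule the_equality)
    show "?w0 \<in> ?W \<and> (\<forall>v\<in>?W. weyl_length (so_even n) (so_even_cartan n) (so_even_positive n) v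
        \<le> weyl_length (so_even n) (so_even_cartan n) (so_even_positive n) ?w0)"
      using w0 top by (simp add: len)
    fix w assume w: "w \<in> ?W \<and> (\<forall>v\<in>?W. weyl_length (so_even n) (so_even_cartan n) (so_even_positive n) v
        \<le> weyl_length (so_even n) (so_even_cartan n) (so_even_positive n) w)"
    hence "inversions_of n ?w0 \<le> inversions_of n w" using w0 len by metis
    hence "inversions_of n w = card (pos_index n)"
      using max[of w] \<open>inversions_of n ?w0 = card (pos_index n)\<close> by simp
    thus "w = ?w0" using w weyl_eq_if_all_inversions[OF n] by blast
  qed
qed

section \<open>Self-dual weights and their dimensions\<close>

text \<open>
  The condition forces the last coordinate to be its own negative, that is 0. Pairing with the coroots of
  the roots \<open>\<epsilon>\<^sub>i - \<epsilon>\<^sub>j\<close>, where \<open>j\<close> is the last index, then shows that the other coordinates are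
  integers and rules out the half-integral weights.
\<close>

lemma self_dual_weights_so_even:
  assumes n: "n \<ge> 3" "odd n"
  shows "self_dual_weights (so_even n) (so_even_cartan n) (so_even_positive n) =
    {weight n (\<lambda>i. of_int (c i)) | c. c \<in> lattice_points (n - 1)}"
proof (intro equalityI subsetI)
  have n2: "n \<ge> 2" using n(1) by simp
  fix l assume l: "l \<in> self_dual_weights (so_even n) (so_even_cartan n) (so_even_positive n)"
  hence lat: "l \<in> weight_lattice (so_even n) (so_even_cartan n)"
    and sd: "longest_element (so_even n) (so_even_cartan n) (so_even_positive n) l = (\<lambda>X. - l X)"
    by (auto simp: self_dual_weights_def)
  obtain x where x: "l = weight n x" using lat by (auto simp: weight_lattice_def dual_space_eq)
  have "(\<lambda>X. - weight n x X) = weight n (\<lambda>i. - x i)" by (simp add: weight_def sum_negf)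
  hence "\<forall>i<n. of_real (if i < n - 1 then -1 else 1) * x i = - x i"
    using sd n unfolding x longest_element_so_even[OF _ n(2)] sign_change_weight
    by (simp add: longest_element_so_even sign_change_weight weight_eq_iff)
  from this[rule_format, of "n - 1"] n have last: "x (n - 1) = 0" by (simp add: equation_minus_iff)
  have int: "x i \<in> \<int>" if i: "i < n - 1" for i
  proof -
    have t: "(i, n - 1, False) \<in> pos_index n" using i by (simp add: pos_index_iff)
    have "l (coroot (so_even n) (so_even_cartan n) (pos_root n (i, n - 1, False))) \<in> \<int>"
      using lat pos_root_in_roots[OF t] unfolding weight_lattice_def by blast
    thus ?thesis using last unfolding x weight_coroot_pos[OF t] by simp
  qed
  define c where "c = (\<lambda>i. if i < n - 1 then \<lfloor>Re (x i)\<rfloor> else 0)"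
  have "weight n x = weight n (\<lambda>i. of_int (c i))"
  proof (rule weight_cong)
    fix i assume i: "i < n"
    show "x i = of_int (c i)"
    proof (cases "i < n - 1")
      case True
      from int[OF this] obtain k where "x i = of_int k" by (auto elim: Ints_cases)
      thus ?thesis using True by (simp add: c_def)
    next
      case False
      hence "i = n - 1" using i by simp
      thus ?thesis using last by (simp add: c_def)
    qed
  qed
  moreover have "c \<in> lattice_points (n - 1)" by (simp add: c_def lattice_points_def)
  ultimately show "l \<in> {weight n (\<lambda>i. of_int (c i)) | c. c \<in> lattice_points (n - 1)}"
    unfolding x by blast
next
  have n2: "n \<ge> 2" using n(1) by simp
  fix l assume "l \<in> {weight n (\<lambda>i. of_int (c i)) | c. c \<in> lattice_points (n - 1)}"
  then obtain c where l: "l = weight n (\<lambda>i. of_int (c i))" and c: "c \<in> lattice_points (n - 1)" by blast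
  have "l (coroot (so_even n) (so_even_cartan n) a) \<in> \<int>" if a: "a \<in> roots (so_even n) (so_even_cartan n)" for a
  proof -
    obtain p q where "a = so_root n p q" "root_index n p q" using a by (auto simp: roots_so_even)
    thus ?thesis unfolding l by (simp add: weight_coroot signed_coord_def)
  qed
  hence "l \<in> weight_lattice (so_even n) (so_even_cartan n)"
    using weight_in_dual l by (simp add: weight_lattice_def)
  moreover have "longest_element (so_even n) (so_even_cartan n) (so_even_positive n) l = (\<lambda>X. - l X)"
  proof -
    have "longest_element (so_even n) (so_even_cartan n) (so_even_positive n) l
        = weight n (\<lambda>i. of_real (if i < n - 1 then -1 else 1) * of_int (c i))"
      unfolding l longest_element_so_even[OF n2 n(2)] by (rule sign_change_weight)
    also have "\<dots> = weight n (\<lambda>i. - of_int (c i))"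
      by (rule weight_cong) (use c in \<open>auto simp: lattice_points_def\<close>)
    also have "\<dots> = (\<lambda>X. - l X)" unfolding l by (simp add: weight_def sum_negf)
    finally show ?thesis .
  qed
  ultimately show "l \<in> self_dual_weights (so_even n) (so_even_cartan n) (so_even_positive n)"
    by (simp add: self_dual_weights_def)
qed

lemma sum_pos_index:
  "(\<Sum>t\<in>pos_index n. f t) = (\<Sum>i<n. \<Sum>j\<in>{i<..<n}. f (i, j, False) + f (i, j, True))"
proof -
  have "(\<Sum>t\<in>pos_index n. f t) = (\<Sum>i<n. \<Sum>jb\<in>{i<..<n} \<times> UNIV. f (i, jb))"
    unfolding pos_index_def by (subst sum.Sigma) auto
  also have "\<dots> = (\<Sum>i<n. \<Sum>j\<in>{i<..<n}. \<Sum>b\<in>UNIV. f (i, j, b))"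
    by (simp only: sum.cartesian_product split_def prod.collapse)
  finally show ?thesis by (simp add: UNIV_bool add.commute)
qed

lemma prod_pos_index:
  "(\<Prod>t\<in>pos_index n. f t) = (\<Prod>i<n. \<Prod>j\<in>{i<..<n}. f (i, j, False) * f (i, j, True))"
proof -
  have "(\<Prod>t\<in>pos_index n. f t) = (\<Prod>i<n. \<Prod>jb\<in>{i<..<n} \<times> UNIV. f (i, jb))"
    unfolding pos_index_def by (subst prod.Sigma) auto
  also have "\<dots> = (\<Prod>i<n. \<Prod>j\<in>{i<..<n}. \<Prod>b\<in>UNIV. f (i, j, b))"
    by (simp only: prod.cartesian_product split_def prod.collapse)
  finally show ?thesis by (simp add: UNIV_bool mult.commute)
qed

lemma half_sum_so_even: "half_sum (so_even_positive n) = weight n (rho n)"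
proof
  fix H
  have "(\<Sum>a\<in>so_even_positive n. a H) = (\<Sum>t\<in>pos_index n. pos_root n t H)"
    unfolding so_even_positive_eq by (subst sum.reindex[OF inj_on_pos_root]) simp
  moreover have "(\<Sum>t\<in>pos_index n. pos_root n t H) = 2 * weight n (rho n) H"
  proof (cases "H \<in> so_even_cartan n")
    case True
    then obtain t where H: "H = cartan_mat n t" by (auto simp: so_even_cartan_eq)
    have "(\<Sum>u\<in>pos_index n. pos_root n u H) = (\<Sum>i<n. \<Sum>j\<in>{i<..<n}. 2 * t i)"
      unfolding sum_pos_index by (intro sum.cong refl) (auto simp: H root_cartan signed_coord_def)
    also have "\<dots> = 2 * (\<Sum>i<n. rho n i * t i)"
      unfolding sum_distrib_left by (intro sum.cong refl) (simp add: rho_def mult.left_commute)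
    finally show ?thesis unfolding H weight_cartan .
  next
    case False
    have "pos_root n t H = 0" for t using False by (cases t) (simp add: so_root_def)
    thus ?thesis using False by (simp add: weight_outside)
  qed
  ultimately show "half_sum (so_even_positive n) H = weight n (rho n) H"
    by (simp add: half_sum_def)
qed

lemma pairing_add: "pairing (\<lambda>i. x i + y i) t = pairing x t + pairing y t"
  by (cases t) auto

text \<open>
  Coordinates are reversed so that \<open>\<rho>\<close> becomes the vector \<open>0, 1, \<dots>, n - 1\<close>.
\<close>

lemma prod_pairing_eq_square_vandermonde:
  fixes a :: "nat \<Rightarrow> int"
  shows "(\<Prod>t\<in>pos_index n. pairing a t) = square_vandermonde n (\<lambda>k. a (n - 1 - k))"
proof -
  have "(\<Prod>t\<in>pos_index n. pairing a t) = (\<Prod>(i, j)\<in>(SIGMA i:{..<n}. {i<..<n}). (a i)\<^sup>2 - (a j)\<^sup>2)"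
    unfolding prod_pos_index by (subst prod.Sigma) (auto simp: algebra_simps power2_eq_square)
  also have "\<dots> = (\<Prod>(k, l)\<in>(SIGMA k:{..<n}. {..<k}). (a (n - 1 - k))\<^sup>2 - (a (n - 1 - l))\<^sup>2)"
    by (rule prod.reindex_bij_witness[of _ "\<lambda>(k, l). (n - 1 - k, n - 1 - l)" "\<lambda>(i, j). (n - 1 - i, n - 1 - j)"]) auto
  also have "\<dots> = square_vandermonde n (\<lambda>k. a (n - 1 - k))"
    unfolding square_vandermonde_def by (subst prod.Sigma) auto
  finally show ?thesis .
qed

lemma pairing_of_int: "pairing (\<lambda>i. of_int (v i)) t = of_int (pairing v t)"
  by (cases t) auto

lemma weyl_dim_so_even:
  "weyl_dim (so_even n) (so_even_cartan n) (so_even_positive n) (weight n (\<lambda>i. of_int (c i))) =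
     of_int (square_vandermonde n (\<lambda>k. c (n - 1 - k) + int k)) / of_int (square_vandermonde n int)"
proof -
  let ?a = "\<lambda>i. c i + rho n i"
  have rho: "(rho n :: nat \<Rightarrow> complex) = (\<lambda>i. of_int (rho n i))" by (simp add: rho_def fun_eq_iff)
  have "weyl_dim (so_even n) (so_even_cartan n) (so_even_positive n) (weight n (\<lambda>i. of_int (c i)))
      = (\<Prod>t\<in>pos_index n. (pairing (\<lambda>i. of_int (c i)) t + pairing (rho n) t) / pairing (rho n) t)"
    unfolding weyl_dim_def so_even_positive_eq
    by (subst prod.reindex[OF inj_on_pos_root])
       (auto intro!: prod.cong simp: weight_coroot_pos half_sum_so_even so_even_positive_eq[symmetric])
  also have "\<dots> = (\<Prod>t\<in>pos_index n. of_int (pairing ?a t) / of_int (pairing (rho n) t))"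
    unfolding rho pairing_of_int pairing_add by simp
  also have "\<dots> = of_int (\<Prod>t\<in>pos_index n. pairing ?a t) / of_int (\<Prod>t\<in>pos_index n. pairing (rho n) t)"
    by (simp add: prod_dividef)
  also have "(\<Prod>t\<in>pos_index n. pairing ?a t) = square_vandermonde n (\<lambda>k. c (n - 1 - k) + int k)"
    unfolding prod_pairing_eq_square_vandermonde square_vandermonde_def
    by (intro prod.cong refl) (auto simp: rho_def)
  also have "(\<Prod>t\<in>pos_index n. pairing (rho n) t) = square_vandermonde n int"
    unfolding prod_pairing_eq_square_vandermonde square_vandermonde_def
    by (intro prod.cong refl) (auto simp: rho_def)
  finally show ?thesis .
qed

lemma weights_not_dvd_iff:
  "weight n (\<lambda>i. of_int (c i)) \<in> weights_not_dvd (so_even n) (so_even_cartan n) (so_even_positive n) m \<longleftrightarrow>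
     weight n (\<lambda>i. of_int (c i)) \<in> weight_lattice (so_even n) (so_even_cartan n) \<and>
     \<not> int m * square_vandermonde n int dvd square_vandermonde n (\<lambda>k. c (n - 1 - k) + int k)"
proof -
  let ?V = "square_vandermonde n (\<lambda>k. c (n - 1 - k) + int k)" and ?C = "square_vandermonde n int"
  have C: "?C \<noteq> 0" using square_vandermonde_int_pos[of n] by simp
  have eq: "(of_int ?V / of_int ?C = (of_nat m * of_int k :: complex)) \<longleftrightarrow> ?V = int m * ?C * k" for k
  proof -
    have "(of_int ?V / of_int ?C = (of_nat m * of_int k :: complex)) \<longleftrightarrow> of_int ?V = (of_int (int m * ?C * k) :: complex)"
      using C by (simp add: field_simps)
    thus ?thesis by (simp only: of_int_eq_iff)
  qed
  show ?thesis unfolding weights_not_dvd_def dvd_def mem_Collect_eq weyl_dim_so_even eq by (rule refl)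
qed

section \<open>The bound\<close>

text \<open>
  The coordinates of \<open>\<lambda> + \<rho>\<close> in reverse order. The entry at 0 belongs to the last coordinate and
  vanishes for self-dual \<open>\<lambda>\<close>.
\<close>

definition shifted_reversed :: "nat \<Rightarrow> (nat \<Rightarrow> int) \<Rightarrow> nat \<Rightarrow> int" where
  "shifted_reversed n c k = c (n - 1 - k) + int k"

text \<open>
  The contrapositive of the divisibility result for determinants. The residues are not only distinct
  but also nonzero, because the vanishing last coordinate takes the residue 0.
\<close>

lemma not_dvd_imp_distinct_residues:
  fixes p e K n :: nat
  assumes n: "n > 0" and p: "prime p" and K: "2 * n - 2 < p ^ Suc K" and c: "c \<in> residue_box (n - 1) q"
    and ndvd: "\<not> int (p ^ e) * square_vandermonde n int dvd square_vandermonde n (shifted_reversed n c)"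
  shows "c \<in> distinct_residues (n - 1) q (int (p ^ (K + e))) (\<lambda>i. int (n - 1 - i))"
proof -
  let ?M = "int (p ^ (K + e))"
  have neq: "shifted_reversed n c i mod ?M \<noteq> shifted_reversed n c j mod ?M" if "i < n" "j < n" "i \<noteq> j" for i j
    using prime_power_dvd_square_vandermonde[OF p K that, of "shifted_reversed n c" e] ndvd by (auto simp: cong_def)
  have val: "c i + int (n - 1 - i) = shifted_reversed n c (n - 1 - i)" if "i < n" for i
    using that by (simp add: shifted_reversed_def)
  have zero: "shifted_reversed n c 0 = 0" using c n by (simp add: shifted_reversed_def residue_box_def lattice_points_def)
  have "inj_on (\<lambda>i. (c i + int (n - 1 - i)) mod ?M) {..<n - 1}"
  proof (rule inj_onI, rule ccontr)
    fix i j assume ij: "i \<in> {..<n - 1}" "j \<in> {..<n - 1}" "i \<noteq> j"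
      "(c i + int (n - 1 - i)) mod ?M = (c j + int (n - 1 - j)) mod ?M"
    have "n - 1 - i \<noteq> n - 1 - j" "n - 1 - i < n" "n - 1 - j < n" using ij by auto
    thus False using neq[of "n - 1 - i" "n - 1 - j"] ij val[of i] val[of j] by simp
  qed
  moreover have "(c i + int (n - 1 - i)) mod ?M \<noteq> 0" if i: "i < n - 1" for i
    using neq[of "n - 1 - i" 0] zero val[of i] i by simp
  ultimately show ?thesis unfolding distinct_residues_def using c by simp
qed

text \<open>
  The dimension modulo \<open>m\<close> is periodic in the coordinates, so the density is a proportion in a box.
\<close>

lemma self_dual_density_eq:
  assumes n: "n \<ge> 3" "odd n" and q: "q > 0" "int m * square_vandermonde n int dvd q"
  shows "self_dual_density (so_even n) (so_even_cartan n) (so_even_positive n) m =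
    real (card {c \<in> residue_box (n - 1) q. \<not> int m * square_vandermonde n int dvd square_vandermonde n (shifted_reversed n c)})
      / of_int q ^ (n - 1)"
proof -
  let ?C = "square_vandermonde n int"
  let ?bad = "\<lambda>c. \<not> int m * ?C dvd square_vandermonde n (shifted_reversed n c)"
  let ?F = "{c \<in> residue_box (n - 1) q. ?bad c}"
  let ?sd = "self_dual_weights (so_even n) (so_even_cartan n) (so_even_positive n)"
  let ?nd = "weights_not_dvd (so_even n) (so_even_cartan n) (so_even_positive n) m"
  let ?E = "\<lambda>c. lattice_embedding (coord_functional n) (n - 1) (\<lambda>i. of_int (c i))"
  have nS: "n = Suc (n - 1)" using n by simp
  have emb: "weight n (\<lambda>i. of_int (c i)) = ?E c" if "c \<in> lattice_points (n - 1)" for c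
  proof -
    have "c (n - 1) = 0" using that by (simp add: lattice_points_def)
    thus ?thesis unfolding weight_def lattice_embedding_def
      by (subst (1) nS) (simp add: fun_eq_iff)
  qed
  have sd: "?sd = {?E c | c. c \<in> lattice_points (n - 1)}"
    unfolding self_dual_weights_so_even[OF n] using emb by (metis (no_types, lifting))
  have res: "(\<lambda>i. c i mod q) \<in> residue_box (n - 1) q" if "c \<in> lattice_points (n - 1)" for c
    using that q by (auto simp: residue_box_def lattice_points_def)
  have period: "?bad (\<lambda>i. c i mod q) \<longleftrightarrow> ?bad c" for c
  proof -
    have "[square_vandermonde n (shifted_reversed n (\<lambda>i. c i mod q)) = square_vandermonde n (shifted_reversed n c)] (mod q)"
      by (rule square_vandermonde_cong) (auto simp: shifted_reversed_def cong_def mod_simps)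
    hence "[square_vandermonde n (shifted_reversed n (\<lambda>i. c i mod q)) = square_vandermonde n (shifted_reversed n c)] (mod int m * ?C)"
      by (rule cong_dvd_modulus[OF _ q(2)])
    from cong_dvd_iff[OF this] show ?thesis by simp
  qed
  have member: "weight n (\<lambda>i. of_int (c i)) \<in> ?nd \<longleftrightarrow> (\<lambda>i. c i mod q) \<in> ?F" if c: "c \<in> lattice_points (n - 1)" for c
  proof -
    have "weight n (\<lambda>i. of_int (c i)) \<in> ?sd" unfolding self_dual_weights_so_even[OF n] using c by blast
    hence "weight n (\<lambda>i. of_int (c i)) \<in> weight_lattice (so_even n) (so_even_cartan n)"
      by (simp add: self_dual_weights_def)
    thus ?thesis using res[OF c] period[of c] unfolding weights_not_dvd_iff shifted_reversed_def[abs_def] by simp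
  qed
  have inter: "?nd \<inter> ?sd = {?E c | c. c \<in> lattice_points (n - 1) \<and> (\<lambda>i. c i mod q) \<in> ?F}"
  proof (intro equalityI subsetI)
    fix l assume "l \<in> ?nd \<inter> ?sd"
    then obtain c where c: "l = ?E c" "c \<in> lattice_points (n - 1)" "l \<in> ?nd" unfolding sd by auto
    thus "l \<in> {?E c | c. c \<in> lattice_points (n - 1) \<and> (\<lambda>i. c i mod q) \<in> ?F}"
      using member[OF c(2)] emb[OF c(2)] by (intro CollectI exI[of _ c]) simp
  next
    fix l assume "l \<in> {?E c | c. c \<in> lattice_points (n - 1) \<and> (\<lambda>i. c i mod q) \<in> ?F}"
    then obtain c where c: "l = ?E c" "c \<in> lattice_points (n - 1)" "(\<lambda>i. c i mod q) \<in> ?F" by auto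
    have "l \<in> ?nd" using member[OF c(2)] c(3) unfolding c(1) emb[OF c(2), symmetric] by simp
    moreover have "l \<in> ?sd" unfolding sd c(1) using c(2) by blast
    ultimately show "l \<in> ?nd \<inter> ?sd" by blast
  qed
  show ?thesis unfolding self_dual_density_def
  proof (rule lattice_density_periodic[OF _ q(1) _ sd inter])
    fix i j assume ij: "i < n - 1" "j < n - 1"
    show "coord_functional n j (cartan_mat n (unit_coord n i)) = (if i = j then 1 else 0)"
    proof -
      have "j < n" "j + n \<noteq> i" using ij by linarith+
      thus ?thesis by (simp add: coord_functional_cartan unit_coord_def)
    qed
  qed auto
qed

theorem theorem6p2:
  fixes m n :: nat
  assumes "m > 0" and "odd n" and "n \<ge> 3"
  shows "self_dual_density (so_even n) (so_even_cartan n) (so_even_positive n) m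
           \<le> real (card (prime_factors m)) * exp (- (real n / (16 * real m)))"
proof -
  let ?d = "n - 1" and ?C = "square_vandermonde n int" and ?s = "\<lambda>i. int (n - 1 - i)"
  let ?e = "\<lambda>p. multiplicity p m"
  have "\<exists>K. p ^ K \<le> 2 * n - 2 \<and> 2 * n - 2 < p ^ Suc K" if "p \<in> prime_factors m" for p
  proof -
    have "p \<ge> 2" using that by (auto simp: in_prime_factors_iff intro: prime_ge_2_nat)
    moreover have "2 * n - 2 \<ge> 1" using assms(3) by simp
    ultimately show ?thesis by (rule prime_power_bracket) blast
  qed
  then obtain K where K: "\<And>p. p \<in> prime_factors m \<Longrightarrow> p ^ K p \<le> 2 * n - 2"
    "\<And>p. p \<in> prime_factors m \<Longrightarrow> 2 * n - 2 < p ^ Suc (K p)" by metis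
  \<comment> \<open>The bound \<open>2 n - 2\<close> is the largest order of a binomial coefficient in the determinant.\<close>
  define M where "M = (\<lambda>p. p ^ (K p + ?e p))"
  have M_pos: "M p > 0" if "p \<in> prime_factors m" for p
    using that by (auto simp: M_def in_prime_factors_iff intro: prime_gt_0_nat)
  \<comment> \<open>a common period for the divisibility of the dimension by \<open>m\<close> and for all conditions on residues\<close>
  define q where "q = int m * ?C * int (\<Prod>p\<in>prime_factors m. M p)"
  have q0: "q > 0"
    unfolding q_def using assms(1) square_vandermonde_int_pos[of n] M_pos
    by (intro mult_pos_pos) (auto simp del: of_nat_prod intro!: prod_pos)
  have Mq: "int (M p) dvd q" if "p \<in> prime_factors m" for p
  proof -
    have "M p dvd (\<Prod>p\<in>prime_factors m. M p)" using that by (intro dvd_prodI) auto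
    thus ?thesis unfolding q_def by (intro dvd_mult) (simp only: of_nat_dvd_iff)
  qed
  let ?F = "{c \<in> residue_box ?d q. \<not> int m * ?C dvd square_vandermonde n (shifted_reversed n c)}"
  let ?G = "\<lambda>p. distinct_residues ?d q (int (M p)) ?s"
  have F: "?F \<subseteq> (\<Union>p\<in>prime_factors m. ?G p)"
  proof
    fix c assume c: "c \<in> ?F"
    obtain x where x: "square_vandermonde n (shifted_reversed n c) = ?C * x"
      using dvd_square_vandermonde[of n "shifted_reversed n c"] by (elim dvdE)
    have C: "?C \<noteq> 0" using square_vandermonde_int_pos[of n] by simp
    have "\<not> int m dvd x" using c C by (simp add: x mult.commute[of "int m"])
    then obtain p where p: "p \<in> prime_factors m" "\<not> int (p ^ ?e p) dvd x"
      using exists_prime_power_not_dvd[OF assms(1)] by blast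
    have "\<not> int (p ^ ?e p) * ?C dvd square_vandermonde n (shifted_reversed n c)"
      using p(2) C unfolding x mult.commute[of _ ?C] by (simp only: dvd_mult_cancel_left de_Morgan_disj simp_thms)
    hence "c \<in> ?G p" unfolding M_def
      using c assms(3) p(1) K(2)[OF p(1)] by (intro not_dvd_imp_distinct_residues) (auto simp: in_prime_factors_iff)
    thus "c \<in> (\<Union>p\<in>prime_factors m. ?G p)" using p(1) by blast
  qed
  have G: "real (card (?G p)) \<le> of_int q ^ ?d * exp (- (real n / (16 * real m)))" if p: "p \<in> prime_factors m" for p
  proof -
    have "p ^ ?e p \<le> m" using assms(1) by (intro dvd_imp_le multiplicity_dvd)
    hence "M p \<le> (2 * n - 2) * m" unfolding M_def power_add using K(1)[OF p] by (intro mult_mono) auto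
    hence "real (M p) \<le> real ((2 * n - 2) * m)" by (simp only: of_nat_le_iff)
    also have "\<dots> = 2 * real ?d * real m" using assms(3) by (simp add: of_nat_diff algebra_simps)
    finally have Mle: "real (M p) \<le> 2 * real ?d * real m" .
    have d0: "real ?d > 0" "real m > 0" using assms by auto
    have "real n / (16 * real m) \<le> real n / (4 * real m)" using d0 by (intro divide_left_mono) auto
    also have "\<dots> = real ?d * real n / (2 * (2 * real ?d * real m))" using d0 by (simp add: field_simps)
    also have "\<dots> \<le> real ?d * real n / (2 * real (M p))"
      using Mle d0 M_pos[OF p] by (intro divide_left_mono mult_left_mono mult_pos_pos) auto
    also have "\<dots> = real ?d * (real ?d + 1) / (2 * real (M p))" using assms(3) by (simp add: of_nat_diff)
    finally have "exp (- (real ?d * (real ?d + 1) / (2 * of_int (int (M p))))) \<le> exp (- (real n / (16 * real m)))"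
      by simp
    hence "of_int q ^ ?d * exp (- (real ?d * (real ?d + 1) / (2 * of_int (int (M p)))))
        \<le> of_int q ^ ?d * exp (- (real n / (16 * real m)))"
      using q0 by (intro mult_left_mono) auto
    with card_distinct_residues_le[OF _ Mq[OF p] q0, of ?d ?s] M_pos[OF p] show ?thesis by simp
  qed
  have fin: "finite (?G p)" for p unfolding distinct_residues_def using finite_residue_box by simp
  have "card ?F \<le> card (\<Union>p\<in>prime_factors m. ?G p)" using F fin by (intro card_mono) auto
  also have "\<dots> \<le> (\<Sum>p\<in>prime_factors m. card (?G p))" by (rule card_UN_le) simp
  finally have "real (card ?F) \<le> (\<Sum>p\<in>prime_factors m. real (card (?G p)))"
    by (simp only: of_nat_sum[symmetric] of_nat_le_iff)
  also have "\<dots> \<le> (\<Sum>p\<in>prime_factors m. of_int q ^ ?d * exp (- (real n / (16 * real m))))"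
    by (rule sum_mono) (rule G)
  also have "\<dots> = of_int q ^ ?d * (real (card (prime_factors m)) * exp (- (real n / (16 * real m))))"
    by simp
  finally have "real (card ?F) / of_int q ^ ?d \<le> real (card (prime_factors m)) * exp (- (real n / (16 * real m)))"
    using q0 by (simp add: divide_le_eq mult.commute)
  moreover have "self_dual_density (so_even n) (so_even_cartan n) (so_even_positive n) m = real (card ?F) / of_int q ^ ?d"
    by (rule self_dual_density_eq[OF assms(3,2) q0]) (simp add: q_def)
  ultimately show ?thesis by simp
qed

end
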